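(* Let $\theta\in\mathbb R$, let $(b_n)_{n\in\mathbb N}$ be an increasing real sequence with $n^{3/10}\ll b_n\ll n^{1/2}$, and let $$p_n(\theta)=\frac{1+\theta\left(\frac{b_n^2}{n}\right)^{1/3}+O\left(\left(\frac{b_n^2}{n}\right)^{2/3}\right)}{n}.$$ Let $L^n=(L^n_k)_{k=1}^n$ be the component-count vector of the Erdős–Rényi graph $\mathcal G(n,p_n(\theta))$, i.e. $L^n_k$ is the number of connected components of size $k$, and let $\mathrm{Me}_n(L^n)=\sum_{k}L^n_k\,\delta_{k/(nb_n)^{2/3}}$. Then the law of $\mathrm{Me}_n(L^n)$ under $\mathbb P_{n,p_n(\theta)}$ satisfies a large deviation principle on $\mathcal M_{\mathbb N}(0,\infty)$ (with the vague topology) with speed $b_n^2$ and rate function $I:\mathcal M_{\mathbb N}(0,\infty)\to[0,\infty]$ defined by $$I(\mu)=-\frac1{24}\int_0^\infty x^3\,d\mu+\frac16\left(\int_0^\infty x\,d\mu-\theta\right)^3\mathbf 1_{\left\{\int_0^\infty x\,d\mu\ge\theta\right\}}+\frac{\theta^3}{6}$$ whenever $\int_0^\infty x\,d\mu<\infty$, and $I(\mu)=\infty$ otherwise.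
   Context: $\mathcal G(n,p)$ is the Erdős–Rényi random graph on vertex set $\{1,\dots,n\}$ in which each pair of vertices is joined by an edge independently with probability $p$; $\mathbb P_{n,p}$ denotes its law. For every $\theta$ one has $p_n(\theta)\in(0,1)$ for $n$ large enough. The notation $a_n\ll c_n$ means $a_n/c_n\to0$ as $n\to\infty$. $\mathcal M_{\mathbb N}(0,\infty)$ is the set of integer-valued measures $\mu$ on $(0,\infty)$ such that $\int f\,d\mu<\infty$ for every continuous, compactly supported $f:(0,\infty)\to\mathbb R$ (i.e. locally finite integer-valued measures), endowed with the vague topology (convergence tested against continuous functions with compact support in $(0,\infty)$). A large deviation principle with speed $b_n^2$ and rate function $I$ means: for every open set $O$, $\liminf_n b_n^{-2}\log\mathbb P_{n,p_n(\theta)}(\mathrm{Me}_n(L^n)\in O)\ge-\inf_{O}I$, and for every closed set $F$, $\limsup_n b_n^{-2}\log\mathbb P_{n,p_n(\theta)}(\mathrm{Me}_n(L^n)\in F)\le-\inf_F I$. *)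

theory Defs
  imports "HOL-Probability.Probability" "HOL-Library.Landau_Symbols"
begin
text \<open>A graph on the vertex set \<open>{1..n}\<close> is represented by its set of edges, each edge being a
  two-element set of vertices.\<close>

definition vertex_pairs :: "nat \<Rightarrow> nat set set" where
  "vertex_pairs n = {e. e \<subseteq> {1..n} \<and> card e = 2}"

text \<open>\<^const>\<open>bernoulli_pmf\<close> truncates its parameter to \<open>[0,1]\<close>, so the definition also makes
  sense (as a junk value) for \<open>p\<close> outside of this interval.\<close>

definition erdos_renyi :: "nat \<Rightarrow> real \<Rightarrow> nat set set pmf" where
  "erdos_renyi n p =
     map_pmf (\<lambda>X. {e \<in> vertex_pairs n. X e}) (Pi_pmf (vertex_pairs n) False (\<lambda>_. bernoulli_pmf p))"

definition connection :: "nat set set \<Rightarrow> (nat \<times> nat) set" where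
  "connection E = {(u, v). {u, v} \<in> E}\<^sup>*"

definition components :: "nat \<Rightarrow> nat set set \<Rightarrow> nat set set" where
  "components n E = {1..n} // connection E"

definition component_count :: "nat \<Rightarrow> nat set set \<Rightarrow> nat \<Rightarrow> nat" where
  "component_count n E k = card {C \<in> components n E. card C = k}"

abbreviation pos_borel :: "real measure" where
  "pos_borel \<equiv> restrict_space borel {0<..}"

text \<open>Continuous functions on \<open>(0,\<infinity>)\<close> with compact support in \<open>(0,\<infinity>)\<close>. The values outside of
  \<open>(0,\<infinity>)\<close> are irrelevant, as only measures on \<^const>\<open>pos_borel\<close> are integrated against.\<close>

definition test_functions :: "(real \<Rightarrow> real) set" where
  "test_functions =
     {f. continuous_on {0<..} f \<and> (\<exists>K. compact K \<and> K \<subseteq> {0<..} \<and> (\<forall>x\<in>{0<..} - K. f x = 0))}"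

text \<open>Integer-valued measures may take the value \<open>\<infinity>\<close> on sets that accumulate at \<open>0\<close> or at
  \<open>\<infinity>\<close>.\<close>

definition int_measures :: "real measure set" where
  "int_measures =
     {\<mu>. sets \<mu> = sets pos_borel \<and>
         (\<forall>A\<in>sets \<mu>. emeasure \<mu> A \<in> range of_nat \<union> {\<infinity>}) \<and>
         (\<forall>f\<in>test_functions. integrable \<mu> f)}"

text \<open>The vague topology is the coarsest topology for which the maps \<open>\<mu> \<mapsto> \<integral> f d\<mu>\<close> are continuous
  for all test functions \<open>f\<close>.\<close>

definition vague_topology :: "real measure topology" where
  "vague_topology = topology_generated_by
     {{\<mu> \<in> int_measures. (LINT x|\<mu>. f x) \<in> U} | f U. f \<in> test_functions \<and> open U}"

text \<open>The library has no sum of measures, so \<open>\<Sum>k. L k \<cdot> \<delta>\<^sub>x\<close> with \<open>x = k / (n b)\<^bsup>2/3\<^esup>\<close> is given by its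
  values on Borel sets. This is meaningful for \<open>n b > 0\<close>.\<close>

definition Me :: "nat \<Rightarrow> real \<Rightarrow> (nat \<Rightarrow> nat) \<Rightarrow> real measure" where
  "Me n b L = measure_of {0<..} (sets pos_borel)
     (\<lambda>A. \<Sum>k=1..n. of_nat (L k) * indicator A (real k / (real n * b) powr (2/3)))"

definition ereal_ln :: "real \<Rightarrow> ereal" where
  "ereal_ln x = (if x > 0 then ereal (ln x) else - \<infinity>)"

text \<open>As the laws are discrete, all sets are measurable. Infima are taken in \<^typ>\<open>ereal\<close>, so the
  infimum over the empty set is \<open>\<infinity>\<close>.\<close>

definition LDP :: "'a topology \<Rightarrow> (nat \<Rightarrow> 'a pmf) \<Rightarrow> (nat \<Rightarrow> real) \<Rightarrow> ('a \<Rightarrow> ereal) \<Rightarrow> bool" where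
  "LDP X P s I \<longleftrightarrow>
     (\<forall>U. openin X U \<longrightarrow>
        liminf (\<lambda>n. ereal (1 / s n) * ereal_ln (measure_pmf.prob (P n) U)) \<ge> - (INF x\<in>U. I x)) \<and>
     (\<forall>F. closedin X F \<longrightarrow>
        limsup (\<lambda>n. ereal (1 / s n) * ereal_ln (measure_pmf.prob (P n) F)) \<le> - (INF x\<in>F. I x))"

text \<open>For an integer-valued measure \<open>\<mu>\<close> with \<open>\<integral> x d\<mu> < \<infinity>\<close> also \<open>\<integral> x\<^sup>3 d\<mu> \<le> (\<integral> x d\<mu>)\<^sup>3\<close> is finite, so
  that both Bochner integrals are genuine.\<close>

definition rate_function :: "real \<Rightarrow> real measure \<Rightarrow> ereal" where
  "rate_function \<theta> \<mu> =
     (if (\<integral>\<^sup>+x. ennreal x \<partial>\<mu>) < \<infinity>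
      then ereal (- (1/24) * (LINT x|\<mu>. x ^ 3)
                  + 1/6 * ((LINT x|\<mu>. x) - \<theta>) ^ 3 * of_bool ((LINT x|\<mu>. x) \<ge> \<theta>)
                  + \<theta> ^ 3 / 6)
      else \<infinity>)"

end

theory Submission
  imports Defs "HOL-Real_Asymp.Real_Asymp"
begin

text \<open>
  Write \<open>v = 1/p\<close>, \<open>a = (n b)\<^bsup>2/3\<^esup>\<close> and \<open>S = b\<^sup>2\<close>. The law of the component counts of \<open>\<G>(n,p)\<close> is a product:
  \<open>P\<^sub>n(L = l) = D\<^sub>n \<Prod>\<^sub>k w\<^sub>k\<^bsup>l k\<^esup> / (l k)!\<close>, where \<open>w\<^sub>k\<close> contains the unknown probability that \<open>\<G>(k,p)\<close> is connected
  but does not depend on \<open>n\<close>. No asymptotic enumeration of connected graphs is needed, because the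
  total mass being \<open>1\<close> for \<^emph>\<open>every\<close> number \<open>N\<close> of vertices gives \<open>w\<^sub>k \<le> N D\<^bsub>N-k\<^esub> / D\<^sub>N\<close>, which is sharp on
  the exponential scale for \<open>N \<approx> v + k/2\<close>, where a component of size \<open>k\<close> is typical. Small
  components are compared with trees, and the generating function of trees is bounded by letting \<open>n\<close>
  tend to infinity in the same normalisation.

  There are only \<open>exp(O(\<surd>n log n)) = exp(o(S))\<close> many count vectors, so it is enough to bound the
  probability of each one. This yields the upper bound (the vague limit of the rescaled sizes is taken
  along a subsequence) and the typical behaviour: without a macroscopic component if \<open>N \<le> v\<close>, and with
  one of size close to \<open>x a\<close> if \<open>N \<approx> v + x a/2\<close>. The second statement gives the matching lower bound
  on \<open>w\<^sub>k\<close>, the first one shows that the vertices outside of prescribed components of total size at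
  least \<open>\<theta> a\<close> form no further macroscopic component, and together they prove the lower bound.
\<close>

section \<open>Decomposition of a random graph along a component\<close>

text \<open>Each term of the rate is the exponent of one factor. Normalised by
  \<open>N * (1 + ln p) + 1 / (2 * p)\<close>, the factor \<open>part_weight p N\<close> at
  \<open>N = v + \<theta> * a\<close> contributes \<open>- \<theta> ^ 3 / 6\<close>, and the weight
  of a component of size \<open>x * a\<close> contributes \<open>x ^ 3 / 24\<close>. If large
  components cover a mass \<open>m > \<theta>\<close>, the other vertices number fewer than
  \<open>v\<close>; tilting the tree series to that number costs
  \<open>(m - \<theta>) ^ 3 / 6\<close>. For \<open>m \<le> \<theta>\<close> the series is evaluated
  at its singularity without any cost, whence the indicator.

  That \<open>N = v + k / 2\<close> is typical for a component of size \<open>k\<close> comes from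
  the identity \<open>t ^ 3 / 6 + (m - t) ^ 3 / 6 - s / 24 = m * (m - 2 * t)\<^sup>2 / 8 + (m ^ 3 -
  s) / 24\<close>: at \<open>N = v + t * a\<close> with \<open>t > 0\<close>, the rate vanishes only
  for one component of size \<open>2 * t * a\<close>. So the upper bound itself locates the giant
  component, and this in turn shows that the upper bound on the weights is sharp.

  The total mass is not vaguely continuous, since dust can carry mass. The upper bound survives
  because the rate increases with the mass; in the lower bound the mass is free to be raised to
  \<theta>.\<close>

definition pairs_of :: "nat set \<Rightarrow> nat set set" where
  "pairs_of V = {e. e \<subseteq> V \<and> card e = 2}"

definition graph_weight :: "real \<Rightarrow> 'a set \<Rightarrow> 'a set \<Rightarrow> real" where
  "graph_weight p S E = (\<Prod>e\<in>S. if e \<in> E then p else 1 - p)"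

definition connected_graph :: "nat set \<Rightarrow> nat set set \<Rightarrow> bool" where
  "connected_graph A F \<longleftrightarrow> (\<forall>u\<in>A. \<forall>w\<in>A. (u, w) \<in> connection F)"

definition size_count :: "nat set \<Rightarrow> nat set set \<Rightarrow> nat \<Rightarrow> nat" where
  "size_count V E k = card {C \<in> V // connection E. card C = k}"

definition conn_prob_on :: "real \<Rightarrow> nat set \<Rightarrow> real" where
  "conn_prob_on p A = (\<Sum>F | F \<subseteq> pairs_of A \<and> connected_graph A F. graph_weight p (pairs_of A) F)"

definition conn_prob :: "real \<Rightarrow> nat \<Rightarrow> real" where
  "conn_prob p k = conn_prob_on p {1..k}"

definition partitions_of :: "nat \<Rightarrow> (nat \<Rightarrow> nat) set" where
  "partitions_of n = {l. (\<forall>k. k \<notin> {1..n} \<longrightarrow> l k = 0) \<and> (\<Sum>k=1..n. k * l k) = n}"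

text \<open>Components of sizes \<open>k\<close> with multiplicities \<open>l k\<close> are
  separated by half of \<open>n\<^sup>2 - (\<Sum>k. k\<^sup>2 * l k)\<close> absent pairs. Splitting
  this difference of squares gives a power of \<open>sqrt (1 - p)\<close> for the whole graph and an
  inverse power for each component, so the weights do not depend on \<open>n\<close>. The
  \<open>fact k\<close> stems from the multinomial coefficient.\<close>

definition comp_weight :: "real \<Rightarrow> nat \<Rightarrow> real" where
  "comp_weight p k = conn_prob p k / (fact k * sqrt (1 - p) ^ k\<^sup>2)"

definition part_weight :: "real \<Rightarrow> nat \<Rightarrow> real" where
  "part_weight p n = fact n * sqrt (1 - p) ^ n\<^sup>2"

definition count_law :: "nat \<Rightarrow> real \<Rightarrow> (nat \<Rightarrow> nat) pmf" where
  "count_law n p = map_pmf (component_count n) (erdos_renyi n p)"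

section \<open>Edge weights on disjoint sets of pairs\<close>

lemma finite_pairs_of [simp]: "finite V \<Longrightarrow> finite (pairs_of V)"
  by (rule finite_subset[of _ "Pow V"]) (auto simp: pairs_of_def)

lemma card_pairs_of: "finite V \<Longrightarrow> card (pairs_of V) = card V choose 2"
  unfolding pairs_of_def by (rule n_subsets)

lemma graph_weight_Un:
  assumes "finite S" "finite T" "S \<inter> T = {}"
  shows "graph_weight p (S \<union> T) E = graph_weight p S (E \<inter> S) * graph_weight p T (E \<inter> T)"
proof -
  have "graph_weight p (S \<union> T) E
      = (\<Prod>e\<in>S. if e \<in> E then p else 1 - p) * (\<Prod>e\<in>T. if e \<in> E then p else 1 - p)"
    unfolding graph_weight_def using assms by (rule prod.union_disjoint)
  then show ?thesis by (simp add: graph_weight_def)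
qed

lemma sum_Pow_Un:
  fixes h :: "'a set \<Rightarrow> 'a set \<Rightarrow> 'b::comm_monoid_add"
  assumes "S \<inter> T = {}"
  shows "(\<Sum>E\<in>Pow (S \<union> T). h (E \<inter> S) (E \<inter> T)) = (\<Sum>E\<in>Pow S. \<Sum>F\<in>Pow T. h E F)"
proof -
  have "(\<Sum>E\<in>Pow (S \<union> T). h (E \<inter> S) (E \<inter> T)) = (\<Sum>(E, F)\<in>Pow S \<times> Pow T. h E F)"
    by (rule sum.reindex_bij_witness[of _ "\<lambda>(E, F). E \<union> F" "\<lambda>E. (E \<inter> S, E \<inter> T)"])
       (use assms in auto)
  then show ?thesis by (simp add: sum.cartesian_product)
qed

text \<open>Independence of the edges in disjoint sets of pairs, as a Fubini theorem for sums over
  subsets.\<close>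

lemma sum_graph_weight_Un:
  assumes "finite S" "finite T" "S \<inter> T = {}"
  shows "(\<Sum>E\<in>Pow (S \<union> T). graph_weight p (S \<union> T) E * (f (E \<inter> S) * g (E \<inter> T)))
       = (\<Sum>E\<in>Pow S. graph_weight p S E * f E) * (\<Sum>E\<in>Pow T. graph_weight p T E * g E)"
proof -
  have "(\<Sum>E\<in>Pow (S \<union> T). graph_weight p (S \<union> T) E * (f (E \<inter> S) * g (E \<inter> T)))
      = (\<Sum>E\<in>Pow (S \<union> T). (graph_weight p S (E \<inter> S) * f (E \<inter> S)) * (graph_weight p T (E \<inter> T) * g (E \<inter> T)))"
    by (intro sum.cong refl) (simp add: graph_weight_Un[OF assms])
  also have "\<dots> = (\<Sum>E\<in>Pow S. \<Sum>F\<in>Pow T. (graph_weight p S E * f E) * (graph_weight p T F * g F))"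
    by (rule sum_Pow_Un[OF assms(3)])
  also have "\<dots> = (\<Sum>E\<in>Pow S. graph_weight p S E * f E) * (\<Sum>E\<in>Pow T. graph_weight p T E * g E)"
    by (simp add: sum_product)
  finally show ?thesis .
qed

lemma sum_graph_weight: "finite S \<Longrightarrow> (\<Sum>E\<in>Pow S. graph_weight p S E) = 1"
proof (induction S rule: finite_induct)
  case empty
  then show ?case by (simp add: graph_weight_def)
next
  case (insert x S)
  have "(\<Sum>E\<in>Pow ({x} \<union> S). graph_weight p ({x} \<union> S) E * (1 * 1))
      = (\<Sum>E\<in>Pow {x}. graph_weight p {x} E * 1) * (\<Sum>E\<in>Pow S. graph_weight p S E * 1)"
    by (rule sum_graph_weight_Un) (use insert in auto)
  moreover have "(\<Sum>E\<in>Pow {x}. graph_weight p {x} E) = 1"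
    by (simp add: graph_weight_def Pow_insert)
  ultimately show ?case using insert by simp
qed

section \<open>The component of a vertex\<close>

lemma equiv_connection: "equiv UNIV (connection E)"
proof -
  have "sym {(u, v). {u, v} \<in> E}" by (auto simp: sym_def insert_commute)
  then show ?thesis
    unfolding connection_def equiv_def
    by (auto simp: refl_on_def trans_rtrancl sym_rtrancl)
qed

lemma connection_refl [simp]: "(u, u) \<in> connection E"
  by (simp add: connection_def)

lemma connection_sym: "(u, v) \<in> connection E \<Longrightarrow> (v, u) \<in> connection E"
  using equiv_connection[of E] by (auto simp: equiv_def sym_def)

lemma connection_trans: "(u, v) \<in> connection E \<Longrightarrow> (v, w) \<in> connection E \<Longrightarrow> (u, w) \<in> connection E"
  by (simp add: connection_def)

lemma connection_mono: "E \<subseteq> F \<Longrightarrow> connection E \<subseteq> connection F"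
  unfolding connection_def by (rule rtrancl_mono) auto

lemma connection_edge: "{u, v} \<in> E \<Longrightarrow> (u, v) \<in> connection E"
  by (auto simp: connection_def)

text \<open>No edge crosses the boundary of \<open>A\<close>, so a path that starts in
  \<open>A\<close> stays there and uses only pairs inside \<open>A\<close>.\<close>

lemma connection_restrict:
  assumes "E \<subseteq> pairs_of V" and cross: "\<And>e. e \<in> E \<Longrightarrow> e \<subseteq> A \<or> e \<inter> A = {}"
    and "(u, w) \<in> connection E" and "u \<in> A"
  shows "w \<in> A \<and> (u, w) \<in> connection (E \<inter> pairs_of A)"
  using assms(3)[unfolded connection_def]
proof (induction rule: rtrancl_induct)
  case base
  then show ?case using assms by simp
next
  case (step y z)
  then have e: "{y, z} \<in> E" and y: "y \<in> A" "(u, y) \<in> connection (E \<inter> pairs_of A)" by auto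
  have sub: "{y, z} \<subseteq> A" using cross[OF e] y by auto
  have "{y, z} \<in> pairs_of A" using e sub assms(1) by (auto simp: pairs_of_def)
  then have "(y, z) \<in> connection (E \<inter> pairs_of A)" using e by (intro connection_edge) auto
  then show ?case using connection_trans[OF y(2)] sub by blast
qed

lemma connection_class_cross:
  assumes "e \<in> E" "card e = 2"
  shows "e \<subseteq> connection E `` {v} \<or> e \<inter> connection E `` {v} = {}"
proof -
  obtain x y where e: "e = {x, y}" using assms(2) by (auto simp: card_2_iff)
  have "(x, y) \<in> connection E" "(y, x) \<in> connection E"
    using assms(1) e by (auto intro!: connection_edge simp: insert_commute)
  then show ?thesis unfolding e by (auto intro: connection_trans)
qed

lemma connection_class_subset:
  assumes "E \<subseteq> pairs_of V" "v \<in> V"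
  shows "connection E `` {v} \<subseteq> V"
  using connection_restrict[OF assms(1), of V v] assms by (auto simp: pairs_of_def)

text \<open>Rewrites the event as one about pairs inside \<open>A\<close> and one about crossing
  pairs, leaving the pairs inside \<open>V - A\<close> free. The three sets of pairs are disjoint,
  so that independence applies.\<close>

lemma component_eq_iff:
  assumes E: "E \<subseteq> pairs_of V" and v: "v \<in> A" and A: "A \<subseteq> V"
  shows "connection E `` {v} = A \<longleftrightarrow>
    connected_graph A (E \<inter> pairs_of A) \<and> E \<inter> (pairs_of V - pairs_of A - pairs_of (V - A)) = {}"
    (is "?l \<longleftrightarrow> ?c \<and> ?x")
proof
  assume l: ?l
  have cross: "e \<subseteq> A \<or> e \<inter> A = {}" if "e \<in> E" for e
    using connection_class_cross[of e E v] that E l by (auto simp: pairs_of_def)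
  have ?c unfolding connected_graph_def
  proof (intro ballI)
    fix u w assume "u \<in> A" "w \<in> A"
    then have "(v, u) \<in> connection E" "(v, w) \<in> connection E" using l by auto
    then have "(u, w) \<in> connection E" by (meson connection_sym connection_trans)
    then show "(u, w) \<in> connection (E \<inter> pairs_of A)"
      using connection_restrict[OF E cross _ \<open>u \<in> A\<close>] by blast
  qed
  moreover have ?x using cross E by (fastforce simp: pairs_of_def)
  ultimately show "?c \<and> ?x" by simp
next
  assume r: "?c \<and> ?x"
  have cross: "e \<subseteq> A \<or> e \<inter> A = {}" if "e \<in> E" for e
    using r that E by (fastforce simp: pairs_of_def)
  have "A \<subseteq> connection E `` {v}"
    using r v connection_mono[of "E \<inter> pairs_of A" E] by (auto simp: connected_graph_def)
  moreover have "connection E `` {v} \<subseteq> A"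
    using connection_restrict[OF E cross _ v] by auto
  ultimately show ?l by simp
qed

lemma components_split:
  assumes E: "E \<subseteq> pairs_of V" and v: "v \<in> V" and A: "connection E `` {v} = A"
  shows "V // connection E = insert A ((V - A) // connection (E \<inter> pairs_of (V - A)))"
proof -
  have AV: "A \<subseteq> V" using connection_class_subset[OF E v] A by simp
  have cross: "e \<subseteq> V - A \<or> e \<inter> (V - A) = {}" if "e \<in> E" for e
    using connection_class_cross[of e E v] that E A by (auto simp: pairs_of_def)
  have eq: "connection E `` {u} = connection (E \<inter> pairs_of (V - A)) `` {u}" if "u \<in> V - A" for u
    using connection_restrict[OF E cross _ that] connection_mono[of "E \<inter> pairs_of (V - A)" E] by blast
  have cl: "connection E `` {u} = A" if "u \<in> A" for u
    using that A equiv_connection[of E] by (metis Image_singleton_iff equiv_class_eq)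
  have VA: "V = A \<union> (V - A)" using AV by auto
  have img: "W // connection F = (\<lambda>u. connection F `` {u}) ` W" for W F
    by (auto simp: quotient_def)
  have vA: "v \<in> A" unfolding A[symmetric] by simp
  have "(\<lambda>u. connection E `` {u}) ` A = (\<lambda>_. A) ` A"
    by (rule image_cong[OF refl]) (rule cl)
  then have A1: "(\<lambda>u. connection E `` {u}) ` A = {A}"
    by (simp only: image_constant[OF vA])
  have A2: "(\<lambda>u. connection E `` {u}) ` (V - A) = (V - A) // connection (E \<inter> pairs_of (V - A))"
    unfolding img by (rule image_cong[OF refl]) (rule eq)
  have "V // connection E = (\<lambda>u. connection E `` {u}) ` (A \<union> (V - A))"
    unfolding img by (subst VA) (rule refl)
  then show ?thesis unfolding image_Un A1 A2 by simp
qed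

lemma size_count_split:
  assumes "finite V" and E: "E \<subseteq> pairs_of V" and v: "v \<in> V" and A: "connection E `` {v} = A"
  shows "size_count V E = (size_count (V - A) (E \<inter> pairs_of (V - A)))
     (card A := Suc (size_count (V - A) (E \<inter> pairs_of (V - A)) (card A)))"
proof
  fix k
  let ?Q = "(V - A) // connection (E \<inter> pairs_of (V - A))"
  have fin: "finite ?Q" using assms(1) by (auto simp: quotient_def)
  have "v \<in> A" using A by auto
  moreover have "C \<subseteq> V - A" if "C \<in> ?Q" for C
    using that connection_class_subset[of "E \<inter> pairs_of (V - A)" "V - A"] by (auto elim!: quotientE)
  ultimately have nin: "A \<notin> ?Q" by auto
  have "{C \<in> V // connection E. card C = k} =
     (if card A = k then insert A {C \<in> ?Q. card C = k} else {C \<in> ?Q. card C = k})"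
    unfolding components_split[OF E v A] by auto
  then show "size_count V E k = ((size_count (V - A) (E \<inter> pairs_of (V - A)))
     (card A := Suc (size_count (V - A) (E \<inter> pairs_of (V - A)) (card A)))) k"
    using fin nin by (auto simp: size_count_def)
qed

lemma card_cross_pairs:
  assumes "finite V" "A \<subseteq> V"
  shows "card (pairs_of V - pairs_of A - pairs_of (V - A)) = card A * (card V - card A)"
proof -
  have fA: "finite A" using assms finite_subset by blast
  have disj: "pairs_of A \<inter> pairs_of (V - A) = {}"
  proof -
    have "e = {}" if "e \<in> pairs_of A" "e \<in> pairs_of (V - A)" for e
      using that by (auto simp: pairs_of_def)
    moreover have "{} \<notin> pairs_of A" by (simp add: pairs_of_def)
    ultimately show ?thesis by blast
  qed
  have set_diff_diff_eq: "pairs_of V - pairs_of A - pairs_of (V - A) = pairs_of V - (pairs_of A \<union> pairs_of (V - A))"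
    by auto
  have sub: "pairs_of A \<union> pairs_of (V - A) \<subseteq> pairs_of V"
    using assms(2) by (auto simp: pairs_of_def)
  have "card (pairs_of V - (pairs_of A \<union> pairs_of (V - A)))
      = card (pairs_of V) - card (pairs_of A \<union> pairs_of (V - A))"
    by (rule card_Diff_subset) (use assms fA sub in auto)
  also have "\<dots> = (card V choose 2) - ((card A choose 2) + ((card V - card A) choose 2))"
    using assms fA disj by (simp add: card_Un_disjoint card_pairs_of card_Diff_subset)
  also have "\<dots> = card A * (card V - card A)"
  proof -
    obtain j where j: "card V = card A + j" using card_mono[OF assms(1,2)] le_Suc_ex by blast
    have two: "2 * (m choose 2) = m * (m - 1)" for m :: nat
    proof -
      have "even (m * (m - 1))" by (cases "even m") auto
      then show ?thesis by (simp add: choose_two)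
    qed
    have "2 * ((card A + j) choose 2) = 2 * ((card A choose 2) + (j choose 2) + card A * j)"
      unfolding two distrib_left by (cases "card A"; cases j) (auto simp: algebra_simps)
    then show ?thesis using j by simp
  qed
  finally show ?thesis by (simp only: set_diff_diff_eq)
qed

text \<open>Total probability over the component \<open>A\<close> of a fixed vertex. A constant
  \<open>f\<close> yields the mass-one identity for the component of a vertex, the indicator of a
  count vector yields the recursion for the law.\<close>

lemma sum_component_decomposition:
  fixes f :: "(nat \<Rightarrow> nat) \<Rightarrow> real"
  assumes V: "finite V" "v \<in> V"
  shows "(\<Sum>E\<in>Pow (pairs_of V). graph_weight p (pairs_of V) E * f (size_count V E)) =
    (\<Sum>A | v \<in> A \<and> A \<subseteq> V. conn_prob_on p A * (1 - p) ^ (card A * (card V - card A)) *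
       (\<Sum>E\<in>Pow (pairs_of (V - A)). graph_weight p (pairs_of (V - A)) E *
          f ((size_count (V - A) E)(card A := Suc (size_count (V - A) E (card A))))))"
proof -
  let ?P = "pairs_of V"
  have "(\<Sum>E\<in>Pow ?P. graph_weight p ?P E * f (size_count V E)) =
     (\<Sum>A | v \<in> A \<and> A \<subseteq> V. \<Sum>E | E \<in> Pow ?P \<and> connection E `` {v} = A. graph_weight p ?P E * f (size_count V E))"
    by (rule sum.group[symmetric]) (use V connection_class_subset[of _ V v] in auto)
  also have "\<dots> = (\<Sum>A | v \<in> A \<and> A \<subseteq> V. conn_prob_on p A * (1 - p) ^ (card A * (card V - card A)) *
       (\<Sum>E\<in>Pow (pairs_of (V - A)). graph_weight p (pairs_of (V - A)) E *
          f ((size_count (V - A) E)(card A := Suc (size_count (V - A) E (card A))))))"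
  proof (rule sum.cong[OF refl])
    fix A assume "A \<in> {A. v \<in> A \<and> A \<subseteq> V}"
    then have A: "v \<in> A" "A \<subseteq> V" by auto
    have fA: "finite A" using A V finite_subset by blast
    \<comment> \<open>\<open>S1\<close> decides whether \<open>A\<close> is connected,
      \<open>S3\<close> whether it is isolated from the rest, and \<open>S2\<close> carries the
      graph that remains.\<close>
    define S1 S2 S3 where "S1 = pairs_of A" and "S2 = pairs_of (V - A)" and "S3 = ?P - S1 - S2"
    have fin: "finite S1" "finite S2" "finite S3" using V fA by (auto simp: S1_def S2_def S3_def)
    have P: "?P = S1 \<union> (S2 \<union> S3)" using A by (auto simp: S1_def S2_def S3_def pairs_of_def)
    have d: "S1 \<inter> (S2 \<union> S3) = {}" "S2 \<inter> S3 = {}"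
    proof -
      have "e \<notin> S2" if "e \<in> S1" for e
      proof
        assume "e \<in> S2"
        then have "e = {}" "card e = 2" using that by (auto simp: S1_def S2_def pairs_of_def)
        then show False by simp
      qed
      then show "S1 \<inter> (S2 \<union> S3) = {}" "S2 \<inter> S3 = {}" by (auto simp: S3_def)
    qed
    define g where "g E = f ((size_count (V - A) E)(card A := Suc (size_count (V - A) E (card A))))" for E
    have "(\<Sum>E | E \<in> Pow ?P \<and> connection E `` {v} = A. graph_weight p ?P E * f (size_count V E))
       = (\<Sum>E\<in>Pow ?P. graph_weight p ?P E * (of_bool (connected_graph A (E \<inter> S1)) *
             (g (E \<inter> (S2 \<union> S3) \<inter> S2) * of_bool (E \<inter> (S2 \<union> S3) \<inter> S3 = {}))))"
    proof (rule sum.mono_neutral_cong_left)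
      show "\<forall>E\<in>Pow ?P - {E \<in> Pow ?P. connection E `` {v} = A}. graph_weight p ?P E *
          (of_bool (connected_graph A (E \<inter> S1)) * (g (E \<inter> (S2 \<union> S3) \<inter> S2) * of_bool (E \<inter> (S2 \<union> S3) \<inter> S3 = {}))) = 0"
      proof
        fix E assume E: "E \<in> Pow ?P - {E \<in> Pow ?P. connection E `` {v} = A}"
        have "E \<inter> (S2 \<union> S3) \<inter> S3 = E \<inter> S3" by auto
        then have "\<not> (connected_graph A (E \<inter> S1) \<and> E \<inter> (S2 \<union> S3) \<inter> S3 = {})"
          using component_eq_iff[of E V v A] E A by (auto simp: S1_def S2_def S3_def)
        then show "graph_weight p ?P E * (of_bool (connected_graph A (E \<inter> S1)) *
          (g (E \<inter> (S2 \<union> S3) \<inter> S2) * of_bool (E \<inter> (S2 \<union> S3) \<inter> S3 = {}))) = 0" by auto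
      qed
      fix E assume E: "E \<in> {E \<in> Pow ?P. connection E `` {v} = A}"
      have i: "E \<inter> (S2 \<union> S3) \<inter> S3 = E \<inter> S3" "E \<inter> (S2 \<union> S3) \<inter> S2 = E \<inter> S2" by auto
      have "connected_graph A (E \<inter> S1) \<and> E \<inter> S3 = {}"
        using component_eq_iff[of E V v A] E A by (auto simp: S1_def S2_def S3_def)
      moreover have "f (size_count V E) = g (E \<inter> S2)"
        using size_count_split[of V E v A] E V by (simp add: g_def S2_def)
      ultimately show "graph_weight p ?P E * f (size_count V E) = graph_weight p ?P E *
          (of_bool (connected_graph A (E \<inter> S1)) * (g (E \<inter> (S2 \<union> S3) \<inter> S2) * of_bool (E \<inter> (S2 \<union> S3) \<inter> S3 = {})))"
        by (simp add: i)
    qed (use V in auto)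
    also have "\<dots> = (\<Sum>E\<in>Pow S1. graph_weight p S1 E * of_bool (connected_graph A E)) *
        (\<Sum>E\<in>Pow (S2 \<union> S3). graph_weight p (S2 \<union> S3) E * (g (E \<inter> S2) * of_bool (E \<inter> S3 = {})))"
      unfolding P by (rule sum_graph_weight_Un) (use fin d in auto)
    also have "(\<Sum>E\<in>Pow (S2 \<union> S3). graph_weight p (S2 \<union> S3) E * (g (E \<inter> S2) * of_bool (E \<inter> S3 = {})))
       = (\<Sum>E\<in>Pow S2. graph_weight p S2 E * g E) * (\<Sum>E\<in>Pow S3. graph_weight p S3 E * of_bool (E = {}))"
      by (rule sum_graph_weight_Un) (use fin d in auto)
    also have "(\<Sum>E\<in>Pow S3. graph_weight p S3 E * of_bool (E = {})) = (\<Sum>E\<in>{{}}. graph_weight p S3 E)"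
      by (rule sum.mono_neutral_cong_right) (use fin in auto)
    also have "\<dots> = (1 - p) ^ (card A * (card V - card A))"
      using card_cross_pairs[of V A] V A by (simp add: graph_weight_def S1_def S2_def S3_def)
    also have "(\<Sum>E\<in>Pow S1. graph_weight p S1 E * of_bool (connected_graph A E)) = conn_prob_on p A"
      unfolding conn_prob_on_def S1_def
      by (rule sum.mono_neutral_cong_right) (use fin in \<open>auto simp: S1_def\<close>)
    finally show "(\<Sum>E | E \<in> Pow ?P \<and> connection E `` {v} = A. graph_weight p ?P E * f (size_count V E))
      = conn_prob_on p A * (1 - p) ^ (card A * (card V - card A)) *
       (\<Sum>E\<in>Pow (pairs_of (V - A)). graph_weight p (pairs_of (V - A)) E *
          f ((size_count (V - A) E)(card A := Suc (size_count (V - A) E (card A)))))"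
      by (simp add: g_def S2_def mult_ac)
  qed
  finally show ?thesis .
qed

lemma sum_over_subsets_containing:
  fixes g :: "nat \<Rightarrow> real"
  assumes "finite V" "v \<in> V"
  shows "(\<Sum>A | v \<in> A \<and> A \<subseteq> V. g (card A)) = (\<Sum>k=1..card V. real ((card V - 1) choose (k - 1)) * g k)"
proof -
  have "(\<Sum>A | v \<in> A \<and> A \<subseteq> V. g (card A))
      = (\<Sum>k=1..card V. \<Sum>A | A \<in> {A. v \<in> A \<and> A \<subseteq> V} \<and> card A = k. g (card A))"
  proof (rule sum.group[symmetric])
    show "card ` {A. v \<in> A \<and> A \<subseteq> V} \<subseteq> {1..card V}"
    proof safe
      fix A assume A: "v \<in> A" "A \<subseteq> V"
      then have "finite A" using assms finite_subset by blast
      then have "card A \<noteq> 0" using A by auto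
      then show "card A \<in> {1..card V}" using card_mono[OF assms(1) A(2)] by simp
    qed
  qed (use assms in auto)
  also have "\<dots> = (\<Sum>k=1..card V. real ((card V - 1) choose (k - 1)) * g k)"
  proof (rule sum.cong[OF refl])
    fix k assume k: "k \<in> {1..card V}"
    have "bij_betw (insert v) {B. B \<subseteq> V - {v} \<and> card B = k - 1} {A. v \<in> A \<and> A \<subseteq> V \<and> card A = k}"
    proof (rule bij_betwI[where g = "\<lambda>A. A - {v}"])
      show "insert v \<in> {B. B \<subseteq> V - {v} \<and> card B = k - 1} \<rightarrow> {A. v \<in> A \<and> A \<subseteq> V \<and> card A = k}"
      proof
        fix B assume B: "B \<in> {B. B \<subseteq> V - {v} \<and> card B = k - 1}"
        then have "finite B" using assms finite_subset[of B V] by auto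
        then show "insert v B \<in> {A. v \<in> A \<and> A \<subseteq> V \<and> card A = k}"
          using B k assms by (subst mem_Collect_eq, subst card_insert_disjoint) auto
      qed
    qed (use assms in auto)
    then have "card {A. v \<in> A \<and> A \<subseteq> V \<and> card A = k} = (card V - 1) choose (k - 1)"
      using n_subsets[of "V - {v}" "k - 1"] assms by (simp add: bij_betw_same_card[symmetric])
    then show "(\<Sum>A | A \<in> {A. v \<in> A \<and> A \<subseteq> V} \<and> card A = k. g (card A))
       = real ((card V - 1) choose (k - 1)) * g k"
      by (simp add: conj_assoc)
  qed
  finally show ?thesis .
qed

lemma sum_conn_prob_on:
  assumes "finite V" "v \<in> V"
  shows "(\<Sum>A | v \<in> A \<and> A \<subseteq> V. conn_prob_on p A * (1 - p) ^ (card A * (card V - card A))) = 1"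
  using sum_component_decomposition[OF assms, of p "\<lambda>_. 1"] assms
  by (simp add: sum_graph_weight)

text \<open>Invariance under relabelling by strong induction instead of bijections: the mass-one
  identity expresses the value for \<open>W\<close> through strictly smaller sets, and by the
  induction hypothesis that expression depends on \<open>card W\<close> only.\<close>

lemma conn_prob_on_eq: "finite V \<Longrightarrow> V \<noteq> {} \<Longrightarrow> conn_prob_on p V = conn_prob p (card V)"
proof (induction "card V" arbitrary: V rule: less_induct)
  case less
  define n where "n = card V"
  have key: "conn_prob_on p W = 1 - (\<Sum>k=1..n. real ((n - 1) choose (k - 1)) *
      (if k < n then conn_prob p k * (1 - p) ^ (k * (n - k)) else 0))"
    if W: "finite W" "W \<noteq> {}" "card W = n" for W
  proof -
    obtain v where v: "v \<in> W" using W by auto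
    have fin: "finite {A. v \<in> A \<and> A \<subset> W}"
      by (rule finite_subset[of _ "Pow W"]) (use W in auto)
    have ne: "{A. v \<in> A \<and> A \<subseteq> W} = insert W {A. v \<in> A \<and> A \<subset> W}" using v by auto
    have "1 = conn_prob_on p W +
       (\<Sum>A | v \<in> A \<and> A \<subset> W. conn_prob_on p A * (1 - p) ^ (card A * (card W - card A)))"
      using sum_conn_prob_on[OF W(1) v, of p] unfolding ne
      by (subst (asm) sum.insert) (use W fin in auto)
    also have "(\<Sum>A | v \<in> A \<and> A \<subset> W. conn_prob_on p A * (1 - p) ^ (card A * (card W - card A)))
       = (\<Sum>A | v \<in> A \<and> A \<subseteq> W. if card A < n then conn_prob p (card A) * (1 - p) ^ (card A * (n - card A)) else 0)"
    proof (rule sum.mono_neutral_cong_left)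
      fix A assume "A \<in> {A. v \<in> A \<and> A \<subset> W}"
      then have A: "v \<in> A" "A \<subset> W" by auto
      then have "card A < n" "finite A"
        using W psubset_card_mono[of W A] finite_subset[of A W] by auto
      then show "conn_prob_on p A * (1 - p) ^ (card A * (card W - card A)) =
         (if card A < n then conn_prob p (card A) * (1 - p) ^ (card A * (n - card A)) else 0)"
        using less(1)[of A] A W n_def by auto
    qed (use W in auto)
    also have "\<dots> = (\<Sum>k=1..card W. real ((card W - 1) choose (k - 1)) *
      (if k < n then conn_prob p k * (1 - p) ^ (k * (n - k)) else 0))"
      using sum_over_subsets_containing[OF W(1) v, of "\<lambda>k. if k < n then conn_prob p k * (1 - p) ^ (k * (n - k)) else 0"]
      by simp
    finally show ?thesis using W by simp
  qed
  have "n > 0" using less(2,3) n_def by (simp add: card_gt_0_iff)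
  then have "conn_prob p n = conn_prob_on p V"
    unfolding conn_prob_def using key[of V] key[of "{1..n}"] less(2,3) n_def by simp
  then show ?case by (simp add: n_def)
qed

text \<open>The law of the size of the component of vertex \<open>1\<close>. Discarding terms of
  this sum gives both the upper bound on component weights and the bound on the tree series.\<close>

lemma sum_conn_prob:
  assumes "n \<ge> 1"
  shows "(\<Sum>k=1..n. real ((n - 1) choose (k - 1)) * (conn_prob p k * (1 - p) ^ (k * (n - k)))) = 1"
proof -
  have "1 = (\<Sum>A | 1 \<in> A \<and> A \<subseteq> {1..n}. conn_prob_on p A * (1 - p) ^ (card A * (card {1..n} - card A)))"
    using sum_conn_prob_on[of "{1..n}" 1 p] assms by simp
  also have "\<dots> = (\<Sum>A | 1 \<in> A \<and> A \<subseteq> {1..n}. (\<lambda>k. conn_prob p k * (1 - p) ^ (k * (n - k))) (card A))"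
  proof (rule sum.cong[OF refl])
    fix A assume A: "A \<in> {A. 1 \<in> A \<and> A \<subseteq> {1..n}}"
    then have "finite A" "A \<noteq> {}" using finite_subset[of A "{1..n}"] by auto
    then show "conn_prob_on p A * (1 - p) ^ (card A * (card {1..n} - card A)) =
       conn_prob p (card A) * (1 - p) ^ (card A * (n - card A))"
      by (simp add: conn_prob_on_eq)
  qed
  also have "\<dots> = (\<Sum>k=1..n. real ((n - 1) choose (k - 1)) * (conn_prob p k * (1 - p) ^ (k * (n - k))))"
    using sum_over_subsets_containing[of "{1..n}" 1 "\<lambda>k. conn_prob p k * (1 - p) ^ (k * (n - k))"] assms by simp
  finally show ?thesis by simp
qed

section \<open>The law of the component counts\<close>

lemma partitions_of_iff:
  assumes "n \<le> R"
  shows "l \<in> partitions_of n \<longleftrightarrow> (\<forall>k. k \<notin> {1..R} \<longrightarrow> l k = 0) \<and> (\<Sum>k=1..R. k * l k) = n"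
proof
  assume l: "l \<in> partitions_of n"
  have "(\<Sum>k=1..R. k * l k) = (\<Sum>k=1..n. k * l k)"
    by (rule sum.mono_neutral_right) (use l assms in \<open>auto simp: partitions_of_def\<close>)
  then show "(\<forall>k. k \<notin> {1..R} \<longrightarrow> l k = 0) \<and> (\<Sum>k=1..R. k * l k) = n"
    using l assms by (auto simp: partitions_of_def)
next
  assume r: "(\<forall>k. k \<notin> {1..R} \<longrightarrow> l k = 0) \<and> (\<Sum>k=1..R. k * l k) = n"
  have z: "l k = 0" if "k \<notin> {1..n}" for k
  proof (rule ccontr)
    assume nz: "l k \<noteq> 0"
    have k: "k \<in> {1..R}" using conjunct1[OF r] nz by metis
    then have "k * l k \<le> (\<Sum>k=1..R. k * l k)"
      by (intro member_le_sum) auto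
    moreover have "k * 1 \<le> k * l k" using nz by (intro mult_le_mono) auto
    ultimately have "k \<le> n" using conjunct2[OF r] by linarith
    then show False using that k by simp
  qed
  have "(\<Sum>k=1..R. k * l k) = (\<Sum>k=1..n. k * l k)"
    by (rule sum.mono_neutral_right) (use z assms in auto)
  then show "l \<in> partitions_of n" using r z by (auto simp: partitions_of_def)
qed

lemma partitions_of_support: "l \<in> partitions_of n \<Longrightarrow> l k \<noteq> 0 \<Longrightarrow> 1 \<le> k \<and> k \<le> n"
proof -
  assume l: "l \<in> partitions_of n" "l k \<noteq> 0"
  have "\<forall>k. k \<notin> {1..n} \<longrightarrow> l k = 0" using l(1) unfolding partitions_of_def by blast
  then have "k \<in> {1..n}" using l(2) by metis
  then show ?thesis by simp
qed

lemma partitions_of_add: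
  assumes "l \<in> partitions_of m" "1 \<le> k"
  shows "l(k := Suc (l k)) \<in> partitions_of (m + k)"
proof -
  have l: "\<forall>j. j \<notin> {1..m + k} \<longrightarrow> l j = 0" "(\<Sum>j=1..m + k. j * l j) = m"
    using assms(1) partitions_of_iff[of m "m + k" l] by auto
  have k: "k \<in> {1..m + k}" using assms by auto
  have "(\<Sum>j=1..m + k. j * (l(k := Suc (l k))) j)
      = k * Suc (l k) + (\<Sum>j\<in>{1..m + k} - {k}. j * (l(k := Suc (l k))) j)"
    using k by (subst sum.remove[of _ k]) auto
  also have "(\<Sum>j\<in>{1..m + k} - {k}. j * (l(k := Suc (l k))) j) = (\<Sum>j\<in>{1..m + k} - {k}. j * l j)"
    by (intro sum.cong) auto
  also have "k * Suc (l k) + \<dots> = k + (\<Sum>j=1..m + k. j * l j)"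
    using k by (subst (2) sum.remove[of _ k]) auto
  finally show ?thesis using l k by (subst partitions_of_iff[of _ "m + k"]) auto
qed

lemma partitions_of_remove:
  assumes "l \<in> partitions_of n" "l k \<noteq> 0"
  shows "l(k := l k - 1) \<in> partitions_of (n - k)"
proof -
  have k: "k \<in> {1..n}" using partitions_of_support[OF assms] by auto
  have l: "\<forall>j. j \<notin> {1..n} \<longrightarrow> l j = 0" "(\<Sum>j=1..n. j * l j) = n"
    using assms(1) by (auto simp: partitions_of_def)
  have "n = k * l k + (\<Sum>j\<in>{1..n} - {k}. j * l j)"
    using k l(2) by (subst (asm) sum.remove[of _ k]) auto
  moreover have "(\<Sum>j\<in>{1..n} - {k}. j * l j) = (\<Sum>j\<in>{1..n} - {k}. j * (l(k := l k - 1)) j)"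
    by (intro sum.cong) auto
  moreover have "k * l k = k * (l k - 1) + k"
    using assms(2) by (cases "l k") auto
  moreover have "(\<Sum>j=1..n. j * (l(k := l k - 1)) j)
      = k * (l k - 1) + (\<Sum>j\<in>{1..n} - {k}. j * (l(k := l k - 1)) j)"
    using k by (subst sum.remove[of _ k]) auto
  ultimately have "(\<Sum>j=1..n. j * (l(k := l k - 1)) j) = n - k" by linarith
  then show ?thesis using l k by (subst partitions_of_iff[of _ n]) auto
qed

lemma finite_partitions_of: "finite (partitions_of n)"
proof (rule finite_subset)
  show "partitions_of n \<subseteq> {f. \<forall>k. (k \<in> {1..n} \<longrightarrow> f k \<in> {0..n}) \<and> (k \<notin> {1..n} \<longrightarrow> f k = 0)}"
  proof
    fix l assume l: "l \<in> partitions_of n"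
    have "l k \<le> n" if "k \<in> {1..n}" for k
    proof -
      have "k * l k \<le> (\<Sum>k=1..n. k * l k)" using that by (intro member_le_sum) auto
      moreover have "1 * l k \<le> k * l k" using that by (intro mult_le_mono) auto
      moreover have "(\<Sum>k=1..n. k * l k) = n" using l by (simp add: partitions_of_def)
      ultimately show ?thesis by linarith
    qed
    then show "l \<in> {f. \<forall>k. (k \<in> {1..n} \<longrightarrow> f k \<in> {0..n}) \<and> (k \<notin> {1..n} \<longrightarrow> f k = 0)}"
      using l by (auto simp: partitions_of_def)
  qed
  show "finite {f :: nat \<Rightarrow> nat. \<forall>k. (k \<in> {1..n} \<longrightarrow> f k \<in> {0..n}) \<and> (k \<notin> {1..n} \<longrightarrow> f k = 0)}"
    by (rule finite_set_of_finite_funs) auto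
qed

text \<open>The range \<open>R\<close> is independent of the number of vertices, so the index set
  stays the same when components are added or removed.\<close>

definition part_prod :: "real \<Rightarrow> nat \<Rightarrow> (nat \<Rightarrow> nat) \<Rightarrow> real" where
  "part_prod p R l = (\<Prod>k=1..R. comp_weight p k ^ l k / fact (l k))"

lemma part_prod_Suc:
  assumes "k \<in> {1..R}"
  shows "part_prod p R (l(k := Suc (l k))) = part_prod p R l * comp_weight p k / real (Suc (l k))"
proof -
  have "part_prod p R (l(k := Suc (l k))) = comp_weight p k ^ Suc (l k) / fact (Suc (l k)) *
      (\<Prod>j\<in>{1..R} - {k}. comp_weight p j ^ (l(k := Suc (l k))) j / fact ((l(k := Suc (l k))) j))"
    unfolding part_prod_def using assms by (subst prod.remove[of _ k]) auto
  also have "(\<Prod>j\<in>{1..R} - {k}. comp_weight p j ^ (l(k := Suc (l k))) j / fact ((l(k := Suc (l k))) j))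
      = (\<Prod>j\<in>{1..R} - {k}. comp_weight p j ^ l j / fact (l j))"
    by (intro prod.cong) auto
  also have "comp_weight p k ^ Suc (l k) / fact (Suc (l k)) * \<dots> =
     (comp_weight p k ^ l k / fact (l k) * \<dots>) * comp_weight p k / real (Suc (l k))"
    by (simp add: field_simps)
  also have "comp_weight p k ^ l k / fact (l k) *
     (\<Prod>j\<in>{1..R} - {k}. comp_weight p j ^ l j / fact (l j)) = part_prod p R l"
    unfolding part_prod_def using assms by (subst (2) prod.remove[of _ k]) auto
  finally show ?thesis .
qed

lemma conn_prob_comp_weight:
  assumes "p < 1"
  shows "conn_prob p k = comp_weight p k * (fact k * sqrt (1 - p) ^ k\<^sup>2)"
  using assms by (simp add: comp_weight_def)

text \<open>Induction along the component of one vertex. If it has size \<open>k\<close>, the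
  formula for \<open>l(k := l k - 1)\<close> returns the claimed value times
  \<open>k * l k / n\<close>, the chance that the vertex lies in a component of that size. These
  fractions add up to one because \<open>l\<close> is a partition of \<open>n\<close>.\<close>

lemma size_count_sum:
  assumes p: "0 \<le> p" "p < 1"
  shows "finite V \<Longrightarrow> l \<in> partitions_of (card V) \<Longrightarrow> card V \<le> R \<Longrightarrow>
    (\<Sum>E\<in>Pow (pairs_of V). graph_weight p (pairs_of V) E * of_bool (size_count V E = l))
      = part_weight p (card V) * part_prod p R l"
proof (induction "card V" arbitrary: V l rule: less_induct)
  case less
  define n where "n = card V"
  define s where "s = sqrt (1 - p)"
  have s2: "1 - p = s\<^sup>2" using p by (simp add: s_def)
  show ?case
  proof (cases "V = {}")
    case True
    have "pairs_of {} = {}" by (auto simp: pairs_of_def)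
    moreover have "size_count {} {} = l"
      using less(3) True by (auto simp: size_count_def partitions_of_def)
    moreover have "part_prod p R l = 1"
      using less(3) True by (auto simp: part_prod_def partitions_of_def)
    ultimately show ?thesis using True by (simp add: graph_weight_def part_weight_def)
  next
    case False
    then obtain v where v: "v \<in> V" by auto
    define g where "g k = conn_prob p k * (1 - p) ^ (k * (n - k)) *
       (if l k = 0 then 0 else part_weight p (n - k) * part_prod p R (l(k := l k - 1)))" for k
    have "(\<Sum>E\<in>Pow (pairs_of V). graph_weight p (pairs_of V) E * of_bool (size_count V E = l))
       = (\<Sum>A | v \<in> A \<and> A \<subseteq> V. conn_prob_on p A * (1 - p) ^ (card A * (card V - card A)) *
       (\<Sum>E\<in>Pow (pairs_of (V - A)). graph_weight p (pairs_of (V - A)) E *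
          of_bool ((size_count (V - A) E)(card A := Suc (size_count (V - A) E (card A))) = l)))"
      by (rule sum_component_decomposition[OF less(2) v])
    also have "\<dots> = (\<Sum>A | v \<in> A \<and> A \<subseteq> V. g (card A))"
    proof (rule sum.cong[OF refl])
      fix A assume "A \<in> {A. v \<in> A \<and> A \<subseteq> V}"
      then have A: "v \<in> A" "A \<subseteq> V" by auto
      have fA: "finite A" using A less(2) finite_subset by blast
      have a0: "card A > 0" using A fA card_gt_0_iff by blast
      have cVA: "card (V - A) = n - card A" using A fA by (simp add: card_Diff_subset n_def)
      have "(\<Sum>E\<in>Pow (pairs_of (V - A)). graph_weight p (pairs_of (V - A)) E *
          of_bool ((size_count (V - A) E)(card A := Suc (size_count (V - A) E (card A))) = l))
        = (if l (card A) = 0 then 0 else part_weight p (n - card A) * part_prod p R (l(card A := l (card A) - 1)))"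
      proof (cases "l (card A) = 0")
        case True
        have "(size_count (V - A) E)(card A := Suc (size_count (V - A) E (card A))) \<noteq> l" for E
          using True by (metis fun_upd_same nat.simps(3))
        then show ?thesis using True by simp
      next
        case nz: False
        have eq: "(c(k := Suc (c k)) = l) = (c = l(k := l k - 1))" if "l k \<noteq> 0" for c :: "nat \<Rightarrow> nat" and k
        proof
          assume "c(k := Suc (c k)) = l"
          then show "c = l(k := l k - 1)" by auto
        next
          assume "c = l(k := l k - 1)"
          then show "c(k := Suc (c k)) = l" using that by (auto simp: fun_eq_iff)
        qed
        have "(\<Sum>E\<in>Pow (pairs_of (V - A)). graph_weight p (pairs_of (V - A)) E *
            of_bool (size_count (V - A) E = l(card A := l (card A) - 1)))
          = part_weight p (card (V - A)) * part_prod p R (l(card A := l (card A) - 1))"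
        proof (rule less(1))
          have "card A \<le> n" using card_mono[OF less(2) A(2)] n_def by simp
          then show "card (V - A) < card V" using cVA a0 n_def by simp
          show "l(card A := l (card A) - 1) \<in> partitions_of (card (V - A))"
            using partitions_of_remove[OF less(3) nz] cVA n_def by simp
          show "card (V - A) \<le> R" using less(4) cVA n_def by simp
        qed (use less in auto)
        then show ?thesis using nz cVA by (simp only: eq[OF nz] if_False)
      qed
      then show "conn_prob_on p A * (1 - p) ^ (card A * (card V - card A)) *
       (\<Sum>E\<in>Pow (pairs_of (V - A)). graph_weight p (pairs_of (V - A)) E *
          of_bool ((size_count (V - A) E)(card A := Suc (size_count (V - A) E (card A))) = l)) = g (card A)"
        using conn_prob_on_eq[of A p] fA A by (auto simp: g_def n_def)
    qed
    also have "\<dots> = (\<Sum>k=1..n. real ((n - 1) choose (k - 1)) * g k)"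
      unfolding n_def by (rule sum_over_subsets_containing[OF less(2) v])
    also have "\<dots> = (\<Sum>k=1..n. real (k * l k) * (fact (n - 1) * s ^ n\<^sup>2 * part_prod p R l))"
    proof (rule sum.cong[OF refl])
      fix k assume k: "k \<in> {1..n}"
      show "real ((n - 1) choose (k - 1)) * g k = real (k * l k) * (fact (n - 1) * s ^ n\<^sup>2 * part_prod p R l)"
      proof (cases "l k = 0")
        case True
        then show ?thesis by (simp add: g_def)
      next
        case False
        then obtain j where j: "l k = Suc j" using not0_implies_Suc by blast
        have kR: "k \<in> {1..R}" using k less(4) n_def by auto
        have "part_prod p R l = part_prod p R (l(k := j)) * comp_weight p k / real (Suc j)"
          using part_prod_Suc[OF kR, of p "l(k := j)"] j by (simp add: fun_upd_idem)
        then have P: "comp_weight p k * part_prod p R (l(k := j)) = real (l k) * part_prod p R l"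
          using j by (simp add: field_simps)
        have F: "fact (k - 1) * fact (n - k) * ((n - 1) choose (k - 1)) = (fact (n - 1) :: nat)"
          using binomial_fact_lemma[of "k - 1" "n - 1"] k by auto
        have F': "fact (k - 1) * fact (n - k) * real ((n - 1) choose (k - 1)) = fact (n - 1)"
          using arg_cong[OF F, of real] by simp
        have fk: "(fact k :: real) = real k * fact (k - 1)"
          using k by (simp add: fact_reduce)
        obtain i where i: "n = k + i" using k le_Suc_ex by auto
        \<comment> \<open>This is
          \<open>n\<^sup>2 = k\<^sup>2 + 2 * k * (n - k) + (n - k)\<^sup>2\<close> in the exponent;
          each absent crossing pair counts twice because \<open>1 - p = s\<^sup>2\<close>.\<close>
        have S: "s ^ k\<^sup>2 * (s\<^sup>2) ^ (k * (n - k)) * s ^ (n - k)\<^sup>2 = s ^ n\<^sup>2"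
          unfolding power_mult[symmetric] power_add[symmetric] i
          by (rule arg_cong[where f = "\<lambda>x. s ^ x"]) (simp add: power2_eq_square algebra_simps)
        have "real ((n - 1) choose (k - 1)) * g k =
          real ((n - 1) choose (k - 1)) * (comp_weight p k * (fact k * s ^ k\<^sup>2) * (s\<^sup>2) ^ (k * (n - k)) *
            (fact (n - k) * s ^ (n - k)\<^sup>2 * part_prod p R (l(k := j))))"
          unfolding g_def using p by (simp add: j conn_prob_comp_weight s2[symmetric] part_weight_def s_def)
        also have "\<dots> = real k * (fact (k - 1) * fact (n - k) * real ((n - 1) choose (k - 1))) *
            (s ^ k\<^sup>2 * (s\<^sup>2) ^ (k * (n - k)) * s ^ (n - k)\<^sup>2) * (comp_weight p k * part_prod p R (l(k := j)))"
          unfolding fk by (simp only: mult_ac)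
        also have "\<dots> = real (k * l k) * (fact (n - 1) * s ^ n\<^sup>2 * part_prod p R l)"
          unfolding F' S P by simp
        finally show ?thesis .
      qed
    qed
    also have "\<dots> = real (\<Sum>k=1..n. k * l k) * (fact (n - 1) * s ^ n\<^sup>2 * part_prod p R l)"
      by (simp add: sum_distrib_right)
    also have "(\<Sum>k=1..n. k * l k) = n" using less(3) by (simp add: partitions_of_def n_def)
    also have "real n * (fact (n - 1) * s ^ n\<^sup>2 * part_prod p R l) = part_weight p n * part_prod p R l"
      using False less(2) n_def by (simp add: part_weight_def s_def fact_reduce card_gt_0_iff)
    finally show ?thesis by (simp add: n_def)
  qed
qed

lemma size_count_partitions:
  "finite V \<Longrightarrow> E \<subseteq> pairs_of V \<Longrightarrow> size_count V E \<in> partitions_of (card V)"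
proof (induction "card V" arbitrary: V E rule: less_induct)
  case less
  show ?case
  proof (cases "V = {}")
    case True
    then show ?thesis by (auto simp: size_count_def partitions_of_def)
  next
    case False
    then obtain v where v: "v \<in> V" by auto
    define A where "A = connection E `` {v}"
    have A: "v \<in> A" "A \<subseteq> V" using connection_class_subset[OF less(3) v] by (auto simp: A_def)
    have fA: "finite A" using A less(2) finite_subset by blast
    have a0: "card A > 0" using A fA card_gt_0_iff by blast
    have le: "card A \<le> card V" using card_mono[OF less(2) A(2)] .
    have cVA: "card (V - A) = card V - card A" using A fA by (simp add: card_Diff_subset)
    have "size_count (V - A) (E \<inter> pairs_of (V - A)) \<in> partitions_of (card (V - A))"
      by (rule less(1)) (use less a0 le cVA in auto)
    from partitions_of_add[OF this, of "card A"] show ?thesis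
      using size_count_split[OF less(2,3) v A_def[symmetric]] a0 le cVA by simp
  qed
qed

section \<open>From weighted sums over graphs to probabilities\<close>

lemma pmf_erdos_renyi:
  assumes "0 \<le> p" "p \<le> 1" "E \<subseteq> pairs_of {1..n}"
  shows "pmf (erdos_renyi n p) E = graph_weight p (pairs_of {1..n}) E"
proof -
  let ?S = "pairs_of {1..n}"
  let ?M = "Pi_pmf ?S False (\<lambda>_. bernoulli_pmf p)"
  let ?f = "\<lambda>X. {e \<in> ?S. X e}"
  have "vertex_pairs n = ?S" by (simp add: vertex_pairs_def pairs_of_def)
  then have "pmf (erdos_renyi n p) E = measure_pmf.prob ?M (?f -` {E})"
    by (simp add: erdos_renyi_def pmf_map)
  also have "\<dots> = measure_pmf.prob ?M (?f -` {E} \<inter> set_pmf ?M)" by (simp add: measure_Int_set_pmf)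
  also have "?f -` {E} \<inter> set_pmf ?M = {\<lambda>e. e \<in> E} \<inter> set_pmf ?M"
    using set_Pi_pmf_subset[of ?S False "\<lambda>_. bernoulli_pmf p"] assms(3) by fastforce
  also have "measure_pmf.prob ?M \<dots> = pmf ?M (\<lambda>e. e \<in> E)"
    by (simp add: measure_Int_set_pmf measure_pmf_single)
  also have "\<dots> = (\<Prod>e\<in>?S. pmf (bernoulli_pmf p) (e \<in> E))"
    by (rule pmf_Pi') (use assms in auto)
  also have "\<dots> = graph_weight p ?S E"
    unfolding graph_weight_def using assms by (intro prod.cong) auto
  finally show ?thesis .
qed

lemma set_pmf_erdos_renyi: "set_pmf (erdos_renyi n p) \<subseteq> Pow (pairs_of {1..n})"
  by (auto simp: erdos_renyi_def vertex_pairs_def pairs_of_def)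

lemma component_count_eq: "component_count n E = size_count {1..n} E"
  by (rule ext) (simp add: component_count_def size_count_def components_def)

lemma set_pmf_count_law: "set_pmf (count_law n p) \<subseteq> partitions_of n"
proof
  fix l assume "l \<in> set_pmf (count_law n p)"
  then obtain E where E: "E \<in> set_pmf (erdos_renyi n p)" "l = size_count {1..n} E"
    by (auto simp: count_law_def component_count_eq)
  have "E \<subseteq> pairs_of {1..n}" using E(1) set_pmf_erdos_renyi[of n p] by blast
  then show "l \<in> partitions_of n" using size_count_partitions[of "{1..n}" E] E(2) by simp
qed

lemma pmf_count_law:
  assumes p: "0 \<le> p" "p < 1" and l: "l \<in> partitions_of n" and R: "n \<le> R"
  shows "pmf (count_law n p) l = part_weight p n * part_prod p R l"
proof -
  let ?S = "pairs_of {1..n}"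
  let ?M = "erdos_renyi n p"
  let ?X = "{E. size_count {1..n} E = l}"
  have "pmf (count_law n p) l = measure_pmf.prob ?M ?X"
    by (simp add: count_law_def pmf_map vimage_def component_count_eq)
  also have "\<dots> = measure_pmf.prob ?M (?X \<inter> Pow ?S)"
  proof -
    have "?X \<inter> Pow ?S \<inter> set_pmf ?M = ?X \<inter> set_pmf ?M"
      using set_pmf_erdos_renyi[of n p] by auto
    then show ?thesis using measure_Int_set_pmf by metis
  qed
  also have "\<dots> = (\<Sum>E\<in>?X \<inter> Pow ?S. pmf ?M E)"
    by (rule measure_measure_pmf_finite) simp
  also have "\<dots> = (\<Sum>E\<in>Pow ?S. graph_weight p ?S E * of_bool (size_count {1..n} E = l))"
    by (rule sum.mono_neutral_cong_left) (use p in \<open>auto simp: pmf_erdos_renyi\<close>)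
  also have "\<dots> = part_weight p (card {1..n}) * part_prod p R l"
    by (rule size_count_sum) (use p l R in auto)
  finally show ?thesis by simp
qed

section \<open>Connection probabilities and spanning trees\<close>

definition tree_count :: "nat \<Rightarrow> nat" where
  "tree_count k = card {T. T \<subseteq> pairs_of {1..k} \<and> connected_graph {1..k} T \<and> card T = k - 1}"

text \<open>As long as \<open>A\<close> is not all of \<open>V\<close>, connectedness supplies an
  edge of \<open>E\<close> leaving \<open>A\<close>. Adding it together with its new endpoint raises
  the numbers of vertices and edges by one each and keeps the subgraph connected.\<close>

lemma connected_subgraph_grow:
  assumes V: "finite V" "v \<in> V" and E: "E \<subseteq> pairs_of V" "connected_graph V E"
    and j: "1 \<le> j" "j \<le> card V"
  shows "\<exists>A F. v \<in> A \<and> A \<subseteq> V \<and> card A = j \<and> F \<subseteq> E \<inter> pairs_of A \<and> connected_graph A F \<and> card F = j - 1"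
  using j
proof (induction j rule: dec_induct)
  case base
  show ?case
    by (rule exI[of _ "{v}"], rule exI[of _ "{}"]) (use V in \<open>auto simp: connected_graph_def\<close>)
next
  case (step j)
  then obtain A F where A: "v \<in> A" "A \<subseteq> V" "card A = j" and F: "F \<subseteq> E \<inter> pairs_of A" "connected_graph A F" "card F = j - 1"
    by auto
  have fA: "finite A" using A V finite_subset by blast
  have "\<exists>e\<in>E. \<not> (e \<subseteq> A \<or> e \<inter> A = {})"
  proof (rule ccontr)
    assume "\<not> ?thesis"
    then have cr: "\<And>e. e \<in> E \<Longrightarrow> e \<subseteq> A \<or> e \<inter> A = {}" by blast
    have "V \<subseteq> A"
      using connection_restrict[OF E(1) cr _ A(1)] E(2) V by (auto simp: connected_graph_def)
    then have "A = V" using A by auto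
    then show False using step A by simp
  qed
  then obtain e where e: "e \<in> E" "\<not> e \<subseteq> A" "e \<inter> A \<noteq> {}" by blast
  have "e \<subseteq> V" "card e = 2" using e E by (auto simp: pairs_of_def)
  then obtain x y where xy: "e = {x, y}" "x \<in> A" "y \<notin> A" "y \<in> V"
    using e by (auto simp: card_2_iff)
  have xA: "(x, u) \<in> connection (insert e F)" if "u \<in> insert y A" for u
  proof (cases "u = y")
    case True
    then show ?thesis using xy by (auto intro!: connection_edge)
  next
    case False
    then have "(x, u) \<in> connection F" using F(2) xy that by (auto simp: connected_graph_def)
    then show ?thesis using connection_mono[of F "insert e F"] by auto
  qed
  have con: "connected_graph (insert y A) (insert e F)"
    unfolding connected_graph_def by (intro ballI connection_trans[OF connection_sym[OF xA] xA])
  have fF: "finite F"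
    by (rule finite_subset[OF _ finite_pairs_of[OF fA]]) (use F(1) in blast)
  have eF: "e \<notin> F"
  proof
    assume "e \<in> F"
    then have "e \<in> pairs_of A" using F(1) by blast
    then show False using e(2) by (simp add: pairs_of_def)
  qed
  have "e \<subseteq> insert y A" unfolding xy(1) using xy(2) by blast
  then have eP: "e \<in> pairs_of (insert y A)" using \<open>card e = 2\<close> by (simp add: pairs_of_def)
  have PA: "pairs_of A \<subseteq> pairs_of (insert y A)" by (auto simp: pairs_of_def)
  have "insert e F \<subseteq> E \<inter> pairs_of (insert y A)"
    using F(1) e(1) eP PA by blast
  moreover have "card (insert y A) = Suc j" using A(3) fA xy(3) by simp
  moreover have "card (insert e F) = Suc j - 1" using F(3) fF eF step(1) by simp
  moreover have "v \<in> insert y A" "insert y A \<subseteq> V" using A xy by auto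
  ultimately show ?case
    using con by - (rule exI[of _ "insert y A"], rule exI[of _ "insert e F"], intro conjI; assumption)
qed

lemma connected_subtree:
  assumes E: "E \<subseteq> pairs_of {1..k}" "connected_graph {1..k} E" and k: "k \<ge> 1"
  shows "\<exists>T\<subseteq>E. connected_graph {1..k} T \<and> card T = k - 1"
proof -
  obtain A F where *: "A \<subseteq> {1..k}" "card A = k" "F \<subseteq> E \<inter> pairs_of A" "connected_graph A F" "card F = k - 1"
    using connected_subgraph_grow[of "{1..k}" 1 E k] assms by auto
  then have "A = {1..k}" using card_subset_eq[of "{1..k}" A] by auto
  then show ?thesis using * by blast
qed

lemma graph_weight_subset:
  assumes "finite S" "T \<subseteq> S"
  shows "graph_weight p S T = p ^ card T * (1 - p) ^ card (S - T)"
proof -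
  have "graph_weight p (T \<union> (S - T)) T = graph_weight p T (T \<inter> T) * graph_weight p (S - T) (T \<inter> (S - T))"
    by (rule graph_weight_Un) (use assms finite_subset in auto)
  moreover have "T \<union> (S - T) = S" "T \<inter> (S - T) = {}" using assms by auto
  ultimately show ?thesis by (simp add: graph_weight_def)
qed

lemma sum_graph_weight_superset:
  assumes "finite S" "T \<subseteq> S"
  shows "(\<Sum>E\<in>Pow S. graph_weight p S E * of_bool (T \<subseteq> E)) = p ^ card T"
proof -
  have fT: "finite T" using assms finite_subset by blast
  have "(\<Sum>E\<in>Pow (T \<union> (S - T)). graph_weight p (T \<union> (S - T)) E * (of_bool (E \<inter> T = T) * 1)) =
     (\<Sum>E\<in>Pow T. graph_weight p T E * of_bool (E = T)) * (\<Sum>E\<in>Pow (S - T). graph_weight p (S - T) E * 1)"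
    by (rule sum_graph_weight_Un) (use assms fT in auto)
  moreover have "T \<union> (S - T) = S" using assms by auto
  moreover have "(E \<inter> T = T) = (T \<subseteq> E)" for E by auto
  moreover have "(\<Sum>E\<in>Pow T. graph_weight p T E * of_bool (E = T)) = (\<Sum>E\<in>{T}. graph_weight p T E)"
    by (rule sum.mono_neutral_cong_right) (use fT in auto)
  ultimately show ?thesis using sum_graph_weight[of "S - T" p] assms by (simp add: graph_weight_def)
qed

lemma graph_weight_nonneg: "0 \<le> p \<Longrightarrow> p \<le> 1 \<Longrightarrow> 0 \<le> graph_weight p S E"
  unfolding graph_weight_def by (intro prod_nonneg) auto

text \<open>A union bound: a connected graph contains a spanning tree, and a given tree is present
  with probability \<open>p ^ (k - 1)\<close>.\<close>

lemma conn_prob_le: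
  fixes p :: real
  assumes p: "0 \<le> p" "p \<le> 1" and k: "k \<ge> 1"
  shows "conn_prob p k \<le> tree_count k * p ^ (k - 1)"
proof -
  let ?S = "pairs_of {1..k}"
  let ?T = "{T. T \<subseteq> ?S \<and> connected_graph {1..k} T \<and> card T = k - 1}"
  have fT: "finite ?T" by (rule finite_subset[of _ "Pow ?S"]) auto
  have "conn_prob p k = (\<Sum>E\<in>Pow ?S. graph_weight p ?S E * of_bool (connected_graph {1..k} E))"
    unfolding conn_prob_def conn_prob_on_def by (rule sum.mono_neutral_cong_left) auto
  also have "\<dots> \<le> (\<Sum>E\<in>Pow ?S. \<Sum>T\<in>?T. graph_weight p ?S E * of_bool (T \<subseteq> E))"
  proof (rule sum_mono)
    fix E assume E: "E \<in> Pow ?S"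
    show "graph_weight p ?S E * of_bool (connected_graph {1..k} E) \<le> (\<Sum>T\<in>?T. graph_weight p ?S E * of_bool (T \<subseteq> E))"
    proof (cases "connected_graph {1..k} E")
      case True
      then obtain T where T: "T \<subseteq> E" "T \<in> ?T" using connected_subtree[of E k] E k by auto
      have "graph_weight p ?S E * of_bool (T \<subseteq> E) \<le> (\<Sum>T\<in>?T. graph_weight p ?S E * of_bool (T \<subseteq> E))"
        by (rule member_le_sum) (use T fT graph_weight_nonneg[OF p] in auto)
      then show ?thesis using T True by simp
    next
      case False
      then show ?thesis by (simp add: mult_nonneg_nonneg graph_weight_nonneg[OF p])
    qed
  qed
  also have "\<dots> = (\<Sum>T\<in>?T. \<Sum>E\<in>Pow ?S. graph_weight p ?S E * of_bool (T \<subseteq> E))" by (rule sum.swap)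
  also have "\<dots> = (\<Sum>T\<in>?T. p ^ (k - 1))"
  proof (rule sum.cong[OF refl])
    fix T assume "T \<in> ?T"
    then show "(\<Sum>E\<in>Pow ?S. graph_weight p ?S E * of_bool (T \<subseteq> E)) = p ^ (k - 1)"
      using sum_graph_weight_superset[of ?S T p] by (simp del: sum_mult_of_bool_eq)
  qed
  finally show ?thesis by (simp add: tree_count_def)
qed

text \<open>Keeps only the graphs that are themselves trees.\<close>

lemma conn_prob_ge:
  fixes p :: real
  assumes p: "0 \<le> p" "p \<le> 1"
  shows "tree_count k * p ^ (k - 1) * (1 - p) ^ ((k choose 2) - (k - 1)) \<le> conn_prob p k"
proof -
  let ?S = "pairs_of {1..k}"
  let ?T = "{T. T \<subseteq> ?S \<and> connected_graph {1..k} T \<and> card T = k - 1}"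
  have "(\<Sum>T\<in>?T. graph_weight p ?S T) \<le> conn_prob p k"
    unfolding conn_prob_def conn_prob_on_def
    by (rule sum_mono2) (use graph_weight_nonneg[OF p] finite_subset[of _ "Pow ?S"] in auto)
  also have "(\<Sum>T\<in>?T. graph_weight p ?S T) = (\<Sum>T\<in>?T. p ^ (k - 1) * (1 - p) ^ ((k choose 2) - (k - 1)))"
  proof (rule sum.cong[OF refl])
    fix T assume T: "T \<in> ?T"
    then have "finite T" using finite_subset[of T ?S] by auto
    then show "graph_weight p ?S T = p ^ (k - 1) * (1 - p) ^ ((k choose 2) - (k - 1))"
      using T by (simp add: graph_weight_subset card_Diff_subset card_pairs_of)
  qed
  finally show ?thesis by (simp add: tree_count_def mult_ac)
qed

lemma conn_prob_nonneg: "0 \<le> p \<Longrightarrow> p \<le> 1 \<Longrightarrow> 0 \<le> conn_prob p k"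
  unfolding conn_prob_def conn_prob_on_def by (intro sum_nonneg graph_weight_nonneg) auto

lemma comp_weight_nonneg: "0 \<le> p \<Longrightarrow> p < 1 \<Longrightarrow> 0 \<le> comp_weight p k"
  unfolding comp_weight_def by (intro divide_nonneg_nonneg conn_prob_nonneg) auto

lemma part_weight_pos: "p < 1 \<Longrightarrow> 0 < part_weight p n"
  by (simp add: part_weight_def)

section \<open>Adding and removing components\<close>

lemma prob_count_law:
  "measure_pmf.prob (count_law n p) X = (\<Sum>l\<in>partitions_of n \<inter> X. pmf (count_law n p) l)"
proof -
  have "measure_pmf.prob (count_law n p) X = measure_pmf.prob (count_law n p) (partitions_of n \<inter> X)"
  proof -
    have "partitions_of n \<inter> X \<inter> set_pmf (count_law n p) = X \<inter> set_pmf (count_law n p)"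
      using set_pmf_count_law[of n p] by auto
    then show ?thesis using measure_Int_set_pmf by metis
  qed
  also have "\<dots> = (\<Sum>l\<in>partitions_of n \<inter> X. pmf (count_law n p) l)"
    by (rule measure_measure_pmf_finite) (simp add: finite_partitions_of)
  finally show ?thesis .
qed

lemma partitions_of_mult_le:
  assumes "l \<in> partitions_of n"
  shows "k * l k \<le> n"
proof (cases "k \<in> {1..n}")
  case True
  have "k * l k \<le> (\<Sum>k=1..n. k * l k)" using True by (intro member_le_sum) auto
  also have "\<dots> = n" using assms by (simp add: partitions_of_def)
  finally show ?thesis .
next
  case False
  then have "l k = 0" using partitions_of_support[OF assms, of k] by auto
  then show ?thesis by simp
qed

text \<open>In the product formula the two probabilities differ by the normalisations, one factor
  \<open>comp_weight p k\<close> and \<open>1 / Suc (l k)\<close>, which is at least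
  \<open>1 / (m + k)\<close>. The loss is polynomial in the number of vertices, hence invisible on
  the exponential scale.\<close>

lemma pmf_count_law_add:
  assumes p: "0 \<le> p" "p < 1" and l: "l \<in> partitions_of m" and k: "1 \<le> k"
  shows "part_weight p (m + k) * comp_weight p k * pmf (count_law m p) l
      \<le> part_weight p m * real (m + k) * pmf (count_law (m + k) p) (l(k := Suc (l k)))"
proof -
  have "1 * l k \<le> k * l k" using k by (intro mult_le_mono) auto
  then have "l k \<le> m" using partitions_of_mult_le[OF l, of k] by linarith
  then have le: "1 \<le> real (m + k) / real (Suc (l k))" using k by (simp add: field_simps)
  have nn: "0 \<le> part_weight p m * part_weight p (m + k) * part_prod p (m + k) l * comp_weight p k"
    using part_weight_pos[OF p(2)] comp_weight_nonneg[OF p]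
    by (auto simp: part_prod_def less_imp_le intro!: mult_nonneg_nonneg prod_nonneg)
  have "part_weight p (m + k) * comp_weight p k * pmf (count_law m p) l
      = part_weight p m * part_weight p (m + k) * part_prod p (m + k) l * comp_weight p k * 1"
    using pmf_count_law[OF p l, of "m + k"] by simp
  also have "\<dots> \<le> part_weight p m * part_weight p (m + k) * part_prod p (m + k) l * comp_weight p k *
      (real (m + k) / real (Suc (l k)))"
    by (rule mult_left_mono[OF le nn])
  also have "\<dots> = part_weight p m * real (m + k) *
     (part_weight p (m + k) * part_prod p (m + k) (l(k := Suc (l k))))"
    using k by (subst part_prod_Suc) auto
  also have "part_weight p (m + k) * part_prod p (m + k) (l(k := Suc (l k)))
      = pmf (count_law (m + k) p) (l(k := Suc (l k)))"
    using pmf_count_law[OF p partitions_of_add[OF l k], of "m + k"] by simp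
  finally show ?thesis .
qed

text \<open>Deleting one component of size \<open>k\<close> is injective on the vectors that have
  one, and it changes their probability by an explicit factor. Hence a size that occurs with
  non-negligible probability must have a large weight: this is the source of the lower bound on
  weights.\<close>

lemma prob_component_size_le:
  assumes p: "0 \<le> p" "p < 1" and k: "1 \<le> k" "k \<le> N"
  shows "measure_pmf.prob (count_law N p) {l. l k \<noteq> 0} * part_weight p (N - k) \<le> comp_weight p k * part_weight p N"
proof -
  let ?X = "partitions_of N \<inter> {l. l k \<noteq> 0}"
  let ?f = "\<lambda>l. l(k := l k - (1::nat))"
  let ?c = "comp_weight p k * part_weight p N"
  have c0: "0 \<le> ?c" using comp_weight_nonneg[OF p] part_weight_pos[OF p(2)] by (simp add: less_imp_le)
  have inj: "inj_on ?f ?X"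
  proof (rule inj_onI)
    fix l l' assume l: "l \<in> ?X" "l' \<in> ?X" and eq: "?f l = ?f l'"
    have "l j = l' j" for j
      using fun_cong[OF eq, of j] l by (cases "j = k") auto
    then show "l = l'" by blast
  qed
  have fX: "?f ` ?X \<subseteq> partitions_of (N - k)" using partitions_of_remove by auto
  have "measure_pmf.prob (count_law N p) {l. l k \<noteq> 0} * part_weight p (N - k)
      = (\<Sum>l\<in>?X. pmf (count_law N p) l * part_weight p (N - k))"
    by (simp add: prob_count_law sum_distrib_right)
  also have "\<dots> \<le> (\<Sum>l\<in>?X. ?c * pmf (count_law (N - k) p) (?f l))"
  proof (rule sum_mono)
    fix l assume "l \<in> ?X"
    then have l: "l \<in> partitions_of N" "l k \<noteq> 0" by auto
    have eq: "(?f l)(k := Suc (?f l k)) = l" using l(2) by auto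
    have q: "part_prod p N l = part_prod p N (?f l) * comp_weight p k / real (Suc (?f l k))"
      using part_prod_Suc[of k N p "?f l"] k eq by auto
    have nn: "0 \<le> part_prod p N (?f l) * comp_weight p k"
      using comp_weight_nonneg[OF p] by (auto simp: part_prod_def intro!: mult_nonneg_nonneg prod_nonneg)
    have le: "part_prod p N l \<le> part_prod p N (?f l) * comp_weight p k"
    proof -
      have "part_prod p N (?f l) * comp_weight p k / real (Suc (?f l k)) \<le> part_prod p N (?f l) * comp_weight p k / 1"
        by (rule divide_left_mono) (use nn in auto)
      then show ?thesis unfolding q by simp
    qed
    have "pmf (count_law N p) l * part_weight p (N - k)
        = part_weight p N * part_weight p (N - k) * part_prod p N l"
      using pmf_count_law[OF p l(1), of N] by simp
    also have "\<dots> \<le> part_weight p N * part_weight p (N - k) * (part_prod p N (?f l) * comp_weight p k)"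
      using part_weight_pos[OF p(2)] by (intro mult_left_mono le) (simp add: less_imp_le)
    also have "\<dots> = ?c * pmf (count_law (N - k) p) (?f l)"
      using pmf_count_law[OF p partitions_of_remove[OF l], of N] by simp
    finally show "pmf (count_law N p) l * part_weight p (N - k) \<le> ?c * pmf (count_law (N - k) p) (?f l)" .
  qed
  also have "\<dots> = ?c * (\<Sum>l\<in>?f ` ?X. pmf (count_law (N - k) p) l)"
    using sum.reindex[OF inj, of "pmf (count_law (N - k) p)"] by (simp add: sum_distrib_left)
  also have "(\<Sum>l\<in>?f ` ?X. pmf (count_law (N - k) p) l) = measure_pmf.prob (count_law (N - k) p) (?f ` ?X)"
    by (rule measure_measure_pmf_finite[symmetric]) (simp add: finite_partitions_of)
  also have "?c * \<dots> \<le> ?c * 1"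
    by (intro mult_left_mono c0 measure_pmf.prob_le_1)
  finally show ?thesis by simp
qed

text \<open>A single term of \<open>sum_conn_prob\<close> is at most one. The number
  \<open>N\<close> of vertices is free here and gets optimised later.\<close>

lemma comp_weight_le:
  assumes p: "0 \<le> p" "p < 1" and k: "1 \<le> k" "k \<le> N"
  shows "comp_weight p k * part_weight p N \<le> real N * part_weight p (N - k)"
proof -
  define s where "s = sqrt (1 - p)"
  have s2: "1 - p = s\<^sup>2" and s0: "0 < s" using p by (auto simp: s_def)
  let ?t = "real ((N - 1) choose (k - 1)) * (conn_prob p k * (1 - p) ^ (k * (N - k)))"
  have t0: "0 \<le> ?t" using conn_prob_nonneg[of p k] p by (auto intro!: mult_nonneg_nonneg)
  have "?t \<le> (\<Sum>k=1..N. real ((N - 1) choose (k - 1)) * (conn_prob p k * (1 - p) ^ (k * (N - k))))"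
    by (rule member_le_sum[where f = "\<lambda>k. real ((N - 1) choose (k - 1)) * (conn_prob p k * (1 - p) ^ (k * (N - k)))"])
       (use k p conn_prob_nonneg[of p] in \<open>auto intro!: mult_nonneg_nonneg\<close>)
  also have "\<dots> = 1" by (rule sum_conn_prob) (use k in auto)
  finally have t1: "?t \<le> 1" .
  have F: "fact (k - 1) * fact (N - k) * ((N - 1) choose (k - 1)) = (fact (N - 1) :: nat)"
    using binomial_fact_lemma[of "k - 1" "N - 1"] k by auto
  have F': "fact (N - 1) = fact (k - 1) * fact (N - k) * real ((N - 1) choose (k - 1))"
    using arg_cong[OF F, of real] by simp
  have fN: "(fact N :: real) = real N * fact (N - 1)" and fk: "(fact k :: real) = real k * fact (k - 1)"
    using k by (simp_all add: fact_reduce)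
  obtain i where i: "N = k + i" using k le_Suc_ex by auto
  have S: "s ^ N\<^sup>2 = s ^ k\<^sup>2 * (s\<^sup>2) ^ (k * (N - k)) * s ^ (N - k)\<^sup>2"
    unfolding power_mult[symmetric] power_add[symmetric] i
    by (rule arg_cong[where f = "\<lambda>x. s ^ x"]) (simp add: power2_eq_square algebra_simps)
  have "real k * (comp_weight p k * part_weight p N)
     = real N * part_weight p (N - k) * ?t"
    unfolding comp_weight_def part_weight_def fN fk F' s_def[symmetric] s2
    using k s0 S by (simp add: field_simps)
  also have "\<dots> \<le> real N * part_weight p (N - k) * real k"
    using t1 k part_weight_pos[OF p(2), of "N - k"]
    by (intro mult_left_mono) auto
  finally have "real k * (comp_weight p k * part_weight p N) \<le> real k * (real N * part_weight p (N - k))"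
    by (simp add: mult_ac)
  then show ?thesis using k by simp
qed

lemma power_div_fact_le_exp:
  fixes x :: real
  assumes "0 \<le> x"
  shows "x ^ j / fact j \<le> exp x"
proof -
  have "(\<Sum>i\<in>{j}. x ^ i /\<^sub>R fact i) \<le> (\<Sum>i. x ^ i /\<^sub>R fact i)"
    by (rule sum_le_suminf) (use assms summable_exp_generic[of x] in auto)
  then show ?thesis by (simp add: exp_def divide_inverse mult.commute)
qed

text \<open>An exponential tilt. The vertices in components of size at most \<open>K\<close> are
  weighted by powers of \<open>z\<close>, each resulting factor
  \<open>(comp_weight p k * z ^ k) ^ l k / fact (l k)\<close> is one term of an exponential series,
  and for larger sizes the factorials are dropped. The parameter \<open>z\<close> stays
  free.\<close>

lemma pmf_count_law_le:
  assumes p: "0 \<le> p" "p < 1" and l: "l \<in> partitions_of N" and K: "K \<le> N" and z: "0 \<le> z"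
  shows "pmf (count_law N p) l * z ^ (N - (\<Sum>k\<in>{K<..N}. k * l k))
      \<le> part_weight p N * exp (\<Sum>k=1..K. comp_weight p k * z ^ k) * (\<Prod>k\<in>{K<..N}. comp_weight p k ^ l k)"
proof -
  let ?w = "comp_weight p"
  have split: "{1..N} = {1..K} \<union> {K<..N}" "{1..K} \<inter> {K<..N} = {}" using K by auto
  have "N = (\<Sum>k=1..N. k * l k)" using l by (simp add: partitions_of_def)
  also have "\<dots> = (\<Sum>k=1..K. k * l k) + (\<Sum>k\<in>{K<..N}. k * l k)"
    unfolding split(1) by (rule sum.union_disjoint) (use split(2) in auto)
  finally have e: "N - (\<Sum>k\<in>{K<..N}. k * l k) = (\<Sum>k=1..K. k * l k)" by simp
  have "pmf (count_law N p) l = part_weight p N * part_prod p N l"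
    by (rule pmf_count_law[OF p l]) simp
  also have "part_prod p N l = (\<Prod>k=1..K. ?w k ^ l k / fact (l k)) * (\<Prod>k\<in>{K<..N}. ?w k ^ l k / fact (l k))"
    unfolding part_prod_def split(1) by (rule prod.union_disjoint) (use split(2) in auto)
  finally have "pmf (count_law N p) l * z ^ (N - (\<Sum>k\<in>{K<..N}. k * l k))
     = part_weight p N * ((\<Prod>k=1..K. ?w k ^ l k / fact (l k)) * (\<Prod>k=1..K. z ^ (k * l k))) * (\<Prod>k\<in>{K<..N}. ?w k ^ l k / fact (l k))"
    by (simp add: e power_sum)
  also have "(\<Prod>k=1..K. ?w k ^ l k / fact (l k)) * (\<Prod>k=1..K. z ^ (k * l k)) = (\<Prod>k=1..K. (?w k * z ^ k) ^ l k / fact (l k))"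
    by (simp add: prod.distrib[symmetric] power_mult_distrib power_mult)
  also have "part_weight p N * \<dots> * (\<Prod>k\<in>{K<..N}. ?w k ^ l k / fact (l k))
     \<le> part_weight p N * (\<Prod>k=1..K. exp (?w k * z ^ k)) * (\<Prod>k\<in>{K<..N}. ?w k ^ l k)"
  proof (intro mult_mono mult_nonneg_nonneg prod_mono conjI prod_nonneg ballI)
    fix k
    show "?w k ^ l k / fact (l k) \<le> ?w k ^ l k"
      using comp_weight_nonneg[OF p, of k] by (simp add: divide_le_eq mult_le_cancel_left1 fact_ge_1)
  qed (use comp_weight_nonneg[OF p] part_weight_pos[OF p(2)] z in
       \<open>auto intro!: power_div_fact_le_exp divide_nonneg_nonneg simp: less_imp_le\<close>)
  finally show ?thesis by (simp add: exp_sum)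
qed

text \<open>The decreasing order matters: an entry of index \<open>i\<close> is at most the total
  divided by \<open>i + 1\<close>, which later yields compactness.\<close>

definition large_sizes :: "nat \<Rightarrow> nat \<Rightarrow> (nat \<Rightarrow> nat) \<Rightarrow> nat list" where
  "large_sizes K n l = concat (map (\<lambda>k. replicate (l k) k) (rev [Suc K..<Suc n]))"

lemma sum_list_large_sizes:
  fixes g :: "nat \<Rightarrow> 'a::semiring_1"
  shows "sum_list (map g (large_sizes K n l)) = (\<Sum>k\<in>{K<..n}. of_nat (l k) * g k)"
proof -
  have "sum_list (map g (concat (map (\<lambda>k. replicate (l k) k) ks))) = sum_list (map (\<lambda>k. of_nat (l k) * g k) ks)" for ks
    by (induction ks) (auto simp: sum_list_replicate)
  then have "sum_list (map g (large_sizes K n l)) = sum_list (map (\<lambda>k. of_nat (l k) * g k) (rev [Suc K..<Suc n]))"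
    by (simp only: large_sizes_def)
  also have "\<dots> = (\<Sum>k\<in>set (rev [Suc K..<Suc n]). of_nat (l k) * g k)"
    by (rule sum_list_distinct_conv_sum_set) simp
  also have "set (rev [Suc K..<Suc n]) = {K<..n}" by auto
  finally show ?thesis .
qed

lemma set_large_sizes: "set (large_sizes K n l) \<subseteq> {K<..n}"
  by (auto simp: large_sizes_def)

lemma sorted_large_sizes: "sorted_wrt (\<ge>) (large_sizes K n l)"
proof (induction n)
  case 0
  then show ?case by (simp add: large_sizes_def)
next
  case (Suc n)
  have "large_sizes K (Suc n) l = (if K \<le> n then replicate (l (Suc n)) (Suc n) else []) @ large_sizes K n l"
    by (simp add: large_sizes_def)
  moreover have "sorted_wrt (\<ge>) (replicate m (c::nat))" for m c by (induction m) auto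
  ultimately show ?case using Suc set_large_sizes[of K n l] by (auto simp: sorted_wrt_append)
qed

lemma count_list_large_sizes:
  "count_list (large_sizes K n l) k = (if k \<in> {K<..n} then l k else 0)"
proof -
  have "count_list xs k = sum_list (map (\<lambda>x. if x = k then 1 else 0) xs)" for xs :: "nat list"
    by (induction xs) auto
  then show ?thesis
    using sum_list_large_sizes[of "\<lambda>x. if x = k then 1 else (0::nat)" K n l]
    by (simp add: if_distrib[of "\<lambda>x. _ * x"] cong: if_cong)
qed

lemma length_large_sizes: "length (large_sizes K n l) = (\<Sum>k\<in>{K<..n}. l k)"
  using sum_list_large_sizes[of "\<lambda>_. 1::nat" K n l] by (simp add: sum_list_triv)

lemma sum_large_le:
  assumes "l \<in> partitions_of n"
  shows "(\<Sum>k\<in>{K<..n}. k * l k) \<le> n" "K * (\<Sum>k\<in>{K<..n}. l k) \<le> n"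
proof -
  have "(\<Sum>k\<in>{K<..n}. k * l k) \<le> (\<Sum>k=1..n. k * l k)" by (rule sum_mono2) auto
  then show 1: "(\<Sum>k\<in>{K<..n}. k * l k) \<le> n" using assms by (simp add: partitions_of_def)
  have "K * (\<Sum>k\<in>{K<..n}. l k) \<le> (\<Sum>k\<in>{K<..n}. k * l k)"
    unfolding sum_distrib_left by (intro sum_mono mult_le_mono) auto
  then show "K * (\<Sum>k\<in>{K<..n}. l k) \<le> n" using 1 by simp
qed

text \<open>A vector is encoded by its counts up to size \<open>K\<close> and by the list of its at
  most \<open>n div K\<close> larger sizes. The two exponents balance when \<open>K\<close> is of
  order \<open>sqrt n\<close>.\<close>

lemma card_partitions_of_le:
  assumes "1 \<le> K"
  shows "card (partitions_of n) \<le> (n + 1) ^ (K + n div K)"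
proof -
  let ?R = "n div K"
  let ?A = "{xs. set xs \<subseteq> {0..n} \<and> length xs = K}"
  let ?B = "{xs. set xs \<subseteq> {0..n} \<and> length xs = ?R}"
  let ?F = "\<lambda>(fs, xs) k. if k \<in> {1..K} then fs ! (k - 1) else if k \<in> {K<..n} then count_list xs k else 0"
  have fin: "finite ?A" "finite ?B" by (rule finite_lists_length_eq, simp)+
  have "partitions_of n \<subseteq> ?F ` (?A \<times> ?B)"
  proof
    fix l assume l: "l \<in> partitions_of n"
    define fs where "fs = map l [1..<Suc K]"
    define ys where "ys = large_sizes K n l"
    \<comment> \<open>The padding by \<open>0\<close> is harmless, as decoding counts only entries
      above \<open>K\<close>.\<close>
    define xs where "xs = ys @ replicate (?R - length ys) 0"
    have "K * length ys \<le> n" using sum_large_le(2)[OF l, of K] by (simp add: ys_def length_large_sizes)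
    then have "length ys \<le> ?R" using assms by (simp add: less_eq_div_iff_mult_less_eq mult.commute)
    then have "xs \<in> ?B" using set_large_sizes[of K n l] by (auto simp: xs_def ys_def)
    moreover have "fs \<in> ?A"
    proof -
      have "l k \<le> n" if "1 \<le> k" for k
      proof -
        have "1 * l k \<le> k * l k" using that by (intro mult_le_mono) auto
        then show ?thesis using partitions_of_mult_le[OF l, of k] by linarith
      qed
      then show ?thesis by (auto simp: fs_def)
    qed
    moreover have "l = ?F (fs, xs)"
    proof
      fix k
      have "count_list (replicate m (0::nat)) k = (if k = 0 then m else 0)" for m by (induction m) auto
      then have "k \<in> {K<..n} \<Longrightarrow> count_list xs k = l k"
        by (simp add: xs_def ys_def count_list_large_sizes)
      moreover have "l k = 0" if "k \<notin> {1..K}" "k \<notin> {K<..n}"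
        using partitions_of_support[OF l, of k] that by fastforce
      ultimately show "l k = ?F (fs, xs) k" by (auto simp: fs_def simp del: upt_Suc)
    qed
    ultimately show "l \<in> ?F ` (?A \<times> ?B)" by (intro image_eqI[of _ _ "(fs, xs)"]) auto
  qed
  then have "card (partitions_of n) \<le> card (?F ` (?A \<times> ?B))" by (intro card_mono) (use fin in auto)
  also have "\<dots> \<le> card (?A \<times> ?B)" by (rule card_image_le) (use fin in auto)
  also have "\<dots> = (n + 1) ^ (K + n div K)"
    by (simp add: card_cartesian_product card_lists_length_eq power_add)
  finally show ?thesis .
qed

section \<open>Bounds on component weights\<close>

lemma binomial_ratio_tendsto:
  "(\<lambda>N. real ((N - 1) choose j) / real N ^ j) \<longlonglongrightarrow> 1 / fact j"
proof -
  have eq: "real ((N - 1) choose j) / real N ^ j = (\<Prod>i<j. (real N - 1 - real i) / real N) / fact j"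
    if "N \<ge> 1" for N
  proof -
    have "real ((N - 1) choose j) = real (N - 1) gchoose j" by (simp add: binomial_gbinomial)
    also have "\<dots> = (\<Prod>i<j. real N - 1 - real i) / fact j"
      using that by (simp add: gbinomial_prod_rev atLeast0LessThan of_nat_diff)
    finally show ?thesis using that by (simp add: prod_dividef)
  qed
  have "(\<lambda>N. (\<Prod>i<j. (real N - 1 - real i) / real N) / fact j) \<longlonglongrightarrow> (\<Prod>i<j. 1) / fact j"
  proof (intro tendsto_intros)
    fix i show "(\<lambda>N. (real N - 1 - real i) / real N) \<longlonglongrightarrow> 1" by real_asymp
  qed simp
  then have "(\<lambda>N. (\<Prod>i<j. (real N - 1 - real i) / real N) / fact j) \<longlonglongrightarrow> 1 / fact j" by simp
  then show ?thesis
    by (rule Lim_transform_eventually) (use eq in \<open>auto intro!: eventually_sequentiallyI[of 1]\<close>)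
qed

text \<open>The summands form the Borel law, the total progeny of a branching process with Poisson
  offspring of mean \<open>x\<close>. They arise as limits at \<open>p = x / N\<close>,
  \<open>N\<close> tending to infinity, of lower bounds for the law of the component of vertex
  \<open>1\<close>; the bound by total mass one survives the limit.\<close>

lemma tree_sum_le_1:
  fixes x :: real
  assumes x: "0 \<le> x"
  shows "(\<Sum>k=1..K. real (tree_count k) * x ^ (k - 1) * exp (- (x * real k)) / fact (k - 1)) \<le> 1"
proof -
  define c where "c k = (k choose 2) - (k - 1)" for k :: nat
  define a where "a N k = real ((N - 1) choose (k - 1)) / real N ^ (k - 1) * real (tree_count k) * x ^ (k - 1)
      * (1 - x / real N) ^ c k * ((1 - x / real N) ^ N) ^ k" for N k
  have lim: "(\<lambda>N. \<Sum>k=1..K. a N k) \<longlonglongrightarrow>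
     (\<Sum>k=1..K. 1 / fact (k - 1) * real (tree_count k) * x ^ (k - 1) * (1 - 0) ^ c k * exp (- x) ^ k)"
    unfolding a_def
  proof (intro tendsto_sum tendsto_mult tendsto_power tendsto_const binomial_ratio_tendsto tendsto_diff)
    show "(\<lambda>N. x / real N) \<longlonglongrightarrow> 0" by real_asymp
    show "(\<lambda>N. (1 - x / real N) ^ N) \<longlonglongrightarrow> exp (- x)"
      using tendsto_exp_limit_sequentially[of "- x"] by simp
  qed
  have bound: "(\<Sum>k=1..K. a N k) \<le> 1" if N: "N \<ge> K + 1" "real N \<ge> x" for N
  proof -
    define p where "p = x / real N"
    have p: "0 \<le> p" "p \<le> 1" using N x by (auto simp: p_def field_simps)
    have "(\<Sum>k=1..K. a N k) \<le> (\<Sum>k=1..K. real ((N - 1) choose (k - 1)) * (conn_prob p k * (1 - p) ^ (k * (N - k))))"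
    proof (rule sum_mono)
      fix k assume k: "k \<in> {1..K}"
      have "a N k = real ((N - 1) choose (k - 1)) * (real (tree_count k) * p ^ (k - 1) * (1 - p) ^ c k * (1 - p) ^ (k * N))"
        by (simp add: a_def p_def power_divide power_mult[symmetric] mult.commute)
      also have "\<dots> \<le> real ((N - 1) choose (k - 1)) * (conn_prob p k * (1 - p) ^ (k * (N - k)))"
      proof (intro mult_left_mono mult_mono)
        show "real (tree_count k) * p ^ (k - 1) * (1 - p) ^ c k \<le> conn_prob p k"
          using conn_prob_ge[OF p, of k] by (simp add: c_def)
        show "(1 - p) ^ (k * N) \<le> (1 - p) ^ (k * (N - k))"
          by (rule power_decreasing) (use p in auto)
      qed (use p conn_prob_nonneg[OF p] in auto)
      finally show "a N k \<le> real ((N - 1) choose (k - 1)) * (conn_prob p k * (1 - p) ^ (k * (N - k)))" .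
    qed
    also have "\<dots> \<le> (\<Sum>k=1..N. real ((N - 1) choose (k - 1)) * (conn_prob p k * (1 - p) ^ (k * (N - k))))"
      by (rule sum_mono2) (use N p conn_prob_nonneg[OF p] in \<open>auto intro!: mult_nonneg_nonneg\<close>)
    also have "\<dots> = 1" by (rule sum_conn_prob) (use N in auto)
    finally show ?thesis .
  qed
  have ev: "eventually (\<lambda>N. (\<Sum>k=1..K. a N k) \<le> 1) sequentially"
  proof -
    obtain N0 where "real N0 \<ge> x" using real_arch_simple by blast
    then show ?thesis
      by (intro eventually_sequentiallyI[of "N0 + K + 1"] bound) auto
  qed
  have "(\<Sum>k=1..K. 1 / fact (k - 1) * real (tree_count k) * x ^ (k - 1) * (1 - 0) ^ c k * exp (- x) ^ k) \<le> 1"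
    by (rule tendsto_upperbound[OF lim ev]) simp
  also have "(\<Sum>k=1..K. 1 / fact (k - 1) * real (tree_count k) * x ^ (k - 1) * (1 - 0) ^ c k * exp (- x) ^ k)
     = (\<Sum>k=1..K. real (tree_count k) * x ^ (k - 1) * exp (- (x * real k)) / fact (k - 1))"
    by (intro sum.cong refl) (simp add: exp_of_nat_mult[symmetric] mult.commute)
  finally show ?thesis .
qed

text \<open>Under the substitution \<open>y * exp (- y)\<close> the derivative of the series becomes
  \<open>1 - y\<close> times a partial sum of the Borel law, hence is at most \<open>1 - y\<close>;
  integrate from \<open>0\<close> to \<open>x\<close>. The hypothesis \<open>x \<le> 1\<close> keeps
  the factor \<open>1 - y\<close> nonnegative.\<close>

lemma tree_gf_le:
  fixes x :: real
  assumes x: "0 \<le> x" "x \<le> 1"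
  shows "(\<Sum>k=1..K. real (tree_count k) * (x * exp (- x)) ^ k / fact k) \<le> x - x\<^sup>2 / 2"
proof -
  define g where "g y = y - y\<^sup>2 / 2 - (\<Sum>k=1..K. real (tree_count k) * (y * exp (- y)) ^ k / fact k)" for y :: real
  have "g 0 \<le> g x"
  proof (rule DERIV_nonneg_imp_nondecreasing[OF x(1)])
    fix y assume y: "0 \<le> y" "y \<le> x"
    let ?d = "(1 - y) * (1 - (\<Sum>k=1..K. real (tree_count k) * y ^ (k - 1) * exp (- (y * real k)) / fact (k - 1)))"
    have t: "((\<lambda>y. real (tree_count k) * (y * exp (- y)) ^ k / fact k) has_real_derivative
        (1 - y) * (real (tree_count k) * y ^ (k - 1) * exp (- (y * real k)) / fact (k - 1))) (at y)"
      if k: "k \<in> {1..K}" for k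
    proof -
      obtain j where j: "k = Suc j" using k by (cases k) auto
      have e: "exp (- (y * real k)) = exp (- y) * exp (- y) ^ j"
      proof -
        have "- (y * real k) = - y + real j * (- y)" by (simp add: j algebra_simps)
        then show ?thesis by (simp only: exp_add exp_of_nat_mult)
      qed
      have kj: "k - 1 = j" "k - Suc 0 = j" and fk: "(fact k :: real) = real k * fact j" and k0: "0 < real k"
        by (simp_all add: j)
      have h: "((\<lambda>y. y * exp (- y)) has_real_derivative (exp (- y) - y * exp (- y))) (at y)"
        by (auto intro!: derivative_eq_intros simp: algebra_simps)
      have "((\<lambda>y. real (tree_count k) * (y * exp (- y)) ^ k / fact k) has_real_derivative
         (real (tree_count k) * (real k * ((exp (- y) - y * exp (- y)) * (y * exp (- y)) ^ j)) / fact k)) (at y)"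
        using DERIV_cdivide[OF DERIV_cmult[OF DERIV_power[OF h, of k]]] unfolding kj .
      also have "real (tree_count k) * (real k * ((exp (- y) - y * exp (- y)) * (y * exp (- y)) ^ j)) / fact k
         = (1 - y) * (real (tree_count k) * y ^ (k - 1) * exp (- (y * real k)) / fact (k - 1))"
        unfolding e kj fk using k0 by (simp add: power_mult_distrib field_simps)
      finally show ?thesis .
    qed
    have "(g has_real_derivative (1 - 2 * y / 2 - (\<Sum>k=1..K. (1 - y) *
        (real (tree_count k) * y ^ (k - 1) * exp (- (y * real k)) / fact (k - 1))))) (at y)"
      unfolding g_def by (intro derivative_intros DERIV_sum t) (auto intro!: derivative_eq_intros)
    also have "1 - 2 * y / 2 - (\<Sum>k=1..K. (1 - y) *
        (real (tree_count k) * y ^ (k - 1) * exp (- (y * real k)) / fact (k - 1))) = ?d"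
      by (simp only: sum_distrib_left[symmetric]) (simp add: algebra_simps)
    finally have "(g has_real_derivative ?d) (at y)" .
    moreover have "0 \<le> ?d" using tree_sum_le_1[of y K] x y by (intro mult_nonneg_nonneg) auto
    ultimately show "\<exists>d. (g has_real_derivative d) (at y) \<and> 0 \<le> d" by blast
  qed
  moreover have "g 0 = 0" by (auto simp: g_def intro!: sum.neutral)
  ultimately show ?thesis by (simp add: g_def)
qed

lemma one_minus_ge_exp:
  fixes p :: real
  assumes "0 \<le> p" "p \<le> 1/2"
  shows "- p - 2 * p\<^sup>2 \<le> ln (1 - p)" "exp (- (2 * p)) \<le> 1 - p"
proof -
  show 1: "- p - 2 * p\<^sup>2 \<le> ln (1 - p)"
    using ln_one_minus_pos_lower_bound[of p] assms by simp
  have "2 * p\<^sup>2 \<le> p" using assms mult_left_mono[of p "1/2" p] by (simp add: power2_eq_square)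
  then have "- (2 * p) \<le> ln (1 - p)" using 1 by linarith
  then show "exp (- (2 * p)) \<le> 1 - p" using assms by (metis exp_le_cancel_iff exp_ln diff_gt_0_iff_gt le_less_trans less_numeral_extra(1) one_less_numeral_iff half_gt_zero_iff field_sum_of_halves less_add_same_cancel1 half_gt_zero order_le_less_trans zero_less_one)
qed

text \<open>For sizes up to \<open>1 / sqrt p\<close> the factor for the pairs inside a component is
  at most \<open>1 + 2 * p * k\<^sup>2\<close>. The leading part is the tree series
  \<open>X k / p\<close>; in the correction \<open>2 * k\<^sup>2 * X k\<close>, one factor
  \<open>k\<close> is bounded by \<open>K\<close> and the other turns \<open>X k\<close> into a term
  of the Borel law.\<close>

lemma small_comp_weight_sum:
  assumes p: "0 < p" "p \<le> 1/2" and K: "p * (real K)\<^sup>2 \<le> 1" and x: "0 \<le> x" "x \<le> 1"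
  shows "(\<Sum>k=1..K. comp_weight p k * (x * exp (- x) / p) ^ k) \<le> (x - x\<^sup>2 / 2) / p + 2 * real K"
proof -
  define s where "s = sqrt (1 - p)"
  have s: "exp (- p) \<le> s" "0 < s"
  proof -
    have "(exp (- p))\<^sup>2 \<le> 1 - p"
      using one_minus_ge_exp(2)[of p] p by (simp add: exp_double[symmetric] power2_eq_square exp_add[symmetric])
    then show "exp (- p) \<le> s" unfolding s_def by (rule real_le_rsqrt)
    then show "0 < s" using exp_gt_zero less_le_trans by blast
  qed
  define X where "X k = real (tree_count k) * (x * exp (- x)) ^ k / fact k" for k
  define Y where "Y k = real (tree_count k) * x ^ (k - 1) * exp (- (x * real k)) / fact (k - 1)" for k
  have X0: "0 \<le> X k" and Y0: "0 \<le> Y k" for k using x by (auto simp: X_def Y_def)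
  have "comp_weight p k * (x * exp (- x) / p) ^ k \<le> X k / p + 2 * Y k * real K" if k: "k \<in> {1..K}" for k
  proof -
    obtain j where j: "k = Suc j" using k by (cases k) auto
    have kK: "(real k)\<^sup>2 \<le> (real K)\<^sup>2" using k by (intro power_mono) auto
    have pk: "p * (real k)\<^sup>2 \<le> 1" using K mult_left_mono[OF kK, of p] p by linarith
    have "exp (- p) ^ k\<^sup>2 \<le> s ^ k\<^sup>2" using s by (intro power_mono) auto
    then have "1 / s ^ k\<^sup>2 \<le> 1 / exp (- p) ^ k\<^sup>2"
      using s by (intro divide_left_mono) auto
    also have "\<dots> = exp (p * (real k)\<^sup>2)"
      by (simp add: exp_of_nat_mult[symmetric] exp_minus field_simps)
    also have "\<dots> \<le> 1 + p * (real k)\<^sup>2 + (p * (real k)\<^sup>2)\<^sup>2" by (rule exp_bound) (use p pk in auto)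
    also have "\<dots> \<le> 1 + 2 * (p * (real k)\<^sup>2)"
      using mult_left_mono[OF pk, of "p * (real k)\<^sup>2"] p by (simp add: power2_eq_square)
    finally have inv: "1 / s ^ k\<^sup>2 \<le> 1 + 2 * (p * (real k)\<^sup>2)" .
    have "comp_weight p k * (x * exp (- x) / p) ^ k = conn_prob p k * (x * exp (- x)) ^ k / (fact k * p ^ k) * (1 / s ^ k\<^sup>2)"
      by (simp add: comp_weight_def s_def power_divide)
    also have "\<dots> \<le> real (tree_count k) * p ^ (k - 1) * (x * exp (- x)) ^ k / (fact k * p ^ k) * (1 + 2 * (p * (real k)\<^sup>2))"
      using conn_prob_le[of p k] conn_prob_nonneg[of p k] p k x s inv
      by (intro mult_mono divide_right_mono) auto
    also have "real (tree_count k) * p ^ (k - 1) * (x * exp (- x)) ^ k / (fact k * p ^ k) = X k / p"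
      using p by (simp add: X_def j del: fact_Suc)
    also have "X k / p * (1 + 2 * (p * (real k)\<^sup>2)) = X k / p + 2 * ((real k)\<^sup>2 * X k)"
      using p by (simp add: field_simps)
    also have "(real k)\<^sup>2 * X k = Y k * (real k * x)"
    proof -
      have kj: "k - 1 = j" and fk: "(fact k :: real) = real k * fact j" and k0: "0 < real k"
        by (simp_all add: j)
      have pw: "(x * exp (- x)) ^ k = x * exp (- x) * (x * exp (- x)) ^ j" by (simp add: j)
      have "- (x * real k) = - x + real j * (- x)" by (simp add: j algebra_simps)
      then have e: "exp (- (x * real k)) = exp (- x) * exp (- x) ^ j" by (simp only: exp_add exp_of_nat_mult)
      show ?thesis
        unfolding X_def Y_def e kj fk pw using k0 by (simp add: power_mult_distrib field_simps power2_eq_square)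
    qed
    also have "X k / p + 2 * (Y k * (real k * x)) \<le> X k / p + 2 * (Y k * real K)"
    proof -
      have "real k * x \<le> real K * 1" using k x by (intro mult_mono) auto
      then show ?thesis using mult_left_mono[OF _ Y0, of "real k * x" "real K" k] by simp
    qed
    finally show ?thesis by simp
  qed
  then have "(\<Sum>k=1..K. comp_weight p k * (x * exp (- x) / p) ^ k) \<le> (\<Sum>k=1..K. X k / p + 2 * Y k * real K)"
    by (intro sum_mono) auto
  also have "\<dots> = (\<Sum>k=1..K. X k) / p + 2 * (\<Sum>k=1..K. Y k) * real K"
    by (simp add: sum.distrib sum_divide_distrib sum_distrib_right sum_distrib_left)
  also have "\<dots> \<le> (x - x\<^sup>2 / 2) / p + 2 * 1 * real K"
    using tree_gf_le[OF x, of K] tree_sum_le_1[OF x(1), of K] p unfolding X_def[symmetric] Y_def[symmetric]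
    by (intro add_mono divide_right_mono mult_right_mono) auto
  finally show ?thesis by simp
qed

text \<open>The source of the cubic cost of a subcritical remainder: later, \<open>x\<close> is
  \<open>p\<close> times the number of vertices in small components. The difference of the sides has
  derivative \<open>c\<close>, and \<open>c\<close> has the nonnegative derivative
  \<open>(1 - t)\<^sup>2 / t\<close>; both vanish at \<open>1\<close>.\<close>

lemma neg_x_ln_x_le:
  fixes x :: real
  assumes "0 \<le> x" "x \<le> 1"
  shows "- (x * ln x) \<le> 1/2 - x\<^sup>2 / 2 - (1 - x) ^ 3 / 6"
proof (cases "x = 0")
  case True
  then show ?thesis by simp
next
  case False
  then have x: "0 < x" "x \<le> 1" using assms by auto
  define c where "c y = 1 - y + (1 - y)\<^sup>2 / 2 + ln y" for y :: real
  have c: "c y \<le> 0" if y: "0 < y" "y \<le> 1" for y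
  proof -
    have "c y \<le> c 1"
    proof (rule DERIV_nonneg_imp_nondecreasing[OF y(2)])
      fix t assume t: "y \<le> t" "t \<le> 1"
      have "(c has_real_derivative (- 1 - (1 - t) + 1 / t)) (at t)"
        unfolding c_def using t y by (auto intro!: derivative_eq_intros simp: field_simps)
      moreover have "- 1 - (1 - t) + 1 / t = (1 - t)\<^sup>2 / t"
        using t y by (simp add: field_simps power2_eq_square)
      ultimately show "\<exists>d. (c has_real_derivative d) (at t) \<and> 0 \<le> d" using t y by auto
    qed
    then show ?thesis by (simp add: c_def)
  qed
  define f where "f y = 1/2 - y\<^sup>2 / 2 - (1 - y) ^ 3 / 6 + y * ln y" for y :: real
  have "f 1 \<le> f x"
  proof (rule DERIV_nonpos_imp_nonincreasing[OF x(2)])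
    fix t assume t: "x \<le> t" "t \<le> 1"
    have "(f has_real_derivative c t) (at t)"
      unfolding f_def c_def using t x by (auto intro!: derivative_eq_intros simp: power2_eq_square field_simps)
    then show "\<exists>d. (f has_real_derivative d) (at t) \<and> d \<le> 0" using c[of t] t x by auto
  qed
  then show ?thesis by (simp add: f_def)
qed

text \<open>The left side has derivative \<open>ln (1 - u\<^sup>2)\<close>, so it is
  \<open>- u ^ 3 / 3\<close> to leading order. The denominator makes the bound valid for every
  \<open>u < 1\<close>, which is needed before sizes are known to be \<open>O(a)\<close>.\<close>

lemma entropy_difference_ge:
  fixes u :: real
  assumes "0 \<le> u" "u < 1"
  shows "(1 + u) * ln (1 + u) - (1 - u) * ln (1 - u) - 2 * u \<ge> - (u ^ 3 / (3 * (1 - u\<^sup>2)))"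
proof -
  define f where "f t = (1 + t) * ln (1 + t) - (1 - t) * ln (1 - t) - 2 * t + t ^ 3 / (3 * (1 - t\<^sup>2))" for t :: real
  have "f 0 \<le> f u"
  proof (rule DERIV_nonneg_imp_nondecreasing[OF assms(1)])
    fix t assume t: "0 \<le> t" "t \<le> u"
    have sq: "t\<^sup>2 < 1" using t assms by (simp add: abs_square_less_1)
    define q where "q = 1 - t\<^sup>2"
    have q: "0 < q" using sq by (simp add: q_def)
    have d: "(f has_real_derivative (ln (1 + t) + ln (1 - t) + (3 * t\<^sup>2 * (3 * (1 - t\<^sup>2)) - t ^ 3 * (3 * (- (2 * t)))) / (3 * (1 - t\<^sup>2))\<^sup>2)) (at t)"
      unfolding f_def using t assms sq
      by (auto intro!: derivative_eq_intros simp: power2_eq_square)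
    have a1: "ln (1 + t) + ln (1 - t) = ln q"
      using t assms by (subst ln_mult_pos[symmetric]) (auto simp: q_def algebra_simps power2_eq_square)
    have a2: "(3 * t\<^sup>2 * (3 * (1 - t\<^sup>2)) - t ^ 3 * (3 * (- (2 * t)))) / (3 * (1 - t\<^sup>2))\<^sup>2 = t\<^sup>2 / q + 2 * t ^ 4 / (3 * q\<^sup>2)"
      using q unfolding q_def[symmetric] by (simp add: field_simps power2_eq_square eval_nat_numeral)
    have a3: "- (t\<^sup>2 / q) \<le> ln q"
    proof -
      have "ln (1 / q) \<le> 1 / q - 1" using q by (intro ln_le_minus_one) auto
      moreover have "1 / q - 1 = t\<^sup>2 / q" using q by (simp add: field_simps q_def)
      ultimately show ?thesis using q by (simp add: ln_div)
    qed
    have a4: "0 \<le> 2 * t ^ 4 / (3 * q\<^sup>2)" using t by simp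
    show "\<exists>d. (f has_real_derivative d) (at t) \<and> 0 \<le> d"
    proof (intro exI conjI)
      show "(f has_real_derivative (ln q + (t\<^sup>2 / q + 2 * t ^ 4 / (3 * q\<^sup>2)))) (at t)"
        using d unfolding a1 a2 .
      show "0 \<le> ln q + (t\<^sup>2 / q + 2 * t ^ 4 / (3 * q\<^sup>2))" using a3 a4 by linarith
    qed
  qed
  then show ?thesis by (simp add: f_def)
qed

section \<open>Exponential bounds for component weights and count vectors\<close>

lemma ln_fact_diff_ge:
  assumes "j \<le> m"
  shows "ln (fact m) - ln (fact j) \<ge> (real m * ln (real m) - real m) - (real j * ln (real j) - real j)"
  using assms
proof (induction m rule: dec_induct)
  case base
  then show ?case by simp
next
  case (step m)
  have "ln (fact (Suc m) :: real) = ln (real (Suc m)) + ln (fact m)"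
    by (simp add: ln_mult)
  moreover have "real m * (ln (real (Suc m)) - ln (real m)) \<le> 1"
  proof (cases "m = 0")
    case False
    have "ln (real (Suc m)) - ln (real m) = ln (1 + 1 / real m)"
      using False by (subst ln_divide_pos[symmetric]) (auto simp: field_simps)
    also have "\<dots> \<le> 1 / real m" by (rule ln_add_one_self_le_self) simp
    finally show ?thesis using False by (simp add: field_simps)
  qed simp
  ultimately show ?case using step by (simp add: algebra_simps)
qed

text \<open>To leading order the logarithm of the bound in \<open>comp_weight_le\<close> is
  \<open>- k * ln (N - k / 2) + p * k * (N - k / 2)\<close>, which is minimal at
  \<open>N - k / 2 = 1 / p\<close>. This dictates \<open>n\<close>. The symmetry of
  \<open>v + k / 2\<close> and \<open>v - k / 2\<close> about \<open>v\<close> cancels the quadratic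
  terms and leaves the cubic one.\<close>

lemma comp_weight_bound:
  assumes p: "0 < p" "p \<le> 1/2" and k: "1 \<le> k" "real k * p < 2"
  shows "comp_weight p k \<le> 3 / p * exp 8 *
     exp (real k * (1 + ln p) + real k ^ 3 * p\<^sup>2 / (24 * (1 - (real k * p / 2)\<^sup>2)))"
proof -
  define v where "v = 1 / p"
  have v: "2 \<le> v" "0 < v" using p by (auto simp: v_def field_simps)
  define u where "u = real k * p / 2"
  have u: "0 \<le> u" "u < 1" using k p by (auto simp: u_def)
  have uv: "real k / 2 = u * v" using p by (simp add: u_def v_def)
  define n where "n = nat \<lceil>v + real k / 2\<rceil>"
  have n: "v + real k / 2 \<le> real n" "real n \<le> v + real k / 2 + 1"
  proof -
    have "0 \<le> \<lceil>v + real k / 2\<rceil>" using v by simp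
    then have "real n = of_int \<lceil>v + real k / 2\<rceil>" by (simp add: n_def)
    then show "v + real k / 2 \<le> real n" "real n \<le> v + real k / 2 + 1"
      using le_of_int_ceiling[of "v + real k / 2"] of_int_ceiling_le_add_one[of "v + real k / 2"] by simp_all
  qed
  have kv: "real k / 2 < v" using uv u v by (simp add: mult_less_cancel_right1)
  have kn: "k \<le> n" using n kv by linarith
  define s where "s = sqrt (1 - p)"
  have s: "0 < s" using p by (simp add: s_def)
  have "n\<^sup>2 = (n - k)\<^sup>2 + (2 * k * n - k\<^sup>2)"
  proof -
    obtain i where "n = k + i" using kn le_Suc_ex by auto
    then show ?thesis by (simp add: power2_eq_square algebra_simps)
  qed
  then have sn: "s ^ n\<^sup>2 = s ^ (n - k)\<^sup>2 * s ^ (2 * k * n - k\<^sup>2)" by (simp add: power_add)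
  have D: "part_weight p n = part_weight p (n - k) * (fact n / fact (n - k) * s ^ (2 * k * n - k\<^sup>2))"
    unfolding part_weight_def s_def[symmetric] sn by simp
  have pos: "0 < part_weight p (n - k)" using p by (intro part_weight_pos) simp
  have "comp_weight p k * (fact n / fact (n - k) * s ^ (2 * k * n - k\<^sup>2)) * part_weight p (n - k) \<le> real n * part_weight p (n - k)"
    using comp_weight_le[of p k n] p k kn unfolding D by (simp add: mult_ac)
  from mult_right_le_imp_le[OF this pos]
  have w: "comp_weight p k * (fact n / fact (n - k) * s ^ (2 * k * n - k\<^sup>2)) \<le> real n" .
  define F where "F = real k ^ 3 * p\<^sup>2 / (24 * (1 - u\<^sup>2))"
  have fct: "ln (fact n / fact (n - k)) \<ge> - real k * ln p - F"
  proof -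
    define G where "G t = t * ln t - t" for t :: real
    have x: "0 < v - real k / 2" using kv by simp
    \<comment> \<open>Rounding \<open>n\<close> up is harmless: \<open>G\<close> is convex, so its
      increment over an interval of length \<open>k\<close> grows when the interval moves to the
      right.\<close>
    have "G (v + real k / 2) - G (v - real k / 2) \<le> G (real n) - G (real n - real k)"
    proof -
      define H where "H t = G (t + real k) - G t" for t
      have "H (v - real k / 2) \<le> H (real n - real k)"
      proof (rule DERIV_nonneg_imp_nondecreasing[where f = H])
        show "v - real k / 2 \<le> real n - real k" using n by simp
        fix t assume t: "v - real k / 2 \<le> t" "t \<le> real n - real k"
        have "(H has_real_derivative ln (t + real k) - ln t) (at t)"
          unfolding H_def G_def using t x by (auto intro!: derivative_eq_intros)
        moreover have "ln t \<le> ln (t + real k)" using t x by simp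
        ultimately show "\<exists>d. (H has_real_derivative d) (at t) \<and> 0 \<le> d" by auto
      qed
      then show ?thesis by (simp add: H_def algebra_simps)
    qed
    also have "\<dots> \<le> ln (fact n) - ln (fact (n - k))"
      using ln_fact_diff_ge[of "n - k" n] kn by (simp add: G_def of_nat_diff)
    also have "\<dots> = ln (fact n / fact (n - k))" by (simp add: ln_div)
    finally have 1: "G (v + real k / 2) - G (v - real k / 2) \<le> ln (fact n / fact (n - k))" .
    have a: "ln (v * (1 + u)) = ln v + ln (1 + u)" "ln (v * (1 - u)) = ln v + ln (1 - u)"
      using v u by (simp_all add: ln_mult)
    have b: "v + real k / 2 = v * (1 + u)" "v - real k / 2 = v * (1 - u)" by (simp_all add: uv algebra_simps)
    have "G (v + real k / 2) - G (v - real k / 2) = v * (1 + u) * (ln v + ln (1 + u)) - v * (1 + u)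
        - (v * (1 - u) * (ln v + ln (1 - u)) - v * (1 - u))"
      unfolding b G_def a ..
    also have "\<dots> = 2 * (u * v) * ln v + v * ((1 + u) * ln (1 + u) - (1 - u) * ln (1 - u) - 2 * u)"
      by (simp add: algebra_simps)
    also have "\<dots> \<ge> 2 * (u * v) * ln v + v * (- (u ^ 3 / (3 * (1 - u\<^sup>2))))"
      using entropy_difference_ge[OF u] v by (intro add_left_mono mult_left_mono) auto
    also have "2 * (u * v) * ln v + v * (- (u ^ 3 / (3 * (1 - u\<^sup>2)))) = - real k * ln p - F"
    proof -
      have lnv: "ln v = - ln p" using p by (simp add: v_def ln_div)
      have "v * u ^ 3 = real k ^ 3 * p\<^sup>2 / 8"
        using p by (simp add: u_def v_def power_divide power_mult_distrib field_simps eval_nat_numeral)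
      then have k3: "real k ^ 3 * p\<^sup>2 = 8 * (v * u ^ 3)" by simp
      have e24: "24 * (1 - u\<^sup>2) = 8 * (3 * (1 - u\<^sup>2))" by simp
      have "F = v * u ^ 3 / (3 * (1 - u\<^sup>2))"
        unfolding F_def k3 e24 by (rule mult_divide_mult_cancel_left) simp
      then show ?thesis unfolding uv[symmetric] lnv by simp
    qed
    finally show ?thesis using 1 by simp
  qed
  have sp: "ln (s ^ (2 * k * n - k\<^sup>2)) \<ge> - (real k + 8)"
  proof -
    have kk: "k\<^sup>2 \<le> 2 * k * n" using kn mult_le_mono[of k n k k] by (simp add: power2_eq_square mult.commute)
    have "real (2 * k * n - k\<^sup>2) = 2 * real k * (real n - real k / 2)"
      using kk by (simp add: of_nat_diff power2_eq_square algebra_simps)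
    also have "\<dots> \<le> 2 * real k * (v + 1)" using n by (intro mult_left_mono) auto
    finally have e: "real (2 * k * n - k\<^sup>2) \<le> 2 * real k * (v + 1)" .
    have l: "- (p + 2 * p\<^sup>2) / 2 \<le> ln s"
      using one_minus_ge_exp(1)[of p] p by (simp add: s_def ln_sqrt)
    \<comment> \<open>The \<open>8\<close> is \<open>6 + 2\<close>, from
      \<open>3 * (k * p) \<le> 6\<close> and \<open>2 * (k * p) * p \<le> 2\<close>.\<close>
    have "- (real k + 8) \<le> 2 * real k * (v + 1) * (- (p + 2 * p\<^sup>2) / 2)"
    proof -
      have "2 * real k * (v + 1) * ((p + 2 * p\<^sup>2) / 2) = real k + 3 * (real k * p) + 2 * (real k * p) * p"
        using p by (simp add: v_def field_simps power2_eq_square)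
      also have "\<dots> \<le> real k + 3 * 2 + 2 * 2 * (1/2)"
        using k p by (intro add_mono mult_mono) auto
      finally have "2 * real k * (v + 1) * ((p + 2 * p\<^sup>2) / 2) \<le> real k + 8" by simp
      moreover have "2 * real k * (v + 1) * (- (p + 2 * p\<^sup>2) / 2) = - (2 * real k * (v + 1) * ((p + 2 * p\<^sup>2) / 2))"
        by (simp only: minus_divide_left[symmetric] mult_minus_right)
      ultimately show ?thesis by linarith
    qed
    also have "\<dots> \<le> real (2 * k * n - k\<^sup>2) * (- (p + 2 * p\<^sup>2) / 2)"
    proof (rule mult_right_mono_neg[OF e])
      have "0 \<le> (p + 2 * p\<^sup>2) / 2" using p by simp
      then show "- (p + 2 * p\<^sup>2) / 2 \<le> 0" by (simp only: minus_divide_left[symmetric] neg_le_0_iff_le)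
    qed
    also have "\<dots> \<le> real (2 * k * n - k\<^sup>2) * ln s" using l by (intro mult_left_mono) auto
    finally show ?thesis using s by (simp add: ln_realpow)
  qed
  have "exp (- real k * ln p - F + - (real k + 8)) \<le> exp (ln (fact n / fact (n - k)) + ln (s ^ (2 * k * n - k\<^sup>2)))"
    using fct sp by (intro exp_le_cancel_iff[THEN iffD2] add_mono)
  also have "\<dots> = fact n / fact (n - k) * s ^ (2 * k * n - k\<^sup>2)"
    using s by (simp add: exp_add)
  finally have ef: "exp (- real k * ln p - F + - (real k + 8)) \<le> fact n / fact (n - k) * s ^ (2 * k * n - k\<^sup>2)" .
  have wp: "0 \<le> comp_weight p k" using p by (intro comp_weight_nonneg) auto
  have "comp_weight p k * exp (- real k * ln p - F + - (real k + 8)) \<le> real n"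
    using order.trans[OF mult_left_mono[OF ef wp] w] .
  then have "comp_weight p k \<le> real n * exp (real k * ln p + F + (real k + 8))"
    by (simp add: exp_minus exp_add exp_diff field_simps)
  also have "\<dots> \<le> 3 / p * exp (real k * ln p + F + (real k + 8))"
    using n kv v by (intro mult_right_mono) (auto simp: v_def)
  finally show ?thesis by (simp add: F_def u_def exp_add algebra_simps)
qed


text \<open>The last line of the bound is the error: \<open>2 * K\<close> from the small components,
  and the prefactor \<open>3 / p * exp 8\<close> of the weight for each of the at most
  \<open>N / K\<close> large ones. All main terms are kept with their exact constants.\<close>

lemma pmf_count_law_exp_bound:
  fixes p :: real and l :: "nat \<Rightarrow> nat" and N K :: nat
  defines "m \<equiv> real N - real (\<Sum>k\<in>{K<..N}. k * l k)"
  assumes p: "0 < p" "p \<le> 1/2" and l: "l \<in> partitions_of N" and K: "1 \<le> K" "K \<le> N" "p * (real K)\<^sup>2 \<le> 1"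
    and Np: "real N * p < 2"
  shows "pmf (count_law N p) l \<le> exp (ln (part_weight p N) + real N * (1 + ln p) + 1 / (2 * p)
     - (max 0 (1 - m * p)) ^ 3 / (6 * p)
     + (\<Sum>k\<in>{K<..N}. real (l k) * (real k ^ 3 * p\<^sup>2 / (24 * (1 - (real k * p / 2)\<^sup>2))))
     + 2 * real K + real N / real K * (ln (3 / p) + 8))"
proof -
  define M where "M = (\<Sum>k\<in>{K<..N}. k * l k)"
  define n where "n = N - M"
  have MN: "M \<le> N" using sum_large_le(1)[OF l] by (simp add: M_def)
  have m: "m = real n" using MN by (simp add: m_def M_def n_def of_nat_diff)
  have Nsplit: "real N = real M + real n" using MN by (simp add: n_def of_nat_diff)
  define f where "f k = real k ^ 3 * p\<^sup>2 / (24 * (1 - (real k * p / 2)\<^sup>2))" for k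
  define c where "c = ln (3 / p) + 8"
  have "1 \<le> 3 / p" using p by (simp add: field_simps)
  then have c0: "0 \<le> c" by (simp add: c_def)
  have C: "3 / p * exp 8 = exp c" using p by (simp add: c_def exp_add)
  \<comment> \<open>The saddle point of the tilt is \<open>x = n * p\<close>, with \<open>n\<close>
    vertices in small components. \<open>tree_gf_le\<close> covers only \<open>x \<le> 1\<close>; at
    the cap the cubic term is zero, in agreement with the \<open>max 0\<close> of the claim.\<close>
  define x where "x = min 1 (real n * p)"
  have x: "0 \<le> x" "x \<le> 1" using p by (auto simp: x_def)
  define z where "z = x * exp (- x) / p"
  have z0: "0 \<le> z" using x p by (simp add: z_def)
  define q where "q = ln x - x - ln p"
  have zn: "z ^ n = exp (real n * q)"
  proof (cases "n = 0")
    case False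
    then have "0 < x" using p by (simp add: x_def)
    have "exp (ln x + - x - ln p) = exp (ln x) * exp (- x) / exp (ln p)" by (simp only: exp_diff exp_add)
    then have "z = exp q" using p \<open>0 < x\<close> by (simp add: z_def q_def)
    then show ?thesis by (simp add: exp_of_nat_mult)
  qed simp
  have W: "(\<Sum>k=1..K. comp_weight p k * z ^ k) \<le> (x - x\<^sup>2 / 2) / p + 2 * real K"
    unfolding z_def by (rule small_comp_weight_sum) (use p K x in auto)
  have "(\<Prod>k\<in>{K<..N}. comp_weight p k ^ l k) \<le> (\<Prod>k\<in>{K<..N}. exp (c + (real k * (1 + ln p) + f k)) ^ l k)"
  proof (intro prod_mono conjI power_mono)
    fix k assume k: "k \<in> {K<..N}"
    have "real k * p \<le> real N * p" using k p by (intro mult_right_mono) auto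
    then have "comp_weight p k \<le> 3 / p * exp 8 * exp (real k * (1 + ln p) + f k)"
      unfolding f_def using k K p Np order.strict_trans1[OF \<open>real k * p \<le> real N * p\<close> Np]
      by (intro comp_weight_bound) auto
    then show "comp_weight p k \<le> exp (c + (real k * (1 + ln p) + f k))"
      unfolding C by (simp only: exp_add)
  qed (use p in \<open>auto intro!: comp_weight_nonneg zero_le_power\<close>)
  also have "\<dots> = exp (\<Sum>k\<in>{K<..N}. real (l k) * (c + (real k * (1 + ln p) + f k)))"
    by (simp add: exp_sum exp_of_nat_mult)
  also have "(\<Sum>k\<in>{K<..N}. real (l k) * (c + (real k * (1 + ln p) + f k)))
     = c * (\<Sum>k\<in>{K<..N}. real (l k)) + real M * (1 + ln p) + (\<Sum>k\<in>{K<..N}. real (l k) * f k)"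
    by (simp add: M_def sum.distrib sum_distrib_left sum_distrib_right algebra_simps)
  also have "\<dots> \<le> c * (real N / real K) + real M * (1 + ln p) + (\<Sum>k\<in>{K<..N}. real (l k) * f k)"
  proof -
    have "real (K * (\<Sum>k\<in>{K<..N}. l k)) \<le> real N"
      using sum_large_le(2)[OF l, of K] by (rule of_nat_mono)
    then have "(\<Sum>k\<in>{K<..N}. real (l k)) \<le> real N / real K" using K by (simp add: field_simps)
    then show ?thesis using c0 by (intro add_mono mult_left_mono) auto
  qed
  finally have P: "(\<Prod>k\<in>{K<..N}. comp_weight p k ^ l k)
      \<le> exp (c * (real N / real K) + real M * (1 + ln p) + (\<Sum>k\<in>{K<..N}. real (l k) * f k))" by simp
  have D: "0 < part_weight p N" using p by (intro part_weight_pos) auto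
  have "pmf (count_law N p) l * exp (real n * q) \<le>
     part_weight p N * exp (\<Sum>k=1..K. comp_weight p k * z ^ k) * (\<Prod>k\<in>{K<..N}. comp_weight p k ^ l k)"
    using pmf_count_law_le[OF _ _ l K(2) z0, of p] p unfolding M_def[symmetric] n_def[symmetric] zn by simp
  also have "\<dots> \<le> part_weight p N * exp ((x - x\<^sup>2 / 2) / p + 2 * real K) *
      exp (c * (real N / real K) + real M * (1 + ln p) + (\<Sum>k\<in>{K<..N}. real (l k) * f k))"
  proof (rule mult_mono[OF mult_left_mono P])
    show "0 \<le> (\<Prod>k\<in>{K<..N}. comp_weight p k ^ l k)"
      using p by (intro prod_nonneg zero_le_power comp_weight_nonneg ballI) auto
  qed (use W D in simp_all)
  also have "\<dots> = exp (ln (part_weight p N) + ((x - x\<^sup>2 / 2) / p + 2 * real K) +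
      (c * (real N / real K) + real M * (1 + ln p) + (\<Sum>k\<in>{K<..N}. real (l k) * f k)))"
    using D by (simp only: exp_add exp_ln)
  finally have "pmf (count_law N p) l \<le> exp (ln (part_weight p N) + ((x - x\<^sup>2 / 2) / p + 2 * real K) +
      (c * (real N / real K) + real M * (1 + ln p) + (\<Sum>k\<in>{K<..N}. real (l k) * f k)) - real n * q)"
    by (simp add: exp_diff pos_le_divide_eq)
  also have "\<dots> \<le> exp (ln (part_weight p N) + real N * (1 + ln p) + 1 / (2 * p)
     - (max 0 (1 - m * p)) ^ 3 / (6 * p)
     + (\<Sum>k\<in>{K<..N}. real (l k) * f k) + 2 * real K + real N / real K * c)"
  proof -
    have "(x - x\<^sup>2 / 2) / p + real M * (1 + ln p) - real n * q \<le>
       real N * (1 + ln p) + 1 / (2 * p) - (max 0 (1 - m * p)) ^ 3 / (6 * p)"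
    proof (cases "1 \<le> real n * p")
      case True
      then have "x = 1" by (simp add: x_def)
      moreover have "max 0 (1 - m * p) = 0" using True by (simp add: m)
      ultimately show ?thesis by (simp add: q_def Nsplit algebra_simps)
    next
      case False
      then have xe: "x = real n * p" and mx: "max 0 (1 - m * p) = 1 - x" by (auto simp: x_def m)
      have ne: "real n = x / p" using p by (simp add: xe)
      have "(x - x\<^sup>2 / 2) / p - real n * (ln x - x) - real n = (- (x * ln x) + x\<^sup>2 / 2) / p"
        unfolding ne using p by (simp add: field_simps power2_eq_square)
      also have "\<dots> \<le> (1 / 2 - (1 - x) ^ 3 / 6) / p"
        using neg_x_ln_x_le[OF x] p by (intro divide_right_mono) auto
      also have "\<dots> = 1 / (2 * p) - (1 - x) ^ 3 / (6 * p)" using p by (simp add: field_simps)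
      finally show ?thesis unfolding mx by (simp add: q_def Nsplit algebra_simps)
    qed
    then show ?thesis by (simp add: algebra_simps)
  qed
  finally show ?thesis unfolding f_def c_def .
qed

section \<open>Asymptotics in the critical window\<close>

lemma ln_fact_le:
  assumes "1 \<le> m"
  shows "ln (fact m) \<le> real m * ln (real m) - real m + ln (real m) + 1"
  using assms
proof (induction m rule: dec_induct)
  case base
  then show ?case by simp
next
  case (step m)
  have m: "0 < real m" using step by simp
  have "ln (fact (Suc m) :: real) = ln (real (Suc m)) + ln (fact m)"
    by (simp add: ln_mult)
  moreover have "1 \<le> real (Suc m) * (ln (real (Suc m)) - ln (real m))"
  proof -
    have "ln (real m / real (Suc m)) \<le> real m / real (Suc m) - 1"
      by (rule ln_le_minus_one) (use m in simp)
    moreover have "real m / real (Suc m) - 1 = - 1 / real (Suc m)" by (simp add: field_simps)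
    moreover have "ln (real m / real (Suc m)) = ln (real m) - ln (real (Suc m))"
      using m by (intro ln_divide_pos) auto
    ultimately have "1 / real (Suc m) \<le> ln (real (Suc m)) - ln (real m)" by simp
    then show ?thesis by (simp add: divide_le_eq mult.commute)
  qed
  ultimately show ?case using step by (simp add: algebra_simps)
qed

text \<open>A Taylor remainder divided by \<open>y ^ 3\<close>; the value at \<open>0\<close> is the
  coefficient of \<open>y ^ 3\<close> and removes the singularity.\<close>

definition cubic_quotient :: "real \<Rightarrow> real" where
  "cubic_quotient y = (if y = 0 then - 1/6 else ((1 + y) * ln (1 + y) - (1 + y)\<^sup>2 / 2 + 1/2) / y ^ 3)"

lemma cubic_quotient: "(1 + y) * ln (1 + y) - (1 + y)\<^sup>2 / 2 + 1/2 = cubic_quotient y * y ^ 3"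
  by (simp add: cubic_quotient_def)

lemma isCont_cubic_quotient: "isCont cubic_quotient 0"
proof -
  have "((\<lambda>y::real. ((1 + y) * ln (1 + y) - (1 + y)\<^sup>2 / 2 + 1/2) / y ^ 3) \<longlongrightarrow> - 1/6) (at 0)"
    by real_asymp
  then have "(cubic_quotient \<longlongrightarrow> - 1/6) (at 0)"
    by (rule Lim_transform_eventually) (auto simp: cubic_quotient_def eventually_at_filter)
  then show ?thesis by (simp add: isCont_def cubic_quotient_def)
qed

lemma cube_diff_le:
  fixes x y B :: real
  assumes "0 \<le> x" "x \<le> B" "0 \<le> y" "y \<le> B"
  shows "x ^ 3 - y ^ 3 \<le> 3 * B\<^sup>2 * \<bar>x - y\<bar>"
proof -
  have "x ^ 3 - y ^ 3 = (x - y) * (x * x + x * y + y * y)" by (simp add: eval_nat_numeral algebra_simps)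
  also have "\<dots> \<le> \<bar>x - y\<bar> * (x * x + x * y + y * y)" using assms by (intro mult_right_mono) auto
  also have "\<dots> \<le> \<bar>x - y\<bar> * (B * B + B * B + B * B)"
    using assms by (intro mult_left_mono add_mono mult_mono) auto
  finally show ?thesis by (simp add: power2_eq_square mult_ac)
qed

text \<open>The added terms cancel everything in \<open>ln (part_weight p N)\<close> that exceeds
  the speed: with \<open>N * p = 1 + y\<close> there remains
  \<open>cubic_quotient y * y ^ 3 / p\<close>, up to an error of order \<open>ln (1 / p)\<close>.
  The linear term cancels against the weights when components are added or removed.\<close>

definition log_weight :: "real \<Rightarrow> nat \<Rightarrow> real" where
  "log_weight p N = ln (part_weight p N) + real N * (1 + ln p) + 1 / (2 * p)"

definition moment :: "nat \<Rightarrow> nat \<Rightarrow> nat \<Rightarrow> real \<Rightarrow> (nat \<Rightarrow> nat) \<Rightarrow> real" where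
  "moment i K N a l = (\<Sum>k\<in>{K<..N}. real (l k) * (real k / a) ^ i)"

lemma moment_nonneg: "0 \<le> a \<Longrightarrow> 0 \<le> moment i K N a l"
  unfolding moment_def by (intro sum_nonneg) auto

lemma size_le_moment:
  assumes "0 < a" "k \<in> {K<..N}" "l k \<noteq> 0"
  shows "real k / a \<le> moment 1 K N a l"
proof -
  have "real k / a * 1 \<le> real k / a * real (l k)" using assms by (intro mult_left_mono) auto
  also have "\<dots> = real (l k) * (real k / a) ^ 1" by simp
  also have "\<dots> \<le> moment 1 K N a l"
    unfolding moment_def by (rule member_le_sum) (use assms in auto)
  finally show ?thesis by simp
qed

lemma moment_3_le:
  assumes "0 < a"
  shows "moment 3 K N a l \<le> (moment 1 K N a l) ^ 3"
proof -
  let ?m = "moment 1 K N a l"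
  have m0: "0 \<le> ?m" using assms by (intro moment_nonneg) simp
  have "moment 3 K N a l \<le> (\<Sum>k\<in>{K<..N}. ?m\<^sup>2 * (real (l k) * (real k / a) ^ 1))"
    unfolding moment_def[of 3]
  proof (rule sum_mono)
    fix k assume k: "k \<in> {K<..N}"
    show "real (l k) * (real k / a) ^ 3 \<le> ?m\<^sup>2 * (real (l k) * (real k / a) ^ 1)"
    proof (cases "l k = 0")
      case False
      have "(real k / a)\<^sup>2 \<le> ?m\<^sup>2" using size_le_moment[of a k K N l, OF assms k False] assms by (intro power_mono) auto
      then have "(real k / a)\<^sup>2 * (real (l k) * (real k / a)) \<le> ?m\<^sup>2 * (real (l k) * (real k / a))"
        using assms by (intro mult_right_mono) auto
      then show ?thesis by (simp add: eval_nat_numeral mult_ac)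
    qed simp
  qed
  also have "\<dots> = ?m\<^sup>2 * ?m" by (simp add: moment_def sum_distrib_left)
  finally show ?thesis by (simp add: eval_nat_numeral mult_ac)
qed

text \<open>The number of vertices is not part of the window, because the estimates are applied with
  the same \<open>p\<close> to \<open>n\<close>, to \<open>1 / p + x * a / 2\<close> and to what
  remains after removing components. The assumption \<open>speed_large\<close> makes the number of
  count vectors and the errors of the exponential bound negligible.\<close>

locale critical_window =
  fixes p a S :: "nat \<Rightarrow> real"
  assumes p_pos: "\<forall>\<^sub>F n in sequentially. 0 < p n" and p_null: "p \<longlonglongrightarrow> 0"
    and a_pos: "\<forall>\<^sub>F n in sequentially. 0 < a n" and S_pos: "\<forall>\<^sub>F n in sequentially. 0 < S n"
    and ap_null: "(\<lambda>n. a n * p n) \<longlonglongrightarrow> 0"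
    and speed_scale: "(\<lambda>n. a n ^ 3 * (p n)\<^sup>2 / S n) \<longlonglongrightarrow> 1"
    and speed_large: "(\<lambda>n. sqrt (1 / p n) * ln (1 / p n) / S n) \<longlonglongrightarrow> 0"
begin

text \<open>At \<open>1 / sqrt p\<close> two requirements meet: \<open>p * K\<^sup>2 \<le> 1\<close>
  for the weights of small components, and \<open>K + N / K\<close> of order
  \<open>sqrt (1 / p)\<close> in the errors.\<close>

definition cutoff :: "nat \<Rightarrow> nat" where
  "cutoff n = nat \<lfloor>sqrt (1 / p n)\<rfloor>"

lemma eventually_p_le:
  assumes "0 < c"
  shows "\<forall>\<^sub>F n in sequentially. 0 < p n \<and> p n \<le> c"
  using order_tendstoD(2)[OF p_null assms] p_pos by eventually_elim auto

lemma null_comparison: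
  assumes "\<forall>\<^sub>F n in sequentially. \<bar>f n\<bar> \<le> c * (sqrt (1 / p n) * ln (1 / p n) / S n)"
  shows "f \<longlonglongrightarrow> 0"
proof (rule Lim_null_comparison)
  show "\<forall>\<^sub>F n in sequentially. norm (f n) \<le> c * (sqrt (1 / p n) * ln (1 / p n) / S n)"
    using assms by simp
  show "(\<lambda>n. c * (sqrt (1 / p n) * ln (1 / p n) / S n)) \<longlonglongrightarrow> 0"
    using tendsto_mult_right_zero[OF speed_large] by simp
qed

lemma eventually_basic:
  "\<forall>\<^sub>F n in sequentially. 0 < p n \<and> p n \<le> 1/9 \<and> 0 < a n \<and> 0 < S n \<and> 1 \<le> ln (1 / p n) \<and> 3 \<le> sqrt (1 / p n)
     \<and> 1 \<le> cutoff n \<and> real (cutoff n) \<le> sqrt (1 / p n) \<and> sqrt (1 / p n) \<le> 2 * real (cutoff n) \<and> p n * (real (cutoff n))\<^sup>2 \<le> 1"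
proof -
  have "\<forall>\<^sub>F n in sequentially. 0 < p n \<and> p n \<le> 1/9" by (rule eventually_p_le) simp
  from this a_pos S_pos show ?thesis
  proof (eventually_elim, goal_cases)
    case (1 n)
    then have v: "9 \<le> 1 / p n" by (simp add: field_simps)
    have "exp (1::real) \<le> 1 / p n" using v exp_le by linarith
    then have l: "1 \<le> ln (1 / p n)" using 1 by (simp add: ln_ge_iff)
    have "sqrt 9 \<le> sqrt (1 / p n)" using v by (intro real_sqrt_le_mono)
    then have s: "3 \<le> sqrt (1 / p n)" by simp
    have "0 \<le> sqrt (1 / p n)" using s by linarith
    then have "0 \<le> \<lfloor>sqrt (1 / p n)\<rfloor>" by (simp only: zero_le_floor)
    then have c: "real (cutoff n) = of_int \<lfloor>sqrt (1 / p n)\<rfloor>" by (simp add: cutoff_def)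
    have c1: "real (cutoff n) \<le> sqrt (1 / p n)" "sqrt (1 / p n) - 1 \<le> real (cutoff n)"
      unfolding c using floor_correct[of "sqrt (1 / p n)"] by simp_all
    have c2: "1 \<le> cutoff n" using c1 s by linarith
    have "(real (cutoff n))\<^sup>2 \<le> (sqrt (1 / p n))\<^sup>2" using c1 by (intro power_mono) auto
    then have "p n * (real (cutoff n))\<^sup>2 \<le> p n * (1 / p n)" using 1 by (intro mult_left_mono) auto
    then have c3: "p n * (real (cutoff n))\<^sup>2 \<le> 1" using 1 by simp
    have c4: "sqrt (1 / p n) \<le> 2 * real (cutoff n)" using c1 s by linarith
    show ?case using 1 l s c1 c2 c3 c4 by (intro conjI) auto
  qed
qed

lemma inverse_S_null: "(\<lambda>n. 1 / S n) \<longlonglongrightarrow> 0"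
proof (rule null_comparison[where c = 1])
  show "\<forall>\<^sub>F n in sequentially. \<bar>1 / S n\<bar> \<le> 1 * (sqrt (1 / p n) * ln (1 / p n) / S n)"
    using eventually_basic
  proof eventually_elim
    case (elim n)
    then have "1 * 1 \<le> sqrt (1 / p n) * ln (1 / p n)" by (intro mult_mono) auto
    then show ?case using elim by (simp add: divide_right_mono)
  qed
qed

lemma S_at_top: "filterlim S at_top sequentially"
proof -
  have "filterlim (\<lambda>n. inverse (1 / S n)) at_top sequentially"
    by (rule filterlim_inverse_at_top[OF inverse_S_null]) (use S_pos in eventually_elim, auto)
  then show ?thesis by simp
qed

lemma exp_neg_S_null:
  assumes "0 < c"
  shows "(\<lambda>n. exp (- (c * S n))) \<longlonglongrightarrow> 0"
proof -
  have "filterlim (\<lambda>n. c * S n) at_top sequentially"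
    by (rule filterlim_tendsto_pos_mult_at_top[OF tendsto_const assms S_at_top])
  then have "filterlim (\<lambda>n. - (c * S n)) at_bot sequentially" by (simp add: filterlim_uminus_at_bot)
  then show ?thesis by (rule filterlim_compose[OF exp_at_bot])
qed

lemma a_at_top: "filterlim a at_top sequentially"
proof -
  have "filterlim (\<lambda>n. a n ^ 3) at_top sequentially"
  proof (rule filterlim_at_top_mono)
    show "filterlim (\<lambda>n. 1/2 * S n) at_top sequentially"
      by (rule filterlim_tendsto_pos_mult_at_top[OF tendsto_const _ S_at_top]) simp
    have "\<forall>\<^sub>F n in sequentially. 1/2 < a n ^ 3 * (p n)\<^sup>2 / S n"
      by (rule order_tendstoD(1)[OF speed_scale]) simp
    then show "\<forall>\<^sub>F n in sequentially. 1/2 * S n \<le> a n ^ 3"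
      using eventually_basic
    proof eventually_elim
      case (elim n)
      then have "1/2 * S n \<le> a n ^ 3 * (p n)\<^sup>2" by (simp add: pos_less_divide_eq)
      also have "\<dots> \<le> a n ^ 3 * 1" using elim by (intro mult_left_mono power_le_one) auto
      finally show ?case by simp
    qed
  qed
  then have cube: "\<forall>\<^sub>F n in sequentially. Z \<le> a n ^ 3" for Z by (simp add: filterlim_at_top)
  show ?thesis
    unfolding filterlim_at_top
  proof
    fix Z
    show "\<forall>\<^sub>F n in sequentially. Z \<le> a n"
      using cube[of "max Z 0 ^ 3"] a_pos
    proof eventually_elim
      case (elim n)
      then have "max Z 0 ^ Suc 2 \<le> a n ^ Suc 2" by simp
      then have "max Z 0 \<le> a n" by (rule power_le_imp_le_base) (use elim in simp)
      then show ?case by simp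
    qed
  qed
qed

section \<open>Graphs whose number of vertices differs from \<open>1 / p\<close> by about
  \<open>\<theta> * a\<close>\<close>

context
  fixes N :: "nat \<Rightarrow> nat" and \<theta> :: real
  assumes N: "(\<lambda>n. (real (N n) - 1 / p n) / a n) \<longlonglongrightarrow> \<theta>"
begin

lemma Np_tendsto: "(\<lambda>n. real (N n) * p n) \<longlonglongrightarrow> 1"
proof -
  have "(\<lambda>n. 1 + (real (N n) - 1 / p n) / a n * (a n * p n)) \<longlonglongrightarrow> 1 + \<theta> * 0"
    by (intro tendsto_intros N ap_null)
  then have "(\<lambda>n. 1 + (real (N n) - 1 / p n) / a n * (a n * p n)) \<longlonglongrightarrow> 1" by simp
  then show ?thesis
    by (rule Lim_transform_eventually) (use eventually_basic in \<open>eventually_elim, auto simp: field_simps\<close>)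
qed

lemma eventually_N:
  "\<forall>\<^sub>F n in sequentially. real (N n) * p n \<le> 6/5 \<and> real (N n) \<le> 2 * (1 / p n) \<and> 1 \<le> N n \<and> cutoff n \<le> N n"
proof -
  have e1: "\<forall>\<^sub>F n in sequentially. real (N n) * p n < 6/5" by (rule order_tendstoD(2)[OF Np_tendsto]) simp
  have e2: "\<forall>\<^sub>F n in sequentially. 4/5 < real (N n) * p n" by (rule order_tendstoD(1)[OF Np_tendsto]) simp
  from e1 e2 eventually_basic show ?thesis
  proof (eventually_elim, goal_cases)
    case (1 n)
    have a: "real (N n) \<le> 2 * (1 / p n)" using 1 by (simp add: field_simps)
    have "sqrt (1 / p n) * 3 \<le> sqrt (1 / p n) * sqrt (1 / p n)" using 1 by (intro mult_left_mono) auto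
    also have "\<dots> = 1 / p n" using 1 by simp
    finally have s: "3 * sqrt (1 / p n) \<le> 1 / p n" by simp
    have "4/5 * (1 / p n) \<le> real (N n)" using 1 by (simp add: field_simps)
    then have "sqrt (1 / p n) \<le> real (N n)" using s 1 by linarith
    then have "real (cutoff n) \<le> real (N n)" using 1 by linarith
    then show ?case using a 1 by auto
  qed
qed

text \<open>Stirling's formula leaves \<open>cubic_quotient y * y ^ 3 / p\<close>, where
  \<open>y\<close> is \<open>a * p\<close> times a quantity tending to \<theta>; then
  \<open>a ^ 3 * p\<^sup>2 / S\<close> tends to one. The remainder \<open>R\<close> is bounded by a
  multiple of \<open>ln (1 / p)\<close>.\<close>

lemma log_weight_tendsto: "(\<lambda>n. log_weight (p n) (N n) / S n) \<longlonglongrightarrow> - (\<theta> ^ 3) / 6"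
proof -
  define y where "y n = real (N n) * p n - 1" for n
  define q where "q n = (real (N n) - 1 / p n) / a n" for n
  have y0: "y \<longlonglongrightarrow> 0" using tendsto_diff[OF Np_tendsto tendsto_const[of 1]] by (simp add: y_def[abs_def])
  define R where "R n = log_weight (p n) (N n) - (1 / p n) * (cubic_quotient (y n) * y n ^ 3)" for n
  have main: "(\<lambda>n. (1 / p n) * (cubic_quotient (y n) * y n ^ 3) / S n) \<longlonglongrightarrow> - (\<theta> ^ 3) / 6"
  proof -
    have "(\<lambda>n. cubic_quotient (y n) * q n ^ 3 * (a n ^ 3 * (p n)\<^sup>2 / S n)) \<longlonglongrightarrow> cubic_quotient 0 * \<theta> ^ 3 * 1"
      unfolding q_def by (intro tendsto_intros N speed_scale isCont_tendsto_compose[OF isCont_cubic_quotient y0])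
    moreover have "cubic_quotient 0 * \<theta> ^ 3 * 1 = - (\<theta> ^ 3) / 6" by (simp add: cubic_quotient_def)
    ultimately have "(\<lambda>n. cubic_quotient (y n) * q n ^ 3 * (a n ^ 3 * (p n)\<^sup>2 / S n)) \<longlonglongrightarrow> - (\<theta> ^ 3) / 6" by simp
    then show ?thesis
    proof (rule Lim_transform_eventually)
      show "\<forall>\<^sub>F n in sequentially. cubic_quotient (y n) * q n ^ 3 * (a n ^ 3 * (p n)\<^sup>2 / S n) = (1 / p n) * (cubic_quotient (y n) * y n ^ 3) / S n"
        using eventually_basic
      proof eventually_elim
        case (elim n)
        then have yq: "y n = q n * a n * p n" by (simp add: y_def q_def field_simps)
        show ?case unfolding yq using elim by (simp add: power_mult_distrib eval_nat_numeral)
      qed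
    qed
  qed
  have rest: "(\<lambda>n. R n / S n) \<longlonglongrightarrow> 0"
  proof (rule null_comparison[where c = 9])
    show "\<forall>\<^sub>F n in sequentially. \<bar>R n / S n\<bar> \<le> 9 * (sqrt (1 / p n) * ln (1 / p n) / S n)"
      using eventually_basic eventually_N
    proof eventually_elim
      case (elim n)
      define m where "m = real (N n)"
      have m: "0 < m" "m \<le> 2 * (1 / p n)" "m * p n \<le> 6/5" using elim by (auto simp: m_def)
      have p: "0 < p n" "p n \<le> 1/2" using elim by auto
      have lnD: "ln (part_weight (p n) (N n)) = ln (fact (N n)) + m\<^sup>2 / 2 * ln (1 - p n)"
        using p by (simp add: part_weight_def ln_mult ln_realpow ln_sqrt m_def)
      have cq: "(1 / p n) * (cubic_quotient (y n) * y n ^ 3) = m * ln m + m * ln (p n) - p n * m\<^sup>2 / 2 + 1 / (2 * p n)"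
      proof -
        have "1 + y n = m * p n" by (simp add: y_def m_def)
        moreover have "ln (m * p n) = ln m + ln (p n)" using m p by (intro ln_mult_pos) auto
        ultimately show ?thesis unfolding cubic_quotient[symmetric] using p by (simp add: field_simps power2_eq_square)
      qed
      have Re: "R n = (ln (fact (N n)) - (m * ln m - m)) + m\<^sup>2 / 2 * (ln (1 - p n) + p n)"
        unfolding R_def log_weight_def lnD cq by (simp add: m_def[symmetric] algebra_simps)
      have lv: "1 \<le> ln (1 / p n)" "1 \<le> sqrt (1 / p n)" using elim by auto
      have f1: "0 \<le> ln (fact (N n)) - (m * ln m - m)"
        using ln_fact_diff_ge[of 0 "N n"] by (simp add: m_def)
      have f2: "ln (fact (N n)) - (m * ln m - m) \<le> ln m + 1"
        using ln_fact_le[of "N n"] elim by (simp add: m_def)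
      have "ln m \<le> ln (2 * (1 / p n))" using m p by (subst ln_le_cancel_iff) auto
      also have "\<dots> = ln 2 + ln (1 / p n)" using p by (intro ln_mult_pos) auto
      finally have f3: "ln m \<le> 1 + ln (1 / p n)" using ln_2_less_1 by linarith
      have g1: "ln (1 - p n) \<le> - p n" using ln_add_one_self_le_self2[of "- p n"] p by simp
      have g2: "- (2 * (p n)\<^sup>2) \<le> ln (1 - p n) + p n" using one_minus_ge_exp(1)[of "p n"] p by simp
      have mp: "m\<^sup>2 * (p n)\<^sup>2 \<le> 4"
      proof -
        have "(m * p n)\<^sup>2 \<le> 2\<^sup>2" using m p by (intro power_mono) auto
        then show ?thesis by (simp add: power_mult_distrib)
      qed
      have "m\<^sup>2 / 2 * - (2 * (p n)\<^sup>2) \<le> m\<^sup>2 / 2 * (ln (1 - p n) + p n)" using g2 by (intro mult_left_mono) auto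
      then have h1: "- 4 \<le> m\<^sup>2 / 2 * (ln (1 - p n) + p n)" using mp by simp
      have h2: "m\<^sup>2 / 2 * (ln (1 - p n) + p n) \<le> 0" using g1 by (intro mult_nonneg_nonpos) auto
      have "\<bar>R n\<bar> \<le> 2 + ln (1 / p n) + 4" unfolding Re using f1 f2 f3 h1 h2 by linarith
      also have "\<dots> \<le> 9 * (1 * ln (1 / p n))" using lv by simp
      also have "\<dots> \<le> 9 * (sqrt (1 / p n) * ln (1 / p n))" using lv by (intro mult_left_mono mult_right_mono) auto
      finally have "\<bar>R n\<bar> / S n \<le> 9 * (sqrt (1 / p n) * ln (1 / p n)) / S n" using elim by (intro divide_right_mono) auto
      then show ?case using elim by simp
    qed
  qed
  have "(\<lambda>n. (1 / p n) * (cubic_quotient (y n) * y n ^ 3) / S n + R n / S n) \<longlonglongrightarrow> - (\<theta> ^ 3) / 6 + 0"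
    by (rule tendsto_add[OF main rest])
  moreover have "(1 / p n) * (cubic_quotient (y n) * y n ^ 3) / S n + R n / S n = log_weight (p n) (N n) / S n" for n
    unfolding R_def by (simp add: diff_divide_distrib)
  ultimately show ?thesis by simp
qed

lemma error_null:
  "(\<lambda>n. (2 * real (cutoff n) + real (N n) / real (cutoff n) * (ln (3 / p n) + 8)) / S n) \<longlonglongrightarrow> 0"
proof (rule null_comparison[where c = 50])
  show "\<forall>\<^sub>F n in sequentially. \<bar>(2 * real (cutoff n) + real (N n) / real (cutoff n) * (ln (3 / p n) + 8)) / S n\<bar>
      \<le> 50 * (sqrt (1 / p n) * ln (1 / p n) / S n)"
    using eventually_basic eventually_N
  proof eventually_elim
    case (elim n)
    define s L where "s = sqrt (1 / p n)" and "L = ln (1 / p n)"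
    have s: "0 < s" "s\<^sup>2 = 1 / p n" "1 \<le> L" using elim by (auto simp: s_def L_def)
    have K: "real (cutoff n) \<le> s" "s \<le> 2 * real (cutoff n)" "0 < real (cutoff n)" using elim by (auto simp: s_def)
    have "real (N n) / real (cutoff n) \<le> 2 * s\<^sup>2 / (s / 2)"
      using elim s K by (intro frac_le) auto
    also have "\<dots> = 4 * s" using s(1) by (simp add: power2_eq_square)
    finally have a: "real (N n) / real (cutoff n) \<le> 4 * s" .
    have "ln (3 / p n) = ln 3 + L" using elim unfolding L_def by (subst ln_mult_pos[symmetric]) auto
    moreover have "ln (3::real) \<le> 2" using ln_le_minus_one[of "3::real"] by simp
    ultimately have b: "ln (3 / p n) + 8 \<le> 11 * L" "0 \<le> ln (3 / p n) + 8" using s ln_ge_zero[of "3::real"] by auto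
    have "real (N n) / real (cutoff n) * (ln (3 / p n) + 8) \<le> 4 * s * (11 * L)"
      using a b s by (intro mult_mono) auto
    moreover have "2 * real (cutoff n) \<le> 2 * s * L" using K s mult_left_mono[of 1 L s] by linarith
    ultimately have c: "2 * real (cutoff n) + real (N n) / real (cutoff n) * (ln (3 / p n) + 8) \<le> 50 * (s * L)"
      using s mult_nonneg_nonneg[of s L] by linarith
    have d: "0 \<le> 2 * real (cutoff n) + real (N n) / real (cutoff n) * (ln (3 / p n) + 8)"
      by (intro add_nonneg_nonneg mult_nonneg_nonneg divide_nonneg_nonneg b(2)) simp_all
    show ?case using divide_right_mono[OF c, of "S n"] d elim unfolding s_def L_def by simp
  qed
qed

lemma card_partitions_subexp:
  assumes "0 < c"
  shows "\<forall>\<^sub>F n in sequentially. real (card (partitions_of (N n))) \<le> exp (c * S n)"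
proof -
  have lim: "(\<lambda>n. (real (cutoff n) + real (N n) / real (cutoff n)) * ln (real (N n) + 1) / S n) \<longlonglongrightarrow> 0"
  proof (rule null_comparison[where c = 20])
    show "\<forall>\<^sub>F n in sequentially. \<bar>(real (cutoff n) + real (N n) / real (cutoff n)) * ln (real (N n) + 1) / S n\<bar>
      \<le> 20 * (sqrt (1 / p n) * ln (1 / p n) / S n)"
      using eventually_basic eventually_N
    proof eventually_elim
      case (elim n)
      define s L where "s = sqrt (1 / p n)" and "L = ln (1 / p n)"
      have s: "0 < s" "s\<^sup>2 = 1 / p n" "1 \<le> L" using elim by (auto simp: s_def L_def)
      have K: "real (cutoff n) \<le> s" "s \<le> 2 * real (cutoff n)" "0 < real (cutoff n)" using elim by (auto simp: s_def)
      have "real (N n) / real (cutoff n) \<le> 2 * s\<^sup>2 / (s / 2)"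
        using elim s K by (intro frac_le) auto
      also have "\<dots> = 4 * s" using s(1) by (simp add: power2_eq_square)
      finally have a: "real (cutoff n) + real (N n) / real (cutoff n) \<le> 5 * s" using K by linarith
      have "9 \<le> 1 / p n" using elim by (simp add: field_simps)
      then have "real (N n) + 1 \<le> 3 * (1 / p n)" using elim by linarith
      then have "ln (real (N n) + 1) \<le> ln (3 * (1 / p n))" using elim by (subst ln_le_cancel_iff) auto
      also have "\<dots> = ln 3 + L" using elim unfolding L_def by (subst ln_mult_pos[symmetric]) auto
      finally have b: "ln (real (N n) + 1) \<le> 4 * L" using ln_le_minus_one[of "3::real"] s by simp
      have "(real (cutoff n) + real (N n) / real (cutoff n)) * ln (real (N n) + 1) \<le> 5 * s * (4 * L)"
        using a b s by (intro mult_mono) auto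
      then have c: "(real (cutoff n) + real (N n) / real (cutoff n)) * ln (real (N n) + 1) \<le> 20 * (s * L)" by simp
      have d: "0 \<le> (real (cutoff n) + real (N n) / real (cutoff n)) * ln (real (N n) + 1)" by simp
      show ?case using divide_right_mono[OF c, of "S n"] d elim unfolding s_def L_def by simp
    qed
  qed
  show ?thesis
    using order_tendstoD(2)[OF lim assms] eventually_basic eventually_N
  proof eventually_elim
    case (elim n)
    let ?e = "cutoff n + N n div cutoff n"
    have "card (partitions_of (N n)) \<le> (N n + 1) ^ ?e"
      by (rule card_partitions_of_le) (use elim in auto)
    then have "real (card (partitions_of (N n))) \<le> real ((N n + 1) ^ ?e)" by (rule of_nat_mono)
    also have "\<dots> = exp (real ?e * ln (real (N n) + 1))"
      by (subst exp_of_nat_mult) (simp add: add.commute)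
    also have "\<dots> \<le> exp (c * S n)"
    proof -
      have "real (N n div cutoff n) \<le> real (N n) / real (cutoff n)" by (rule of_nat_div_le_of_nat)
      then have "real ?e * ln (real (N n) + 1) \<le> (real (cutoff n) + real (N n) / real (cutoff n)) * ln (real (N n) + 1)"
        by (intro mult_right_mono) auto
      also have "\<dots> \<le> c * S n" using elim by (simp add: pos_divide_less_eq less_imp_le)
      finally show ?thesis by simp
    qed
    finally show ?case .
  qed
qed

text \<open>Two passes over one inequality. The denominators \<open>1 - (k * p / 2)\<^sup>2\<close>
  tend to one uniformly only if all sizes are \<open>O(a)\<close>. So a crude estimate of them first
  shows that the mass is bounded; with this bound, the second pass obtains the rate with its sharp
  constants. The constant \<open>A\<close> precedes \<eta>, so that one compactness argument serves
  all \<eta>.\<close>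

lemma macro_bound:
  "\<exists>A. \<forall>\<eta>>0. \<forall>\<^sub>F n in sequentially. \<forall>l\<in>partitions_of (N n).
     exp (- (C * S n)) \<le> pmf (count_law (N n) (p n)) l \<longrightarrow>
     moment 1 (cutoff n) (N n) (a n) l \<le> A \<and>
     \<theta> ^ 3 / 6 + (max 0 (moment 1 (cutoff n) (N n) (a n) l - \<theta>)) ^ 3 / 6
       - moment 3 (cutoff n) (N n) (a n) l / 24 \<le> C + \<eta>"
proof -
  define m1 m3 where "m1 n l = moment 1 (cutoff n) (N n) (a n) l" and "m3 n l = moment 3 (cutoff n) (N n) (a n) l" for n l
  define q where "q n = (real (N n) - 1 / p n) / a n" for n
  define rho where "rho n = a n ^ 3 * (p n)\<^sup>2 / S n" for n
  define err where "err n = (log_weight (p n) (N n) / S n + \<theta> ^ 3 / 6) +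
     (2 * real (cutoff n) + real (N n) / real (cutoff n) * (ln (3 / p n) + 8)) / S n" for n
  have q: "q \<longlonglongrightarrow> \<theta>" using N by (simp add: q_def[abs_def])
  have rho: "rho \<longlonglongrightarrow> 1" using speed_scale by (simp add: rho_def[abs_def])
  have err: "err \<longlonglongrightarrow> 0"
  proof -
    have "err \<longlonglongrightarrow> (- (\<theta> ^ 3) / 6 + \<theta> ^ 3 / 6) + 0"
      unfolding err_def by (intro tendsto_add log_weight_tendsto error_null tendsto_const)
    then show ?thesis by simp
  qed
  define c where "c = \<bar>\<theta>\<bar> + 1"
  define G where "G n l = (\<Sum>k\<in>{cutoff n<..N n}. real (l k) * ((real k / a n) ^ 3 / (24 * (1 - (real k * p n / 2)\<^sup>2))))" for n l
  have key: "\<forall>\<^sub>F n in sequentially. \<forall>l\<in>partitions_of (N n). exp (- (C * S n)) \<le> pmf (count_law (N n) (p n)) l \<longrightarrow>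
     \<theta> ^ 3 / 6 + rho n * (max 0 (m1 n l - q n)) ^ 3 / 6 - rho n * G n l \<le> C + err n"
    using eventually_basic eventually_N
  proof eventually_elim
    case (elim n)
    show ?case
    proof (intro ballI impI)
      fix l assume l: "l \<in> partitions_of (N n)" and le: "exp (- (C * S n)) \<le> pmf (count_law (N n) (p n)) l"
      define M where "M = (\<Sum>k\<in>{cutoff n<..N n}. k * l k)"
      define r where "r = real (N n) - real M"
      define Q where "Q = log_weight (p n) (N n) - (max 0 (1 - r * p n)) ^ 3 / (6 * p n)
        + (\<Sum>k\<in>{cutoff n<..N n}. real (l k) * (real k ^ 3 * (p n)\<^sup>2 / (24 * (1 - (real k * p n / 2)\<^sup>2))))
        + 2 * real (cutoff n) + real (N n) / real (cutoff n) * (ln (3 / p n) + 8)"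
      have pos: "0 < p n" "0 < a n" "0 < S n" using elim by auto
      have "pmf (count_law (N n) (p n)) l \<le> exp Q"
        unfolding Q_def log_weight_def r_def M_def
        by (rule pmf_count_law_exp_bound) (use elim l in auto)
      then have "exp (- (C * S n)) \<le> exp Q" using le by linarith
      then have CQ: "- C \<le> Q / S n" using pos by (simp add: pos_le_divide_eq)
      have am: "a n * m1 n l = real M"
        using pos by (simp add: m1_def moment_def M_def sum_distrib_left mult.commute)
      have "1 - r * p n = a n * p n * (m1 n l - q n)"
      proof -
        have "a n * p n * (m1 n l - q n) = p n * (a n * m1 n l) - p n * (a n * q n)" by (simp add: algebra_simps)
        also have "a n * q n = real (N n) - 1 / p n" using pos by (simp add: q_def)
        finally show ?thesis unfolding am r_def using pos by (simp add: algebra_simps)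
      qed
      then have mx: "max 0 (1 - r * p n) = a n * p n * max 0 (m1 n l - q n)"
        using pos by (simp add: max_def mult_le_0_iff zero_le_mult_iff)
      have t1: "(max 0 (1 - r * p n)) ^ 3 / (6 * p n) / S n = rho n * (max 0 (m1 n l - q n)) ^ 3 / 6"
        unfolding mx rho_def using pos by (simp add: power_mult_distrib field_simps eval_nat_numeral)
      have t2: "(\<Sum>k\<in>{cutoff n<..N n}. real (l k) * (real k ^ 3 * (p n)\<^sup>2 / (24 * (1 - (real k * p n / 2)\<^sup>2)))) / S n = rho n * G n l"
        unfolding G_def rho_def sum_divide_distrib sum_distrib_left
      proof (rule sum.cong[OF refl])
        fix k
        define w where "w = 24 * (1 - (real k * p n / 2)\<^sup>2)"
        define X where "X = (real k / a n) ^ 3"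
        have X: "real k ^ 3 = X * a n ^ 3" using pos by (simp add: X_def power_divide)
        have "real (l k) * (real k ^ 3 * (p n)\<^sup>2 / w) / S n = a n ^ 3 * (p n)\<^sup>2 / S n * (real (l k) * ((real k / a n) ^ 3 / w))"
          unfolding X X_def[symmetric] by (simp add: divide_inverse mult_ac)
        then show "real (l k) * (real k ^ 3 * (p n)\<^sup>2 / (24 * (1 - (real k * p n / 2)\<^sup>2))) / S n
          = a n ^ 3 * (p n)\<^sup>2 / S n * (real (l k) * ((real k / a n) ^ 3 / (24 * (1 - (real k * p n / 2)\<^sup>2))))"
          by (simp only: w_def)
      qed
      have "Q / S n = err n - \<theta> ^ 3 / 6 - rho n * (max 0 (m1 n l - q n)) ^ 3 / 6 + rho n * G n l"
        unfolding t1[symmetric] t2[symmetric] by (simp add: Q_def err_def add_divide_distrib diff_divide_distrib)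
      then show "\<theta> ^ 3 / 6 + rho n * (max 0 (m1 n l - q n)) ^ 3 / 6 - rho n * G n l \<le> C + err n"
        using CQ by linarith
    qed
  qed
  \<comment> \<open>Above \<open>5 * c\<close> the excess \<open>m - q\<close> is at least
    \<open>4/5 * m\<close>; the \<open>120\<close> undoes the factor \<open>1/60\<close> found below
    and \<open>rho n > 1/2\<close>.\<close>
  define A where "A = max (5 * c) (1 + 120 * (\<bar>C\<bar> + 1 + \<bar>\<theta>\<bar> ^ 3))"
  have A0: "0 < A" "5 * c \<le> A" by (auto simp: A_def c_def)
  have coarse: "\<forall>\<^sub>F n in sequentially. \<forall>l\<in>partitions_of (N n). exp (- (C * S n)) \<le> pmf (count_law (N n) (p n)) l \<longrightarrow> m1 n l \<le> A"
  proof -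
    have e1: "\<forall>\<^sub>F n in sequentially. 1/2 < rho n" by (rule order_tendstoD(1)[OF rho]) simp
    have e2: "\<forall>\<^sub>F n in sequentially. q n < c" by (rule order_tendstoD(2)[OF q]) (simp add: c_def)
    have e3: "\<forall>\<^sub>F n in sequentially. err n < 1" by (rule order_tendstoD(2)[OF err]) simp
    from key e1 e2 e3 eventually_basic eventually_N show ?thesis
    proof eventually_elim
      case (elim n)
      show ?case
      proof (intro ballI impI)
        fix l assume l: "l \<in> partitions_of (N n)" "exp (- (C * S n)) \<le> pmf (count_law (N n) (p n)) l"
        have k: "\<theta> ^ 3 / 6 + rho n * (max 0 (m1 n l - q n)) ^ 3 / 6 - rho n * G n l \<le> C + err n" using elim l by blast
        have pos: "0 < p n" "0 < a n" "0 < S n" using elim by auto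
        have G: "G n l \<le> (m1 n l) ^ 3 / 15"
        proof -
          have "G n l \<le> (\<Sum>k\<in>{cutoff n<..N n}. real (l k) * ((real k / a n) ^ 3 / 15))"
            unfolding G_def
          proof (intro sum_mono mult_left_mono divide_left_mono)
            fix k assume k: "k \<in> {cutoff n<..N n}"
            have "real k * p n \<le> real (N n) * p n" using k pos by (intro mult_right_mono) auto
            moreover have "real (N n) * p n \<le> 6/5" using elim by simp
            ultimately have "real k * p n / 2 \<le> 3/5" by linarith
            then have U: "(real k * p n / 2)\<^sup>2 \<le> (3/5)\<^sup>2" using pos by (intro power_mono) auto
            \<comment> \<open>From \<open>N * p \<le> 6/5\<close> the argument is at most
              \<open>3/5\<close>, and \<open>24 * (1 - 9/25) = 15.36\<close>.\<close>
            have "15 \<le> 24 * (1 - U)" if "U \<le> (3/5)\<^sup>2" for U :: real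
              using that by (simp add: power_divide)
            from this[OF U] show w: "15 \<le> 24 * (1 - (real k * p n / 2)\<^sup>2)" .
            then show "0 < 24 * (1 - (real k * p n / 2)\<^sup>2) * 15" by linarith
          qed (use pos in auto)
          also have "\<dots> = m3 n l / 15" by (simp add: m3_def moment_def sum_divide_distrib)
          also have "\<dots> \<le> (m1 n l) ^ 3 / 15"
            unfolding m1_def m3_def using moment_3_le[of "a n"] pos by (intro divide_right_mono) auto
          finally show ?thesis .
        qed
        show "m1 n l \<le> A"
        proof (rule ccontr)
          assume "\<not> m1 n l \<le> A"
          then have m: "5 * c < m1 n l" "1 + 120 * (\<bar>C\<bar> + 1 + \<bar>\<theta>\<bar> ^ 3) < m1 n l" by (auto simp: A_def)
          have c1: "1 \<le> c" by (simp add: c_def)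
          have t0: "0 \<le> 120 * (\<bar>C\<bar> + 1 + \<bar>\<theta>\<bar> ^ 3)" by simp
          have h: "4/5 * m1 n l \<le> max 0 (m1 n l - q n)" using m elim by linarith
          have "(4/5 * m1 n l) ^ 3 \<le> (max 0 (m1 n l - q n)) ^ 3"
            by (rule power_mono[OF h]) (use m c1 in linarith)
          then have b: "64/125 * (m1 n l) ^ 3 \<le> (max 0 (m1 n l - q n)) ^ 3" by (simp add: power_mult_distrib power_divide)
          have m_ge: "1 \<le> m1 n l" using m t0 by linarith
          have m1: "m1 n l \<le> (m1 n l) ^ 3" by (rule self_le_power[OF m_ge]) simp
          \<comment> \<open>Since \<open>64/125 / 6 - 1/15 > 1/60\<close>, the cost of the excess
            mass beats the gain from large components, even if all mass sits in a single
            one.\<close>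
          have "1/60 * (m1 n l) ^ 3 \<le> (max 0 (m1 n l - q n)) ^ 3 / 6 - G n l"
            using b G m1 m t0 by linarith
          then have "rho n * (1/60 * (m1 n l) ^ 3) \<le> rho n * ((max 0 (m1 n l - q n)) ^ 3 / 6 - G n l)"
            using elim by (intro mult_left_mono) auto
          moreover have "1/2 * (1/60 * (m1 n l) ^ 3) \<le> rho n * (1/60 * (m1 n l) ^ 3)"
            using elim m1 m_ge by (intro mult_right_mono) auto
          moreover have "- (\<bar>\<theta>\<bar> ^ 3) \<le> \<theta> ^ 3 / 6"
          proof -
            have "\<bar>\<theta> ^ 3\<bar> = \<bar>\<theta>\<bar> ^ 3" by (rule power_abs)
            then show ?thesis by linarith
          qed
          moreover have "rho n * ((max 0 (m1 n l - q n)) ^ 3 / 6 - G n l)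
              = rho n * (max 0 (m1 n l - q n)) ^ 3 / 6 - rho n * G n l" by (simp add: algebra_simps)
          moreover have "err n < 1" using elim by simp
          moreover have "C \<le> \<bar>C\<bar>" by simp
          moreover define Y where "Y = \<bar>C\<bar> + 1 + \<bar>\<theta>\<bar> ^ 3"
          ultimately have "(m1 n l) ^ 3 / 120 \<le> Y"
            using k by linarith
          moreover have "1 + 120 * Y < m1 n l" using m by (simp add: Y_def)
          ultimately show False using m1 by linarith
        qed
      qed
    qed
  qed
  define B where "B = A + \<bar>\<theta>\<bar> + 1"
  have B0: "0 \<le> B" using A0 by (simp add: B_def)
  \<comment> \<open>The errors from \<open>log_weight\<close> and the small components, from
    replacing \<open>q\<close> by \<theta>, from replacing \<open>rho\<close> by one in the cost,
    and from replacing both \<open>rho\<close> and the denominators by one in the gain.\<close>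
  define om where "om n = err n + B\<^sup>2 / 2 * \<bar>q n - \<theta>\<bar> + \<bar>1 - rho n\<bar> * B ^ 3 / 6
     + \<bar>rho n / (1 - (A * (a n * p n) / 2)\<^sup>2) - 1\<bar> * A ^ 3 / 24" for n
  have om: "om \<longlonglongrightarrow> 0"
  proof -
    have "om \<longlonglongrightarrow> 0 + B\<^sup>2 / 2 * \<bar>\<theta> - \<theta>\<bar> + \<bar>1 - 1\<bar> * B ^ 3 / 6
     + \<bar>1 / (1 - (A * 0 / 2)\<^sup>2) - 1\<bar> * A ^ 3 / 24"
      unfolding om_def by (intro tendsto_intros err q rho ap_null) auto
    then show ?thesis by simp
  qed
  have fine: "\<forall>\<^sub>F n in sequentially. \<forall>l\<in>partitions_of (N n). exp (- (C * S n)) \<le> pmf (count_law (N n) (p n)) l \<longrightarrow>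
      \<theta> ^ 3 / 6 + (max 0 (m1 n l - \<theta>)) ^ 3 / 6 - m3 n l / 24 \<le> C + \<eta>" if eta: "0 < \<eta>" for \<eta>
  proof -
    have e1: "\<forall>\<^sub>F n in sequentially. 1/2 < rho n" by (rule order_tendstoD(1)[OF rho]) simp
    have e2: "\<forall>\<^sub>F n in sequentially. q n < \<theta> + 1" by (rule order_tendstoD(2)[OF q]) simp
    have e2': "\<forall>\<^sub>F n in sequentially. \<theta> - 1 < q n" by (rule order_tendstoD(1)[OF q]) simp
    have e3: "\<forall>\<^sub>F n in sequentially. om n < \<eta>" by (rule order_tendstoD(2)[OF om eta])
    have e4: "\<forall>\<^sub>F n in sequentially. a n * p n < 1 / A" by (rule order_tendstoD(2)[OF ap_null]) (use A0 in simp)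
    from key coarse e1 e2 e2' e3 e4 eventually_basic show ?thesis
    proof eventually_elim
      case (elim n)
      show ?case
      proof (intro ballI impI)
        fix l assume l: "l \<in> partitions_of (N n)" "exp (- (C * S n)) \<le> pmf (count_law (N n) (p n)) l"
        have k: "\<theta> ^ 3 / 6 + rho n * (max 0 (m1 n l - q n)) ^ 3 / 6 - rho n * G n l \<le> C + err n" using elim l by blast
        have mA: "m1 n l \<le> A" using elim l by blast
        have pos: "0 < p n" "0 < a n" "0 < S n" using elim by auto
        have m0: "0 \<le> m1 n l" "0 \<le> m3 n l" unfolding m1_def m3_def using pos by (auto intro!: moment_nonneg)
        define d where "d = (A * (a n * p n) / 2)\<^sup>2"
        have ap: "A * (a n * p n) < 1" using elim A0 by (simp add: pos_less_divide_eq mult.commute)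
        have d: "d < 1"
        proof -
          have "0 \<le> A * (a n * p n) / 2" using A0 pos by simp
          then have "(A * (a n * p n) / 2)\<^sup>2 < 1\<^sup>2" using ap by (intro power_strict_mono) auto
          then show ?thesis by (simp add: d_def)
        qed
        have G: "G n l \<le> m3 n l / (24 * (1 - d))"
        proof -
          have "G n l \<le> (\<Sum>k\<in>{cutoff n<..N n}. real (l k) * (real k / a n) ^ 3 / (24 * (1 - d)))"
            unfolding G_def
          proof (rule sum_mono)
            fix k assume k: "k \<in> {cutoff n<..N n}"
            show "real (l k) * ((real k / a n) ^ 3 / (24 * (1 - (real k * p n / 2)\<^sup>2))) \<le> real (l k) * (real k / a n) ^ 3 / (24 * (1 - d))"
            proof (cases "l k = 0")
              case False
              have "real k / a n \<le> A" using size_le_moment[of "a n" k "cutoff n" "N n" l] pos k False mA by (simp add: m1_def)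
              then have "real k \<le> A * a n" using pos by (simp add: pos_divide_le_eq)
              then have "real k * p n / 2 \<le> A * (a n * p n) / 2" using mult_right_mono[of "real k" "A * a n" "p n"] pos by (simp add: mult.assoc)
              then have u: "(real k * p n / 2)\<^sup>2 \<le> d" unfolding d_def using pos by (intro power_mono) auto
              have "(real k / a n) ^ 3 / (24 * (1 - (real k * p n / 2)\<^sup>2)) \<le> (real k / a n) ^ 3 / (24 * (1 - d))"
                using u d pos by (intro divide_left_mono mult_pos_pos) auto
              then have "real (l k) * ((real k / a n) ^ 3 / (24 * (1 - (real k * p n / 2)\<^sup>2))) \<le> real (l k) * ((real k / a n) ^ 3 / (24 * (1 - d)))"
                by (intro mult_left_mono) auto
              then show ?thesis by simp
            qed simp
          qed
          also have "\<dots> = m3 n l / (24 * (1 - d))" by (simp add: m3_def moment_def sum_divide_distrib)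
          finally show ?thesis .
        qed
        have m3A: "m3 n l \<le> A ^ 3"
        proof -
          have "m3 n l \<le> (m1 n l) ^ 3" unfolding m1_def m3_def by (rule moment_3_le) (use pos in simp)
          also have "\<dots> \<le> A ^ 3" using mA m0 by (intro power_mono) auto
          finally show ?thesis .
        qed
        have r0: "0 < rho n" using elim by linarith
        have i1: "rho n * G n l - m3 n l / 24 \<le> \<bar>rho n / (1 - d) - 1\<bar> * A ^ 3 / 24"
        proof -
          have "rho n * G n l \<le> rho n * (m3 n l / (24 * (1 - d)))" using G r0 by (intro mult_left_mono) auto
          also have "\<dots> = rho n / (1 - d) * m3 n l / 24" by simp
          finally have "rho n * G n l - m3 n l / 24 \<le> (rho n / (1 - d) - 1) * m3 n l / 24" by (simp add: left_diff_distrib diff_divide_distrib)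
          also have "\<dots> \<le> \<bar>rho n / (1 - d) - 1\<bar> * A ^ 3 / 24"
            using m3A m0 by (intro divide_right_mono mult_mono) auto
          finally show ?thesis .
        qed
        define x y where "x = max 0 (m1 n l - \<theta>)" and "y = max 0 (m1 n l - q n)"
        have xy: "0 \<le> x" "x \<le> B" "0 \<le> y" "y \<le> B" using mA elim m0 A0 by (auto simp: x_def y_def B_def)
        have i2: "x ^ 3 / 6 - rho n * y ^ 3 / 6 \<le> B\<^sup>2 / 2 * \<bar>q n - \<theta>\<bar> + \<bar>1 - rho n\<bar> * B ^ 3 / 6"
        proof -
          have "x ^ 3 - y ^ 3 \<le> 3 * B\<^sup>2 * \<bar>x - y\<bar>" by (rule cube_diff_le) (use xy in auto)
          also have "\<dots> \<le> 3 * B\<^sup>2 * \<bar>q n - \<theta>\<bar>" by (intro mult_left_mono) (auto simp: x_def y_def)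
          finally have 1: "x ^ 3 - y ^ 3 \<le> 3 * B\<^sup>2 * \<bar>q n - \<theta>\<bar>" .
          have "(1 - rho n) * y ^ 3 \<le> \<bar>1 - rho n\<bar> * B ^ 3"
            using xy by (intro mult_mono power_mono) auto
          then have 2: "y ^ 3 - rho n * y ^ 3 \<le> \<bar>1 - rho n\<bar> * B ^ 3" by (simp add: algebra_simps)
          have "x ^ 3 / 6 - rho n * y ^ 3 / 6 = ((x ^ 3 - y ^ 3) + (y ^ 3 - rho n * y ^ 3)) / 6" by (simp add: field_simps)
          also have "\<dots> \<le> (3 * B\<^sup>2 * \<bar>q n - \<theta>\<bar> + \<bar>1 - rho n\<bar> * B ^ 3) / 6" using 1 2 by (intro divide_right_mono) auto
          finally show ?thesis by (simp add: field_simps)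
        qed
        show "\<theta> ^ 3 / 6 + (max 0 (m1 n l - \<theta>)) ^ 3 / 6 - m3 n l / 24 \<le> C + \<eta>"
          using k i1 i2 elim unfolding om_def d_def[symmetric] x_def[symmetric] y_def[symmetric] by linarith
      qed
    qed
  qed
  show ?thesis
  proof (intro exI[of _ A] allI impI)
    fix \<eta> :: real assume "0 < \<eta>"
    from fine[OF this] coarse
    show "\<forall>\<^sub>F n in sequentially. \<forall>l\<in>partitions_of (N n).
     exp (- (C * S n)) \<le> pmf (count_law (N n) (p n)) l \<longrightarrow>
     moment 1 (cutoff n) (N n) (a n) l \<le> A \<and>
     \<theta> ^ 3 / 6 + (max 0 (moment 1 (cutoff n) (N n) (a n) l - \<theta>)) ^ 3 / 6
       - moment 3 (cutoff n) (N n) (a n) l / 24 \<le> C + \<eta>"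
      by eventually_elim (simp add: m1_def m3_def)
  qed
qed

text \<open>A union bound over the count vectors; their number is subexponential in
  \<open>S\<close>, so giving up half of the exponent pays for it.\<close>

lemma prob_null:
  fixes c :: real
  assumes c: "0 < c" and bad: "\<forall>\<^sub>F n in sequentially. \<forall>l\<in>partitions_of (N n) \<inter> X n. pmf (count_law (N n) (p n)) l \<le> exp (- (c * S n))"
  shows "(\<lambda>n. measure_pmf.prob (count_law (N n) (p n)) (X n)) \<longlonglongrightarrow> 0"
proof (rule Lim_null_comparison)
  have "\<forall>\<^sub>F n in sequentially. real (card (partitions_of (N n))) \<le> exp (c / 2 * S n)"
    by (rule card_partitions_subexp) (use c in simp)
  then show "\<forall>\<^sub>F n in sequentially. norm (measure_pmf.prob (count_law (N n) (p n)) (X n)) \<le> exp (- (c / 2 * S n))"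
    using bad
  proof eventually_elim
    case (elim n)
    have "measure_pmf.prob (count_law (N n) (p n)) (X n) \<le> (\<Sum>l\<in>partitions_of (N n) \<inter> X n. exp (- (c * S n)))"
      unfolding prob_count_law using elim by (intro sum_mono) auto
    also have "\<dots> = real (card (partitions_of (N n) \<inter> X n)) * exp (- (c * S n))" by simp
    also have "\<dots> \<le> real (card (partitions_of (N n))) * exp (- (c * S n))"
      by (intro mult_right_mono of_nat_mono card_mono finite_partitions_of) auto
    also have "\<dots> \<le> exp (c / 2 * S n) * exp (- (c * S n))" using elim by (intro mult_right_mono) auto
    also have "\<dots> = exp (- (c / 2 * S n))" by (simp add: exp_add[symmetric])
    finally show ?case by simp
  qed
  show "(\<lambda>n. exp (- (c / 2 * S n))) \<longlonglongrightarrow> 0" by (rule exp_neg_S_null) (use c in simp)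
qed

end

end

section \<open>Typical components\<close>

definition add_sizes :: "nat list \<Rightarrow> (nat \<Rightarrow> nat) \<Rightarrow> nat \<Rightarrow> nat" where
  "add_sizes ks l = (\<lambda>j. l j + count_list ks j)"

lemma add_sizes_Cons: "add_sizes (k # ks) l = (add_sizes ks l)(k := Suc (add_sizes ks l k))"
  by (auto simp: add_sizes_def)

lemma inj_add_sizes: "inj_on (add_sizes ks) X"
  by (auto simp: add_sizes_def fun_eq_iff intro!: inj_onI)

lemma add_sizes_partitions:
  assumes "l \<in> partitions_of m" "\<forall>k\<in>set ks. 1 \<le> k"
  shows "add_sizes ks l \<in> partitions_of (m + sum_list ks)"
  using assms(2)
proof (induction ks)
  case Nil
  then show ?case using assms(1) by (simp add: add_sizes_def)
next
  case (Cons k ks)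
  then have "add_sizes ks l \<in> partitions_of (m + sum_list ks)" "1 \<le> k" by auto
  note P = partitions_of_add[OF this]
  have eq: "m + sum_list (k # ks) = m + sum_list ks + k" by simp
  show ?case unfolding add_sizes_Cons eq by (rule P)
qed

lemma pmf_count_law_add_sizes:
  assumes p: "0 \<le> p" "p < 1" and l: "l \<in> partitions_of m" and ks: "\<forall>k\<in>set ks. 1 \<le> k"
    and T: "m + sum_list ks \<le> T"
  shows "part_weight p (m + sum_list ks) * prod_list (map (comp_weight p) ks) * pmf (count_law m p) l
      \<le> part_weight p m * real T ^ length ks * pmf (count_law (m + sum_list ks) p) (add_sizes ks l)"
  using ks T
proof (induction ks)
  case Nil
  have "add_sizes [] l = l" by (simp add: add_sizes_def)
  then show ?case by simp
next
  case (Cons k ks)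
  define M where "M = m + sum_list ks"
  have IH: "part_weight p M * prod_list (map (comp_weight p) ks) * pmf (count_law m p) l
      \<le> part_weight p m * real T ^ length ks * pmf (count_law M p) (add_sizes ks l)"
    unfolding M_def using Cons by (intro Cons.IH) auto
  have lM: "add_sizes ks l \<in> partitions_of M"
    unfolding M_def using add_sizes_partitions[OF l, of ks] Cons.prems by auto
  have k: "1 \<le> k" using Cons.prems by simp
  have st: "part_weight p (M + k) * comp_weight p k * pmf (count_law M p) (add_sizes ks l)
      \<le> part_weight p M * real (M + k) * pmf (count_law (M + k) p) (add_sizes (k # ks) l)"
    unfolding add_sizes_Cons by (rule pmf_count_law_add[OF p lM k])
  have DM: "0 < part_weight p M" "0 < part_weight p m" "0 < part_weight p (M + k)" using p(2) by (auto intro: part_weight_pos)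
  have w: "0 \<le> comp_weight p k" by (rule comp_weight_nonneg[OF p])
  have MT: "real (M + k) \<le> real T" using Cons.prems by (simp add: M_def)
  have "part_weight p M * (part_weight p (M + k) * (comp_weight p k * prod_list (map (comp_weight p) ks)) * pmf (count_law m p) l)
      = part_weight p (M + k) * comp_weight p k * (part_weight p M * prod_list (map (comp_weight p) ks) * pmf (count_law m p) l)"
    by (simp add: mult_ac)
  also have "\<dots> \<le> part_weight p (M + k) * comp_weight p k * (part_weight p m * real T ^ length ks * pmf (count_law M p) (add_sizes ks l))"
    using DM w by (intro mult_left_mono IH) auto
  also have "\<dots> = part_weight p m * real T ^ length ks * (part_weight p (M + k) * comp_weight p k * pmf (count_law M p) (add_sizes ks l))"
    by (simp add: mult_ac)
  also have "\<dots> \<le> part_weight p m * real T ^ length ks * (part_weight p M * real (M + k) * pmf (count_law (M + k) p) (add_sizes (k # ks) l))"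
    using DM by (intro mult_left_mono st) auto
  also have "\<dots> \<le> part_weight p m * real T ^ length ks * (part_weight p M * real T * pmf (count_law (M + k) p) (add_sizes (k # ks) l))"
    using DM MT by (intro mult_left_mono mult_right_mono) auto
  also have "\<dots> = part_weight p M * (part_weight p m * real T ^ length (k # ks) * pmf (count_law (M + k) p) (add_sizes (k # ks) l))"
    by (simp add: mult_ac)
  finally have "part_weight p (M + k) * (comp_weight p k * prod_list (map (comp_weight p) ks)) * pmf (count_law m p) l
     \<le> part_weight p m * real T ^ length (k # ks) * pmf (count_law (M + k) p) (add_sizes (k # ks) l)"
    using DM by (simp only: mult_le_cancel_left_pos)
  then show ?case by (simp add: M_def add_ac)
qed

text \<open>Plants components of sizes \<open>ks\<close> into a graph on the other \<open>m\<close>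
  vertices. Adding sizes is injective on count vectors, so the bounds for single vectors add up, and
  only the polynomial factor \<open>N ^ length ks\<close> is lost.\<close>

lemma prob_count_law_add_sizes:
  assumes p: "0 \<le> p" "p < 1" and ks: "\<forall>k\<in>set ks. 1 \<le> k" and N: "N = m + sum_list ks"
    and X: "\<And>l. l \<in> partitions_of m \<Longrightarrow> l \<in> G \<Longrightarrow> add_sizes ks l \<in> X"
  shows "part_weight p N * prod_list (map (comp_weight p) ks) * measure_pmf.prob (count_law m p) G
      \<le> part_weight p m * real N ^ length ks * measure_pmf.prob (count_law N p) X"
proof -
  let ?A = "partitions_of m \<inter> G"
  have D: "0 < part_weight p m" using p(2) by (rule part_weight_pos)
  have "part_weight p N * prod_list (map (comp_weight p) ks) * measure_pmf.prob (count_law m p) G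
     = (\<Sum>l\<in>?A. part_weight p N * prod_list (map (comp_weight p) ks) * pmf (count_law m p) l)"
    by (simp add: prob_count_law sum_distrib_left)
  also have "\<dots> \<le> (\<Sum>l\<in>?A. part_weight p m * real N ^ length ks * pmf (count_law N p) (add_sizes ks l))"
    unfolding N by (intro sum_mono pmf_count_law_add_sizes p ks) auto
  also have "\<dots> = part_weight p m * real N ^ length ks * (\<Sum>l\<in>add_sizes ks ` ?A. pmf (count_law N p) l)"
    by (simp add: sum.reindex[OF inj_add_sizes] sum_distrib_left)
  also have "(\<Sum>l\<in>add_sizes ks ` ?A. pmf (count_law N p) l) = measure_pmf.prob (count_law N p) (add_sizes ks ` ?A)"
    by (rule measure_measure_pmf_finite[symmetric]) (simp add: finite_partitions_of)
  also have "part_weight p m * real N ^ length ks * \<dots> \<le> part_weight p m * real N ^ length ks * measure_pmf.prob (count_law N p) X"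
    using D X by (intro mult_left_mono measure_pmf.finite_measure_mono) auto
  finally show ?thesis .
qed

text \<open>A sequence of witnesses with error tending to \<open>0\<close> is obtained by nearly minimising the error.\<close>

lemma choose_convergent:
  fixes P :: "nat \<Rightarrow> 'a \<Rightarrow> bool" and g :: "nat \<Rightarrow> 'a \<Rightarrow> real"
  assumes "\<And>d. 0 < d \<Longrightarrow> \<forall>\<^sub>F n in sequentially. \<exists>k. P n k \<and> \<bar>g n k - x\<bar> < d"
  shows "\<exists>k. (\<forall>\<^sub>F n in sequentially. P n (k n)) \<and> (\<lambda>n. g n (k n)) \<longlonglongrightarrow> x"
proof -
  define D where "D n = (INF k\<in>{k. P n k}. \<bar>g n k - x\<bar>)" for n
  define k where "k n = (SOME k. P n k \<and> \<bar>g n k - x\<bar> < D n + 1 / real (Suc n))" for n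
  have bdd: "bdd_below ((\<lambda>k. \<bar>g n k - x\<bar>) ` {k. P n k})" for n
    by (intro bdd_belowI[of _ 0]) auto
  have k: "P n (k n) \<and> \<bar>g n (k n) - x\<bar> < D n + 1 / real (Suc n)" if "\<exists>k. P n k" for n
  proof -
    have ne: "{k. P n k} \<noteq> {}" using that by auto
    have "(INF k\<in>{k. P n k}. \<bar>g n k - x\<bar>) < D n + 1 / real (Suc n)" by (simp add: D_def)
    then have "\<exists>k\<in>{k. P n k}. \<bar>g n k - x\<bar> < D n + 1 / real (Suc n)"
      by (rule iffD1[OF cINF_less_iff[OF ne bdd]])
    then obtain j where "P n j \<and> \<bar>g n j - x\<bar> < D n + 1 / real (Suc n)" by blast
    then show ?thesis unfolding k_def by (rule someI)
  qed
  have "(\<lambda>n. g n (k n)) \<longlonglongrightarrow> x"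
  proof (rule tendstoI)
    fix e :: real assume e: "0 < e"
    have "(\<lambda>n. 1 / real (Suc n)) \<longlonglongrightarrow> 0" by (rule LIMSEQ_Suc[OF lim_1_over_n])
    then have "\<forall>\<^sub>F n in sequentially. 1 / real (Suc n) < e / 2" by (rule order_tendstoD(2)) (use e in simp)
    then show "\<forall>\<^sub>F n in sequentially. dist (g n (k n)) x < e"
      using assms[of "e / 2", OF half_gt_zero[OF e]]
    proof eventually_elim
      case (elim n)
      then obtain j where j: "P n j" "\<bar>g n j - x\<bar> < e / 2" by auto
      have "D n \<le> \<bar>g n j - x\<bar>" unfolding D_def by (rule cINF_lower[OF bdd]) (use j in simp)
      moreover have "\<bar>g n (k n) - x\<bar> < D n + 1 / real (Suc n)" using k[of n] j(1) by blast
      ultimately show ?case using j(2) elim(1) unfolding dist_real_def by linarith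
    qed
  qed
  moreover have "\<forall>\<^sub>F n in sequentially. P n (k n)"
    using assms[of 1, OF zero_less_one] by eventually_elim (use k in blast)
  ultimately show ?thesis by blast
qed

text \<open>For \<open>t \<le> 0\<close> one has \<open>t ^ 3 + (m - t) ^ 3 \<ge> m ^ 3\<close>, and
  \<open>1/6 - 1/24 = 1/8\<close>.\<close>

lemma rate_without_giant:
  fixes t m s :: real
  assumes "t \<le> 0" "0 \<le> m" "s \<le> m ^ 3"
  shows "m ^ 3 / 8 \<le> t ^ 3 / 6 + (max 0 (m - t)) ^ 3 / 6 - s / 24"
proof -
  define u where "u = - t"
  have u: "0 \<le> u" using assms by (simp add: u_def)
  have "(m + u) ^ 3 = m ^ 3 + u ^ 3 + 3 * (m * u * (m + u))" by (simp add: eval_nat_numeral algebra_simps)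
  moreover have "0 \<le> m * u * (m + u)" using u assms by simp
  moreover have t3: "t ^ 3 = - (u ^ 3)" by (simp add: u_def)
  moreover have mx: "max 0 (m - t) = m + u" using u assms by (simp add: u_def)
  ultimately show ?thesis using assms(3) unfolding mx by linarith
qed

text \<open>For \<open>s \<le> m ^ 3\<close> both summands on the right are nonnegative if
  \<open>m\<close> is. They vanish together only if \<open>m\<close> is \<open>0\<close> or
  \<open>2 * t\<close> and \<open>s = m ^ 3\<close>, that is, if the mass sits in one
  component.\<close>

lemma rate_supercritical_identity:
  fixes t m s :: real
  assumes "t \<le> m"
  shows "t ^ 3 / 6 + (max 0 (m - t)) ^ 3 / 6 - s / 24 = m * (m - 2 * t)\<^sup>2 / 8 + (m ^ 3 - s) / 24"
  using assms by (simp add: max_def field_simps eval_nat_numeral)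

text \<open>Stability of the zero \<open>m = x\<close>, \<open>s = m ^ 3\<close> of the rate at
  \<open>t = x / 2\<close>. The second conclusion excludes that all sizes are at most
  \<open>x - d\<close>, since then \<open>s\<close> would be at most
  \<open>(x - d)\<^sup>2 * m\<close>; the first one excludes sizes beyond
  \<open>x + d\<close>.\<close>

lemma rate_near_giant:
  fixes x m s d :: real
  assumes x: "0 < x" and d: "0 < d" "d \<le> x" and m: "0 \<le> m" and s: "s \<le> m ^ 3"
    and J: "(x / 2) ^ 3 / 6 + (max 0 (m - x / 2)) ^ 3 / 6 - s / 24 < c"
    and c: "c \<le> x ^ 3 / 64" "c \<le> x * d\<^sup>2 / 64" "c \<le> x\<^sup>2 * d / 192"
  shows "m < x + d" "(x - d)\<^sup>2 * m < s"
proof -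
  have c0: "c \<le> x ^ 3 / 64" by (rule c)
  \<comment> \<open>Below \<open>x / 2\<close> the rate is at least
    \<open>x ^ 3 / 48 - x ^ 3 / 192 = x ^ 3 / 64\<close>, whence the first bound on
    \<open>c\<close>.\<close>
  have mx: "x / 2 \<le> m"
  proof (rule ccontr)
    assume "\<not> x / 2 \<le> m"
    then have "m < x / 2" by simp
    then have "m ^ 3 \<le> (x / 2) ^ 3" using m by (intro power_mono) auto
    then have "s \<le> x ^ 3 / 8" using s by (simp add: power_divide)
    moreover have "0 \<le> (max 0 (m - x / 2)) ^ 3" by simp
    moreover have "(x / 2) ^ 3 = x ^ 3 / 8" by (simp add: power_divide)
    ultimately have "x ^ 3 / 48 - x ^ 3 / 192 < c" using J by linarith
    then show False using c0 x by simp
  qed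
  have J': "m * (m - x)\<^sup>2 / 8 + (m ^ 3 - s) / 24 < c"
    using J rate_supercritical_identity[OF mx, of s] by simp
  have "x / 2 * (m - x)\<^sup>2 \<le> m * (m - x)\<^sup>2" using mx by (intro mult_right_mono) auto
  moreover have "0 \<le> (m ^ 3 - s) / 24" using s by simp
  ultimately have "x / 2 * (m - x)\<^sup>2 < 8 * c" using J' by linarith
  also have "\<dots> \<le> x / 2 * (d / 2)\<^sup>2" using c(2) by (simp add: power2_eq_square)
  finally have "(m - x)\<^sup>2 < (d / 2)\<^sup>2" using x by simp
  then have "\<bar>m - x\<bar>\<^sup>2 < (d / 2)\<^sup>2" by simp
  then have "\<bar>m - x\<bar> < d / 2" by (rule power2_less_imp_less) (use d in simp)
  then have md: "x - d / 2 < m \<and> m < x + d / 2" by linarith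
  then show "m < x + d" using d by simp
  have "(m ^ 3 - s) / 24 < c" by (rule le_less_trans[OF _ J']) (use m in simp)
  then have s2: "m ^ 3 - s < 24 * c" by simp
  have "(x - d)\<^sup>2 + x * d / 4 \<le> (x - d / 2)\<^sup>2"
  proof -
    have "(x - d / 2)\<^sup>2 - (x - d)\<^sup>2 = d * (x - 3 * d / 4)" by (simp add: power2_eq_square algebra_simps)
    also have "\<dots> \<ge> d * (x / 4)" using d by (intro mult_left_mono) auto
    finally show ?thesis by (simp add: mult.commute)
  qed
  also have "\<dots> \<le> m\<^sup>2" using md d by (intro power_mono) auto
  finally have "m * ((x - d)\<^sup>2 + x * d / 4) \<le> m * m\<^sup>2" using m by (rule mult_left_mono)
  moreover have "x / 2 * (x * d / 4) \<le> m * (x * d / 4)" using mx x d by (intro mult_right_mono) auto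
  moreover have "24 * c \<le> x / 2 * (x * d / 4)" using c(3) by (simp add: power2_eq_square)
  moreover have "m * m\<^sup>2 = m ^ 3" by (simp add: eval_nat_numeral)
  ultimately show "(x - d)\<^sup>2 * m < s" using s2 by (simp add: algebra_simps)
qed

section \<open>Typical behaviour in the window and the lower bound on weights\<close>

context critical_window
begin

text \<open>The fourth power of \<open>sqrt (1 / p) / a\<close> times
  \<open>a ^ 3 * p\<^sup>2 / S\<close> is \<open>1 / (a * S)\<close>, which tends to zero. Thus
  components below the cutoff vanish on the scale \<open>a\<close>, and test functions do not see
  them.\<close>

lemma cutoff_small:
  assumes "0 < d"
  shows "\<forall>\<^sub>F n in sequentially. real (cutoff n) < d * a n"
proof -
  have "(\<lambda>n. sqrt (1 / p n) / a n) \<longlonglongrightarrow> 0"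
  proof -
    have a0: "(\<lambda>n. 1 / a n) \<longlonglongrightarrow> 0"
      using tendsto_inverse_0_at_top[OF a_at_top] by (simp add: inverse_eq_divide)
    have "(\<lambda>n. (sqrt (1 / p n) / a n) ^ 4 * (a n ^ 3 * (p n)\<^sup>2 / S n)) \<longlonglongrightarrow> 0"
    proof -
      have e: "(\<lambda>n. (1 / a n) * (1 / S n)) \<longlonglongrightarrow> 0 * 0"
        by (rule tendsto_mult[OF a0 inverse_S_null])
      then have "(\<lambda>n. (1 / a n) * (1 / S n)) \<longlonglongrightarrow> 0" by simp
      then show ?thesis
      proof (rule Lim_transform_eventually)
        show "\<forall>\<^sub>F n in sequentially. (1 / a n) * (1 / S n) = (sqrt (1 / p n) / a n) ^ 4 * (a n ^ 3 * (p n)\<^sup>2 / S n)"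
          using eventually_basic
        proof eventually_elim
          case (elim n)
          define t where "t = sqrt (1 / p n)"
          have t: "t\<^sup>2 * p n = 1" using elim by (simp add: t_def)
          have "(t / a n) ^ 4 * (a n ^ 3 * (p n)\<^sup>2 / S n) = (t\<^sup>2 * p n)\<^sup>2 * (1 / a n) * (1 / S n)"
            using elim by (simp add: power_divide field_simps eval_nat_numeral)
          then show ?case unfolding t t_def[symmetric] by simp
        qed
      qed
    qed
    then have "(\<lambda>n. (sqrt (1 / p n) / a n) ^ 4 * (a n ^ 3 * (p n)\<^sup>2 / S n) / (a n ^ 3 * (p n)\<^sup>2 / S n)) \<longlonglongrightarrow> 0 / 1"
      by (intro tendsto_divide speed_scale) auto
    then have "(\<lambda>n. (sqrt (1 / p n) / a n) ^ 4) \<longlonglongrightarrow> 0 / 1"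
      by (rule Lim_transform_eventually) (use eventually_basic in \<open>eventually_elim, auto\<close>)
    then have 4: "(\<lambda>n. (sqrt (1 / p n) / a n) ^ 4) \<longlonglongrightarrow> 0" by simp
    have "(\<lambda>n. root 4 ((sqrt (1 / p n) / a n) ^ 4)) \<longlonglongrightarrow> root 4 0"
      by (intro tendsto_real_root 4)
    then have "(\<lambda>n. root 4 ((sqrt (1 / p n) / a n) ^ 4)) \<longlonglongrightarrow> 0" by (simp only: real_root_zero)
    moreover have "\<forall>\<^sub>F n in sequentially. root 4 ((sqrt (1 / p n) / a n) ^ 4) = sqrt (1 / p n) / a n"
      using eventually_basic by eventually_elim (auto intro!: real_root_power_cancel)
    ultimately show ?thesis by (rule Lim_transform_eventually)
  qed
  from order_tendstoD(2)[OF this assms] eventually_basic show ?thesis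
  proof eventually_elim
    case (elim n)
    then have "sqrt (1 / p n) < d * a n" by (simp add: pos_divide_less_eq)
    then show ?case using elim by linarith
  qed
qed

text \<open>A component of size at least \<open>d * a\<close> forces mass at least \<open>d\<close>
  and, as \<theta> is not positive, a rate of at least \<open>d ^ 3 / 8\<close>. This exceeds
  \<open>c + c / 2\<close> for \<open>c = d ^ 3 / 16\<close>.\<close>

lemma no_macroscopic_components:
  assumes N: "(\<lambda>n. (real (N n) - 1 / p n) / a n) \<longlonglongrightarrow> \<theta>" and \<theta>: "\<theta> \<le> 0" and d: "0 < d"
  shows "(\<lambda>n. measure_pmf.prob (count_law (N n) (p n)) {l. \<forall>k. d * a n \<le> real k \<longrightarrow> l k = 0}) \<longlonglongrightarrow> 1"
proof -
  let ?X = "\<lambda>n. {l. \<exists>k. d * a n \<le> real k \<and> l k \<noteq> (0::nat)}"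
  define c where "c = d ^ 3 / 16"
  have c: "0 < c" using d by (simp add: c_def)
  obtain A where A: "\<And>\<eta>. 0 < \<eta> \<Longrightarrow> \<forall>\<^sub>F n in sequentially. \<forall>l\<in>partitions_of (N n).
     exp (- (c * S n)) \<le> pmf (count_law (N n) (p n)) l \<longrightarrow>
     moment 1 (cutoff n) (N n) (a n) l \<le> A \<and>
     \<theta> ^ 3 / 6 + (max 0 (moment 1 (cutoff n) (N n) (a n) l - \<theta>)) ^ 3 / 6
       - moment 3 (cutoff n) (N n) (a n) l / 24 \<le> c + \<eta>"
    using macro_bound[OF N, of c] by blast
  have "(\<lambda>n. measure_pmf.prob (count_law (N n) (p n)) (?X n)) \<longlonglongrightarrow> 0"
  proof (rule prob_null[OF N c])
    show "\<forall>\<^sub>F n in sequentially. \<forall>l\<in>partitions_of (N n) \<inter> ?X n. pmf (count_law (N n) (p n)) l \<le> exp (- (c * S n))"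
      using A[of "c / 2", OF half_gt_zero[OF c]] cutoff_small[OF d] eventually_basic
    proof eventually_elim
      case (elim n)
      show ?case
      proof (rule ballI, rule ccontr)
        fix l assume l: "l \<in> partitions_of (N n) \<inter> ?X n" and ge: "\<not> pmf (count_law (N n) (p n)) l \<le> exp (- (c * S n))"
        let ?m = "moment 1 (cutoff n) (N n) (a n) l" and ?s = "moment 3 (cutoff n) (N n) (a n) l"
        have a: "0 < a n" using elim by simp
        obtain k where k: "d * a n \<le> real k" "l k \<noteq> 0" using l by auto
        have "k \<in> {cutoff n<..N n}" using k elim partitions_of_support[of l "N n" k] l by auto
        then have "real k / a n \<le> ?m" by (rule size_le_moment[of "a n" k "cutoff n" "N n" l, OF a _ k(2)])
        moreover have "d \<le> real k / a n" using k a by (simp add: pos_le_divide_eq)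
        ultimately have dm: "d \<le> ?m" by linarith
        have "d ^ 3 \<le> ?m ^ 3" using dm d by (intro power_mono) auto
        moreover have "?m ^ 3 / 8 \<le> \<theta> ^ 3 / 6 + (max 0 (?m - \<theta>)) ^ 3 / 6 - ?s / 24"
          by (rule rate_without_giant[OF \<theta>]) (use moment_3_le[OF a] dm d in auto)
        moreover have "\<theta> ^ 3 / 6 + (max 0 (?m - \<theta>)) ^ 3 / 6 - ?s / 24 \<le> c + c / 2"
          using elim(1) l ge by auto
        moreover have "0 < d ^ 3" using d by simp
        ultimately show False by (simp add: c_def)
      qed
    qed
  qed
  then have "(\<lambda>n. 1 - measure_pmf.prob (count_law (N n) (p n)) (?X n)) \<longlonglongrightarrow> 1 - 0"
    by (intro tendsto_intros)
  moreover have "1 - measure_pmf.prob (count_law (N n) (p n)) (?X n)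
     = measure_pmf.prob (count_law (N n) (p n)) {l. \<forall>k. d * a n \<le> real k \<longrightarrow> l k = 0}" for n
  proof -
    have "measure_pmf.prob (count_law (N n) (p n)) (space (measure_pmf (count_law (N n) (p n))) - ?X n)
       = 1 - measure_pmf.prob (count_law (N n) (p n)) (?X n)"
      by (rule measure_pmf.prob_compl) simp
    moreover have "space (measure_pmf (count_law (N n) (p n))) - ?X n = {l. \<forall>k. d * a n \<le> real k \<longrightarrow> l k = 0}" by auto
    ultimately show ?thesis by simp
  qed
  ultimately show ?thesis by simp
qed

text \<open>Vectors without a size near \<open>x * a\<close> have a rate bounded away from zero, so
  some such size is present with probability at least \<open>1/2\<close>. As there are at most
  \<open>N n\<close> candidates, one of them has probability at least \<open>1 / (2 * N n)\<close>,
  and \<open>prob_component_size_le\<close> turns this into a bound on its weight.\<close>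

lemma component_near:
  assumes N: "(\<lambda>n. (real (N n) - 1 / p n) / a n) \<longlonglongrightarrow> x / 2" and x: "0 < x" and d: "0 < d" "d \<le> x"
  shows "\<forall>\<^sub>F n in sequentially. \<exists>k. 1 \<le> k \<and> k \<le> N n \<and> \<bar>real k / a n - x\<bar> < d \<and>
    part_weight (p n) (N n - k) \<le> 2 * real (N n) * (comp_weight (p n) k * part_weight (p n) (N n))"
proof -
  let ?near = "\<lambda>n k. \<bar>real k / a n - x\<bar> < d"
  let ?X = "\<lambda>n. {l. \<forall>k. ?near n k \<longrightarrow> l k = (0::nat)}"
  define c where "c = min (x ^ 3 / 64) (min (x * d\<^sup>2 / 64) (x\<^sup>2 * d / 192)) / 2"
  have c: "0 < c" using x d by (simp add: c_def)
  obtain A where A: "\<And>\<eta>. 0 < \<eta> \<Longrightarrow> \<forall>\<^sub>F n in sequentially. \<forall>l\<in>partitions_of (N n).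
     exp (- (c * S n)) \<le> pmf (count_law (N n) (p n)) l \<longrightarrow>
     moment 1 (cutoff n) (N n) (a n) l \<le> A \<and>
     (x / 2) ^ 3 / 6 + (max 0 (moment 1 (cutoff n) (N n) (a n) l - (x / 2))) ^ 3 / 6
       - moment 3 (cutoff n) (N n) (a n) l / 24 \<le> c + \<eta>"
    using macro_bound[OF N, of c] by blast
  have lim: "(\<lambda>n. measure_pmf.prob (count_law (N n) (p n)) (?X n)) \<longlonglongrightarrow> 0"
  proof (rule prob_null[OF N c])
    show "\<forall>\<^sub>F n in sequentially. \<forall>l\<in>partitions_of (N n) \<inter> ?X n. pmf (count_law (N n) (p n)) l \<le> exp (- (c * S n))"
      using A[of "c / 2", OF half_gt_zero[OF c]] eventually_basic
    proof eventually_elim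
      case (elim n)
      show ?case
      proof (rule ballI, rule ccontr)
        fix l assume l: "l \<in> partitions_of (N n) \<inter> ?X n" and ge: "\<not> pmf (count_law (N n) (p n)) l \<le> exp (- (c * S n))"
        let ?m = "moment 1 (cutoff n) (N n) (a n) l" and ?s = "moment 3 (cutoff n) (N n) (a n) l"
        have a: "0 < a n" using elim by simp
        have "(x / 2) ^ 3 / 6 + (max 0 (?m - x / 2)) ^ 3 / 6 - ?s / 24 \<le> c + c / 2" using elim(1) l ge by auto
        then have J: "(x / 2) ^ 3 / 6 + (max 0 (?m - x / 2)) ^ 3 / 6 - ?s / 24 < 2 * c" using c by linarith
        have cc: "2 * c \<le> x ^ 3 / 64" "2 * c \<le> x * d\<^sup>2 / 64" "2 * c \<le> x\<^sup>2 * d / 192" by (auto simp: c_def)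
        note R = rate_near_giant[OF x d moment_nonneg moment_3_le[OF a] J cc, OF less_imp_le[OF a]]
        have "?s \<le> (\<Sum>k\<in>{cutoff n<..N n}. (x - d)\<^sup>2 * (real (l k) * (real k / a n) ^ 1))"
          unfolding moment_def[of 3]
        proof (rule sum_mono)
          fix k assume k: "k \<in> {cutoff n<..N n}"
          show "real (l k) * (real k / a n) ^ 3 \<le> (x - d)\<^sup>2 * (real (l k) * (real k / a n) ^ 1)"
          proof (cases "l k = 0")
            case False
            have "real k / a n \<le> ?m" by (rule size_le_moment[of "a n" k "cutoff n" "N n" l, OF a k False])
            moreover have "\<not> ?near n k" using l False by auto
            ultimately have le: "real k / a n \<le> x - d" using R(1) by linarith
            have "(real k / a n)\<^sup>2 \<le> (x - d)\<^sup>2" using le a by (intro power_mono) auto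
            then have "(real k / a n)\<^sup>2 * (real (l k) * (real k / a n)) \<le> (x - d)\<^sup>2 * (real (l k) * (real k / a n))"
              using a by (intro mult_right_mono) auto
            then show ?thesis by (simp add: eval_nat_numeral mult_ac)
          qed simp
        qed
        also have "\<dots> = (x - d)\<^sup>2 * ?m" by (simp add: moment_def sum_distrib_left)
        finally show False using R(2) by linarith
      qed
    qed
  qed
  have e: "\<forall>\<^sub>F n in sequentially. measure_pmf.prob (count_law (N n) (p n)) (?X n) < 1/2"
    by (rule order_tendstoD(2)[OF lim]) simp
  from e eventually_basic eventually_N[OF N] show ?thesis
  proof eventually_elim
    case (elim n)
    let ?M = "count_law (N n) (p n)"
    have p: "0 \<le> p n" "p n < 1" and a: "0 < a n" using elim by auto
    let ?K = "{k\<in>{1..N n}. ?near n k}"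
    have "1 / 2 < 1 - measure_pmf.prob ?M (?X n)" using elim by simp
    also have "\<dots> = measure_pmf.prob ?M (space (measure_pmf ?M) - ?X n)"
      by (rule measure_pmf.prob_compl[symmetric]) simp
    also have "\<dots> = measure_pmf.prob ?M ((space (measure_pmf ?M) - ?X n) \<inter> set_pmf ?M)" by (simp add: measure_Int_set_pmf)
    also have "\<dots> \<le> measure_pmf.prob ?M (\<Union>k\<in>?K. {l. l k \<noteq> 0})"
    proof (rule measure_pmf.finite_measure_mono)
      show "(space (measure_pmf ?M) - ?X n) \<inter> set_pmf ?M \<subseteq> (\<Union>k\<in>?K. {l. l k \<noteq> 0})"
      proof
        fix l assume "l \<in> (space (measure_pmf ?M) - ?X n) \<inter> set_pmf ?M"
        then obtain k where "?near n k" "l k \<noteq> 0" "l \<in> partitions_of (N n)" using set_pmf_count_law by fastforce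
        then show "l \<in> (\<Union>k\<in>?K. {l. l k \<noteq> 0})" using partitions_of_support[of l "N n" k] by auto
      qed
    qed simp
    also have "\<dots> \<le> (\<Sum>k\<in>?K. measure_pmf.prob ?M {l. l k \<noteq> 0})"
      by (rule measure_pmf.finite_measure_subadditive_finite) auto
    finally have big: "1 / 2 < (\<Sum>k\<in>?K. measure_pmf.prob ?M {l. l k \<noteq> 0})" .
    have "\<exists>k\<in>?K. 1 / (2 * real (N n)) \<le> measure_pmf.prob ?M {l. l k \<noteq> 0}"
    proof (rule ccontr)
      assume "\<not> ?thesis"
      then have "(\<Sum>k\<in>?K. measure_pmf.prob ?M {l. l k \<noteq> 0}) \<le> (\<Sum>k\<in>?K. 1 / (2 * real (N n)))"
        by (intro sum_mono) (auto simp: not_le intro: less_imp_le)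
      also have "\<dots> = real (card ?K) * (1 / (2 * real (N n)))" by simp
      also have "\<dots> \<le> real (N n) * (1 / (2 * real (N n)))"
      proof (rule mult_right_mono)
        have "card ?K \<le> card {1..N n}" by (rule card_mono) auto
        then show "real (card ?K) \<le> real (N n)" by simp
      qed simp
      also have "\<dots> = 1 / 2" using elim by simp
      finally show False using big by simp
    qed
    then obtain k where k: "k \<in> ?K" "1 / (2 * real (N n)) \<le> measure_pmf.prob ?M {l. l k \<noteq> 0}" by blast
    have D: "0 < part_weight (p n) (N n - k)" using p by (intro part_weight_pos)
    have "1 / (2 * real (N n)) * part_weight (p n) (N n - k) \<le> measure_pmf.prob ?M {l. l k \<noteq> 0} * part_weight (p n) (N n - k)"
      using k D by (intro mult_right_mono) auto
    also have "\<dots> \<le> comp_weight (p n) k * part_weight (p n) (N n)"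
      by (rule prob_component_size_le[OF p]) (use k in auto)
    finally have "part_weight (p n) (N n - k) \<le> 2 * real (N n) * (comp_weight (p n) k * part_weight (p n) (N n))"
      using elim by (simp add: field_simps)
    then show ?case using k by (intro exI[of _ k]) auto
  qed
qed

lemma ln_size_null:
  assumes N: "(\<lambda>n. (real (N n) - 1 / p n) / a n) \<longlonglongrightarrow> \<theta>"
  shows "(\<lambda>n. ln (2 * real (N n)) / S n) \<longlonglongrightarrow> 0"
proof (rule null_comparison[where c = 3])
  show "\<forall>\<^sub>F n in sequentially. \<bar>ln (2 * real (N n)) / S n\<bar> \<le> 3 * (sqrt (1 / p n) * ln (1 / p n) / S n)"
    using eventually_basic eventually_N[OF N]
  proof eventually_elim
    case (elim n)
    define v where "v = 1 / p n"
    have v: "0 < v" "1 \<le> ln v" "1 \<le> sqrt v" using elim by (auto simp: v_def)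
    have N1: "1 \<le> real (N n)" using elim by simp
    have "ln (2 * real (N n)) \<le> ln (4 * v)" using elim N1 v by (subst ln_le_cancel_iff) (auto simp: v_def)
    also have "\<dots> = 2 * ln 2 + ln v" using v ln_realpow[of 2 2] by (simp add: ln_mult)
    also have "\<dots> \<le> 3 * (1 * ln v)" using v ln_2_less_1 by linarith
    also have "\<dots> \<le> 3 * (sqrt v * ln v)" using v by (intro mult_left_mono mult_right_mono) auto
    finally have "ln (2 * real (N n)) / S n \<le> 3 * (sqrt v * ln v) / S n" using elim by (intro divide_right_mono) auto
    moreover have "0 \<le> ln (2 * real (N n)) / S n" using N1 elim by simp
    ultimately show ?case by (simp add: v_def)
  qed
qed

text \<open>Removing the component near \<open>x * a\<close> from \<open>1 / p + x * a / 2\<close>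
  vertices leaves about \<open>1 / p - x * a / 2\<close>. At these symmetric points the normalised
  logarithms are \<open>- ((x / 2) ^ 3 / 6)\<close> and \<open>(x / 2) ^ 3 / 6\<close>, and their
  difference \<open>x ^ 3 / 24\<close> matches \<open>comp_weight_bound\<close>. The bound is
  obtained for suitable sizes near \<open>x * a\<close> only, which suffices because test functions
  are continuous.\<close>

lemma comp_weight_lower:
  assumes x: "0 < x"
  shows "\<exists>k. (\<lambda>n. real (k n) / a n) \<longlonglongrightarrow> x \<and>
    (\<forall>\<eta>>0. \<forall>\<^sub>F n in sequentially. 1 \<le> k n \<and> 0 < comp_weight (p n) (k n) \<and>
      real (k n) * (1 + ln (p n)) + (x ^ 3 / 24 - \<eta>) * S n \<le> ln (comp_weight (p n) (k n)))"
proof -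
  define N where "N n = nat \<lfloor>1 / p n + x / 2 * a n\<rfloor>" for n
  have N: "(\<lambda>n. (real (N n) - 1 / p n) / a n) \<longlonglongrightarrow> x / 2"
  proof -
    have "(\<lambda>n. 1 / a n) \<longlonglongrightarrow> 0"
      using tendsto_inverse_0_at_top[OF a_at_top] by (simp add: inverse_eq_divide)
    moreover have "\<forall>\<^sub>F n in sequentially. norm ((real (N n) - 1 / p n) / a n - x / 2) \<le> 1 / a n"
      using eventually_basic
    proof eventually_elim
      case (elim n)
      define y where "y = 1 / p n + x / 2 * a n"
      have pos: "0 < p n" "0 < a n" using elim by auto
      have "0 \<le> y" using pos x by (simp add: y_def)
      then have "real (N n) = of_int \<lfloor>y\<rfloor>" by (simp add: N_def y_def)
      then have "y - 1 \<le> real (N n)" "real (N n) \<le> y" using floor_correct[of y] by simp_all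
      then have "\<bar>real (N n) - y\<bar> \<le> 1" by linarith
      moreover have "(real (N n) - 1 / p n) / a n - x / 2 = (real (N n) - y) / a n"
        using pos by (simp add: y_def field_simps)
      ultimately show ?case using pos by (simp add: divide_right_mono)
    qed
    ultimately have "(\<lambda>n. (real (N n) - 1 / p n) / a n - x / 2) \<longlonglongrightarrow> 0"
      by (rule Lim_null_comparison[rotated])
    then show ?thesis by (rule LIM_zero_cancel)
  qed
  define P where "P n k \<longleftrightarrow> 1 \<le> k \<and> k \<le> N n \<and>
     part_weight (p n) (N n - k) \<le> 2 * real (N n) * (comp_weight (p n) k * part_weight (p n) (N n))" for n k
  have "\<exists>k. (\<forall>\<^sub>F n in sequentially. P n (k n)) \<and> (\<lambda>n. real (k n) / a n) \<longlonglongrightarrow> x"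
  proof (rule choose_convergent)
    fix d :: real assume "0 < d"
    then have "0 < min d x" "min d x \<le> x" using x by auto
    from component_near[OF N x this]
    show "\<forall>\<^sub>F n in sequentially. \<exists>k. P n k \<and> \<bar>real k / a n - x\<bar> < d"
      by eventually_elim (auto simp: P_def)
  qed
  then obtain k where k: "\<forall>\<^sub>F n in sequentially. P n (k n)" "(\<lambda>n. real (k n) / a n) \<longlonglongrightarrow> x" by blast
  have N': "(\<lambda>n. (real (N n - k n) - 1 / p n) / a n) \<longlonglongrightarrow> - (x / 2)"
  proof -
    have "(\<lambda>n. (real (N n) - 1 / p n) / a n - real (k n) / a n) \<longlonglongrightarrow> x / 2 - x" by (intro tendsto_diff N k)
    then have "(\<lambda>n. (real (N n) - 1 / p n) / a n - real (k n) / a n) \<longlonglongrightarrow> - (x / 2)" by simp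
    then show ?thesis
      by (rule Lim_transform_eventually)
         (use k(1) in \<open>eventually_elim, auto simp: P_def of_nat_diff diff_divide_distrib[symmetric] algebra_simps\<close>)
  qed
  note lnN = ln_size_null[OF N]
  have T: "(\<lambda>n. log_weight (p n) (N n - k n) / S n - log_weight (p n) (N n) / S n - ln (2 * real (N n)) / S n)
     \<longlonglongrightarrow> - ((- (x / 2)) ^ 3) / 6 - - ((x / 2) ^ 3) / 6 - 0"
    by (intro tendsto_diff log_weight_tendsto N N' lnN)
  have eq: "- ((- (x / 2)) ^ 3) / 6 - - ((x / 2) ^ 3) / 6 - 0 = x ^ 3 / 24"
    by (simp add: power_divide)
  from T have lim: "(\<lambda>n. log_weight (p n) (N n - k n) / S n - log_weight (p n) (N n) / S n - ln (2 * real (N n)) / S n)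
     \<longlonglongrightarrow> x ^ 3 / 24" unfolding eq .
  show ?thesis
  proof (intro exI[of _ k] conjI k(2) allI impI)
    fix \<eta> :: real assume "0 < \<eta>"
    then have "\<forall>\<^sub>F n in sequentially. x ^ 3 / 24 - \<eta> < log_weight (p n) (N n - k n) / S n - log_weight (p n) (N n) / S n - ln (2 * real (N n)) / S n"
      by (intro order_tendstoD(1)[OF lim]) simp
    from this k(1) eventually_basic eventually_N[OF N]
    show "\<forall>\<^sub>F n in sequentially. 1 \<le> k n \<and> 0 < comp_weight (p n) (k n) \<and>
      real (k n) * (1 + ln (p n)) + (x ^ 3 / 24 - \<eta>) * S n \<le> ln (comp_weight (p n) (k n))"
    proof eventually_elim
      case (elim n)
      let ?w = "comp_weight (p n) (k n)"
      have p: "0 \<le> p n" "p n < 1" and S: "0 < S n" using elim by auto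
      have D: "0 < part_weight (p n) (N n - k n)" "0 < part_weight (p n) (N n)" using p by (auto intro: part_weight_pos)
      have P: "part_weight (p n) (N n - k n) \<le> 2 * real (N n) * (?w * part_weight (p n) (N n))" "k n \<le> N n" "1 \<le> k n"
        using elim(2) by (auto simp: P_def)
      have w: "0 < ?w"
      proof (rule ccontr)
        assume "\<not> 0 < ?w"
        then have "?w = 0" using comp_weight_nonneg[OF p, of "k n"] by simp
        then show False using P D by simp
      qed
      have N1: "0 < real (N n)" using elim by simp
      have "ln (part_weight (p n) (N n - k n)) \<le> ln (2 * real (N n) * (?w * part_weight (p n) (N n)))"
        using P D w N1 by (subst ln_le_cancel_iff) auto
      also have "\<dots> = ln (2 * real (N n)) + (ln ?w + ln (part_weight (p n) (N n)))"
        using D w N1 by (simp add: ln_mult_pos)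
      finally have 1: "ln (part_weight (p n) (N n - k n)) - ln (part_weight (p n) (N n)) - ln (2 * real (N n)) \<le> ln ?w" by simp
      have 2: "ln (part_weight (p n) (N n - k n)) - ln (part_weight (p n) (N n))
        = log_weight (p n) (N n - k n) - log_weight (p n) (N n) + real (k n) * (1 + ln (p n))"
        using P by (simp add: log_weight_def of_nat_diff algebra_simps)
      have "x ^ 3 / 24 - \<eta> < (log_weight (p n) (N n - k n) - log_weight (p n) (N n) - ln (2 * real (N n))) / S n"
        using elim(1) by (simp add: diff_divide_distrib)
      then have "(x ^ 3 / 24 - \<eta>) * S n < log_weight (p n) (N n - k n) - log_weight (p n) (N n) - ln (2 * real (N n))"
        using S by (simp add: pos_less_divide_eq)
      then show ?case using 1 2 w P by auto
    qed
  qed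
qed

end

section \<open>Integer-valued measures and the vague topology\<close>

lemma space_pos_borel [simp]: "space pos_borel = {0<..}"
  by (simp add: space_restrict_space)

lemma sets_pos_borel_iff: "A \<in> sets pos_borel \<longleftrightarrow> A \<subseteq> {0<..} \<and> A \<in> sets borel"
  by (subst sets_restrict_space_iff) auto

lemma test_function_measurable: "f \<in> test_functions \<Longrightarrow> f \<in> borel_measurable pos_borel"
  by (auto simp: test_functions_def intro!: borel_measurable_continuous_on_restrict)

lemma test_function_support:
  assumes "f \<in> test_functions"
  shows "\<exists>\<alpha>>0. \<forall>x. 0 < x \<longrightarrow> x < \<alpha> \<longrightarrow> f x = 0"
proof -
  obtain K where K: "compact K" "K \<subseteq> {0<..}" "\<forall>x\<in>{0<..} - K. f x = 0"
    using assms by (auto simp: test_functions_def)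
  show ?thesis
  proof (cases "K = {}")
    case True
    then show ?thesis using K by (intro exI[of _ 1]) auto
  next
    case False
    then obtain m where m: "m \<in> K" "\<forall>x\<in>K. m \<le> x" using compact_attains_inf[OF K(1)] by blast
    have "0 < m" using m K by auto
    moreover have "f x = 0" if "0 < x" "x < m" for x using K(3) m(2) that by force
    ultimately show ?thesis by blast
  qed
qed

text \<open>The support stays away from \<open>0\<close>, so the extension by zero is continuous
  there too. This is used for rescaled sizes that tend to \<open>0\<close>.\<close>

lemma test_function_extension:
  assumes f: "f \<in> test_functions"
  shows "isCont (\<lambda>x. if 0 < x then f x else 0) y"
proof -
  obtain \<alpha> where \<alpha>: "0 < \<alpha>" "\<And>x. 0 < x \<Longrightarrow> x < \<alpha> \<Longrightarrow> f x = 0" using test_function_support[OF f] by blast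
  let ?F = "\<lambda>x. if 0 < x then f x else 0"
  show ?thesis
  proof (cases "0 < y")
    case True
    have "continuous_on {0<..} f" using f by (auto simp: test_functions_def)
    then have "isCont f y" using True by (simp add: continuous_on_eq_continuous_at)
    moreover have "\<forall>\<^sub>F x in nhds y. ?F x = f x"
      using eventually_nhds_in_open[of "{0<..}" y] True by (auto elim: eventually_mono)
    ultimately show ?thesis using isCont_cong by fastforce
  next
    case False
    have "\<forall>\<^sub>F x in nhds y. ?F x = 0"
      using eventually_nhds_in_open[of "{..<\<alpha>}" y] False \<alpha> by (auto elim!: eventually_mono)
    then have "isCont ?F y = isCont (\<lambda>_. 0::real) y" by (rule isCont_cong)
    then show ?thesis by simp
  qed
qed

lemma topspace_vague: "topspace vague_topology = int_measures"
proof -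
  have "(\<lambda>_. 0) \<in> test_functions" by (auto simp: test_functions_def intro!: exI[of _ "{}"])
  then have "int_measures \<in> {{\<mu> \<in> int_measures. (LINT x|\<mu>. f x) \<in> U} | f U. f \<in> test_functions \<and> open U}"
    by (intro CollectI exI[of _ "\<lambda>_. 0"] exI[of _ UNIV]) auto
  then show ?thesis unfolding vague_topology_def topology_generated_by_topspace by blast
qed

text \<open>Membership near \<mu> is controlled by finitely many test functions with one common
  tolerance. Hence convergence of the integral of each test function along a sequence suffices to
  detect limits in closed sets.\<close>

lemma vague_neighbourhood:
  assumes "openin vague_topology U" "\<mu> \<in> U"
  shows "\<exists>F d. finite F \<and> F \<subseteq> test_functions \<and> 0 < d \<and>
    (\<forall>\<nu>\<in>int_measures. (\<forall>f\<in>F. \<bar>(LINT x|\<nu>. f x) - (LINT x|\<mu>. f x)\<bar> < d) \<longrightarrow> \<nu> \<in> U)"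
  using openin_topology_generated_by[OF assms(1)[unfolded vague_topology_def]] assms(2)
proof (induction rule: generate_topology_on.induct)
  case Empty
  then show ?case by simp
next
  case (Int A B)
  obtain F d where 1: "finite F" "F \<subseteq> test_functions" "0 < d"
    "\<forall>\<nu>\<in>int_measures. (\<forall>f\<in>F. \<bar>(LINT x|\<nu>. f x) - (LINT x|\<mu>. f x)\<bar> < d) \<longrightarrow> \<nu> \<in> A"
    using Int by blast
  obtain G e where 2: "finite G" "G \<subseteq> test_functions" "0 < e"
    "\<forall>\<nu>\<in>int_measures. (\<forall>f\<in>G. \<bar>(LINT x|\<nu>. f x) - (LINT x|\<mu>. f x)\<bar> < e) \<longrightarrow> \<nu> \<in> B"
    using Int by blast
  show ?case
    using 1 2 by (intro exI[of _ "F \<union> G"] exI[of _ "min d e"]) auto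
next
  case (UN K)
  then obtain A where A: "A \<in> K" "\<mu> \<in> A" by auto
  from UN.IH[OF A] obtain F d where "finite F" "F \<subseteq> test_functions" "0 < d"
    "\<forall>\<nu>\<in>int_measures. (\<forall>f\<in>F. \<bar>(LINT x|\<nu>. f x) - (LINT x|\<mu>. f x)\<bar> < d) \<longrightarrow> \<nu> \<in> A"
    by (elim exE conjE) (rule that; assumption)
  then show ?case using A(1) by (intro exI[of _ F] exI[of _ d]) auto
next
  case (Basis A)
  then obtain f V where A: "A = {\<mu> \<in> int_measures. (LINT x|\<mu>. f x) \<in> V}" "f \<in> test_functions" "open V" by auto
  then obtain e where e: "0 < e" "\<And>y. dist y (LINT x|\<mu>. f x) < e \<Longrightarrow> y \<in> V"
    using Basis.prems by (auto simp: open_dist)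
  then show ?case
    using A by (intro exI[of _ "{f}"] exI[of _ e]) (auto simp: dist_real_def)
qed

text \<open>The image of a counting measure: the index set carries the multiplicities, as different
  indices with equal positions add up.\<close>

definition atomic_measure :: "'i set \<Rightarrow> ('i \<Rightarrow> real) \<Rightarrow> real measure" where
  "atomic_measure I x = distr (count_space I) pos_borel x"

lemma atomic_measurable: "x \<in> I \<rightarrow> {0<..} \<Longrightarrow> x \<in> measurable (count_space I) pos_borel"
  by simp

lemma integrable_count_space_finite_support:
  fixes g :: "'i \<Rightarrow> real"
  assumes "finite {i \<in> I. g i \<noteq> 0}"
  shows "integrable (count_space I) g"
proof -
  have "(\<integral>\<^sup>+i. ennreal (norm (g i)) \<partial>count_space I) = (\<Sum>i\<in>{i \<in> I. g i \<noteq> 0}. ennreal (norm (g i)))"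
    by (rule nn_integral_count_space') (use assms in auto)
  also have "\<dots> < \<infinity>" by (simp add: sum_ennreal)
  finally show ?thesis by (simp add: integrable_iff_bounded)
qed

lemma atomic_measure_int_measures:
  assumes x: "x \<in> I \<rightarrow> {0<..}" and fin: "\<And>\<alpha>. 0 < \<alpha> \<Longrightarrow> finite {i \<in> I. \<alpha> \<le> x i}"
  shows "atomic_measure I x \<in> int_measures"
    and "f \<in> test_functions \<Longrightarrow> (LINT y|atomic_measure I x. f y) = (\<Sum>i | i \<in> I \<and> f (x i) \<noteq> 0. f (x i))"
proof -
  note m = atomic_measurable[OF x]
  have finf: "finite {i \<in> I. f (x i) \<noteq> 0}" if f: "f \<in> test_functions" for f
  proof -
    obtain \<alpha> where \<alpha>: "0 < \<alpha>" "\<And>x. 0 < x \<Longrightarrow> x < \<alpha> \<Longrightarrow> f x = 0" using test_function_support[OF f] by blast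
    have "{i \<in> I. f (x i) \<noteq> 0} \<subseteq> {i \<in> I. \<alpha> \<le> x i}"
      using \<alpha>(2) x by (auto simp: not_less[symmetric] Pi_iff)
    then show ?thesis using fin[OF \<alpha>(1)] finite_subset by blast
  qed
  have "integrable (atomic_measure I x) f" if f: "f \<in> test_functions" for f
    unfolding atomic_measure_def
    using integrable_distr_eq[OF m test_function_measurable[OF f]] integrable_count_space_finite_support[OF finf[OF f]] by simp
  moreover have "emeasure (atomic_measure I x) A \<in> range of_nat \<union> {\<infinity>}" if "A \<in> sets pos_borel" for A
  proof -
    have "emeasure (atomic_measure I x) A = emeasure (count_space I) (x -` A \<inter> I)"
      using emeasure_distr[OF m that] by (simp add: atomic_measure_def)
    then show ?thesis by (auto simp: emeasure_count_space)
  qed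
  ultimately show "atomic_measure I x \<in> int_measures"
    by (auto simp: int_measures_def atomic_measure_def)
  show "(LINT y|atomic_measure I x. f y) = (\<Sum>i | i \<in> I \<and> f (x i) \<noteq> 0. f (x i))" if f: "f \<in> test_functions"
    unfolding atomic_measure_def
    using integral_distr[OF m test_function_measurable[OF f]] lebesgue_integral_count_space_finite_support[OF finf[OF f]] by simp
qed

text \<open>The index \<open>(k, j)\<close> stands for the \<open>j\<close>-th of the
  \<open>l k\<close> components of size \<open>k\<close>.\<close>

lemma Me_eq_atomic_measure:
  assumes "0 < real n * b"
  shows "Me n b l = atomic_measure (SIGMA k:{1..n}. {..<l k}) (\<lambda>(k, j). real k / (real n * b) powr (2/3))"
proof -
  let ?I = "SIGMA k:{1..n}. {..<l k}" and ?x = "\<lambda>(k, j). real k / (real n * b) powr (2/3)"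
  have "Me n b l = measure_of {0<..} (sets pos_borel) (\<lambda>A. emeasure (count_space ?I) (?x -` A \<inter> ?I))"
    unfolding Me_def
  proof (rule measure_of_eq)
    show "sets pos_borel \<subseteq> Pow {0<..}" using sets.space_closed[of pos_borel] by simp
    fix A
    have "?x -` A \<inter> ?I = (SIGMA k:{k\<in>{1..n}. real k / (real n * b) powr (2/3) \<in> A}. {..<l k})" by auto
    then have "emeasure (count_space ?I) (?x -` A \<inter> ?I) = of_nat (card (SIGMA k:{k\<in>{1..n}. real k / (real n * b) powr (2/3) \<in> A}. {..<l k}))"
      by (subst emeasure_count_space_finite) auto
    also have "\<dots> = of_nat (\<Sum>k\<in>{k\<in>{1..n}. real k / (real n * b) powr (2/3) \<in> A}. l k)" by simp
    also have "(\<Sum>k\<in>{k\<in>{1..n}. real k / (real n * b) powr (2/3) \<in> A}. l k) = (\<Sum>k=1..n. if real k / (real n * b) powr (2/3) \<in> A then l k else 0)"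
      by (rule sum.mono_neutral_cong_left) auto
    also have "of_nat \<dots> = (\<Sum>k=1..n. of_nat (l k) * indicator A (real k / (real n * b) powr (2/3)) :: ennreal)"
      unfolding of_nat_sum by (intro sum.cong) auto
    finally show "(\<Sum>k=1..n. of_nat (l k) * indicator A (real k / (real n * b) powr (2/3))) = emeasure (count_space ?I) (?x -` A \<inter> ?I)" ..
  qed
  then show ?thesis by (simp add: atomic_measure_def distr_def)
qed

lemma Me_facts:
  assumes "0 < real n * b"
  shows "Me n b l \<in> int_measures"
    and "f \<in> test_functions \<Longrightarrow> (LINT y|Me n b l. f y) = (\<Sum>k=1..n. real (l k) * f (real k / (real n * b) powr (2/3)))"
proof -
  let ?I = "SIGMA k:{1..n}. {..<l k}" and ?x = "\<lambda>(k, j). real k / (real n * b) powr (2/3)"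
  have fI: "finite ?I" by auto
  have "0 < (real n * b) powr (2/3)" using assms unfolding powr_gt_zero by linarith
  then have x: "?x \<in> ?I \<rightarrow> {0<..}" by auto
  note * = atomic_measure_int_measures[OF x]
  show "Me n b l \<in> int_measures"
    unfolding Me_eq_atomic_measure[OF assms] by (rule *(1)) (use fI in auto)
  show "(LINT y|Me n b l. f y) = (\<Sum>k=1..n. real (l k) * f (real k / (real n * b) powr (2/3)))" if f: "f \<in> test_functions"
  proof -
    have "(LINT y|Me n b l. f y) = (\<Sum>i | i \<in> ?I \<and> f (?x i) \<noteq> 0. f (?x i))"
      unfolding Me_eq_atomic_measure[OF assms] by (rule *(2)) (use fI f in auto)
    also have "\<dots> = (\<Sum>i\<in>?I. f (?x i))" by (rule sum.mono_neutral_left) (use fI in auto)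
    also have "\<dots> = (\<Sum>k=1..n. \<Sum>j<l k. f (real k / (real n * b) powr (2/3)))"
      by (subst sum.Sigma) (auto simp: case_prod_unfold)
    finally show ?thesis by simp
  qed
qed

section \<open>Structure of integer-valued measures\<close>

lemma int_measure_ge_1:
  assumes "\<mu> \<in> int_measures" "A \<in> sets \<mu>" "emeasure \<mu> A \<noteq> 0"
  shows "1 \<le> emeasure \<mu> A"
proof -
  have "emeasure \<mu> A \<in> range of_nat \<union> {\<infinity>}" using assms by (auto simp: int_measures_def)
  then consider k where "emeasure \<mu> A = of_nat k" | "emeasure \<mu> A = \<infinity>" by blast
  then show ?thesis
  proof cases
    case 1
    then have "1 \<le> k" using assms(3) by (cases k) auto
    then have "(of_nat 1 :: ennreal) \<le> of_nat k" by (rule of_nat_mono)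
    then show ?thesis using 1 by simp
  qed simp
qed

lemma int_measure_sets: "\<mu> \<in> int_measures \<Longrightarrow> sets \<mu> = sets pos_borel"
  by (simp add: int_measures_def)

lemma int_measure_space: "\<mu> \<in> int_measures \<Longrightarrow> space \<mu> = {0<..}"
  using sets_eq_imp_space_eq[of \<mu> pos_borel] int_measure_sets by simp

text \<open>A set that is not null has measure at least one, so Markov's inequality excludes any
  mass above the mean \<open>m\<close>. Hence \<open>x ^ 3 \<le> m\<^sup>2 * x\<close> almost
  everywhere, which makes the cubic integral finite.\<close>

lemma int_measure_mean:
  assumes \<mu>: "\<mu> \<in> int_measures" and fin: "(\<integral>\<^sup>+x. ennreal x \<partial>\<mu>) < \<infinity>"
  defines "m \<equiv> (LINT x|\<mu>. x)"
  shows "0 \<le> m" "integrable \<mu> (\<lambda>x. x)" "(\<integral>\<^sup>+x. ennreal x \<partial>\<mu>) = ennreal m"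
    and "integrable \<mu> (\<lambda>x. x ^ 3)" "(LINT x|\<mu>. x ^ 3) \<le> m ^ 3" "AE x in \<mu>. x \<le> m"
proof -
  note sp = int_measure_space[OF \<mu>] and st = int_measure_sets[OF \<mu>]
  have meas: "(\<lambda>x. x) \<in> borel_measurable \<mu>" "(\<lambda>x. x ^ 3) \<in> borel_measurable \<mu>"
    unfolding measurable_cong_sets[OF st refl] by (auto intro!: measurable_restrict_space1)
  have nn: "AE x in \<mu>. 0 \<le> x" by (rule AE_I2) (simp add: sp)
  show int: "integrable \<mu> (\<lambda>x. x)"
    by (rule integrableI_nonneg) (use meas nn fin in auto)
  show m0: "0 \<le> m" unfolding m_def by (rule integral_nonneg_AE[OF nn])
  show mean: "(\<integral>\<^sup>+x. ennreal x \<partial>\<mu>) = ennreal m"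
    unfolding m_def by (rule nn_integral_eq_integral[OF int nn])
  have null: "emeasure \<mu> {m + 1 / real (Suc j) ..} = 0" for j
  proof (rule ccontr)
    let ?A = "{m + 1 / real (Suc j) ..}"
    assume ne: "emeasure \<mu> ?A \<noteq> 0"
    have pos: "0 < m + 1 / real (Suc j)" using m0 by (simp add: add_nonneg_pos)
    have A: "?A \<in> sets \<mu>" unfolding st sets_pos_borel_iff using pos by auto
    have "ennreal (m + 1 / real (Suc j)) * 1 \<le> ennreal (m + 1 / real (Suc j)) * emeasure \<mu> ?A"
      by (intro mult_left_mono int_measure_ge_1[OF \<mu> A ne]) auto
    also have "\<dots> = (\<integral>\<^sup>+x. ennreal (m + 1 / real (Suc j)) * indicator ?A x \<partial>\<mu>)"
      using A by (simp add: nn_integral_cmult_indicator)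
    also have "\<dots> \<le> (\<integral>\<^sup>+x. ennreal x \<partial>\<mu>)"
      by (intro nn_integral_mono) (auto simp: indicator_def intro!: ennreal_leI)
    finally have "m + 1 / real (Suc j) \<le> m" using mean m0 by simp
    then show False by simp
  qed
  have "(\<Union>j. {m + 1 / real (Suc j) ..}) \<in> null_sets \<mu>"
  proof (rule null_sets_UN)
    fix j
    have "0 < m + 1 / real (Suc j)" using m0 by (simp add: add_nonneg_pos)
    then have "{m + 1 / real (Suc j) ..} \<in> sets \<mu>" unfolding st sets_pos_borel_iff by auto
    then show "{m + 1 / real (Suc j) ..} \<in> null_sets \<mu>" by (rule null_setsI[OF null])
  qed
  then show ae: "AE x in \<mu>. x \<le> m"
  proof (rule AE_I')
    show "{x \<in> space \<mu>. \<not> x \<le> m} \<subseteq> (\<Union>j. {m + 1 / real (Suc j) ..})"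
    proof
      fix x assume "x \<in> {x \<in> space \<mu>. \<not> x \<le> m}"
      then have "0 < x - m" by simp
      then obtain j where "1 / real (Suc j) < x - m" using nat_approx_posE by (metis of_nat_Suc)
      then show "x \<in> (\<Union>j. {m + 1 / real (Suc j) ..})" by (intro UN_I[of j]) auto
    qed
  qed
  have cube: "AE x in \<mu>. x ^ 3 \<le> m\<^sup>2 * x \<and> 0 \<le> x ^ 3"
    using ae nn
  proof eventually_elim
    case (elim x)
    then have "x\<^sup>2 * x \<le> m\<^sup>2 * x" by (intro mult_right_mono power_mono) auto
    then show ?case using elim by (simp add: eval_nat_numeral)
  qed
  show int3: "integrable \<mu> (\<lambda>x. x ^ 3)"
  proof (rule Bochner_Integration.integrable_bound)
    show "integrable \<mu> (\<lambda>x. m\<^sup>2 * x)" using int by simp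
    show "AE x in \<mu>. norm (x ^ 3) \<le> norm (m\<^sup>2 * x)" using cube by eventually_elim auto
  qed (rule meas)
  have "(LINT x|\<mu>. x ^ 3) \<le> (LINT x|\<mu>. m\<^sup>2 * x)"
    by (rule integral_mono_AE) (use int int3 cube in auto)
  also have "\<dots> = m ^ 3" by (simp add: m_def[symmetric] eval_nat_numeral)
  finally show "(LINT x|\<mu>. x ^ 3) \<le> m ^ 3" .
qed

section \<open>The rate as a function of the first and third moments\<close>

definition rate_value :: "real \<Rightarrow> real \<Rightarrow> real \<Rightarrow> real" where
  "rate_value \<theta> m s = \<theta> ^ 3 / 6 + (max 0 (m - \<theta>)) ^ 3 / 6 - s / 24"

lemma rate_function_eq:
  assumes "(\<integral>\<^sup>+x. ennreal x \<partial>\<mu>) < \<infinity>"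
  shows "rate_function \<theta> \<mu> = ereal (rate_value \<theta> (LINT x|\<mu>. x) (LINT x|\<mu>. x ^ 3))"
  using assms by (auto simp: rate_function_def rate_value_def max_def)

text \<open>For \<open>\<theta> \<le> m\<close> this is the completed square; for
  \<open>m < \<theta>\<close> one has \<open>s \<le> m ^ 3 \<le> \<theta> ^ 3\<close>, and
  \<open>1/24 < 1/6\<close>.\<close>

lemma rate_value_nonneg:
  assumes "0 \<le> m" "s \<le> m ^ 3"
  shows "0 \<le> rate_value \<theta> m s"
proof (cases "\<theta> \<le> m")
  case True
  have "rate_value \<theta> m s = m * (m - 2 * \<theta>)\<^sup>2 / 8 + (m ^ 3 - s) / 24"
    using True by (simp add: rate_value_def max_def field_simps eval_nat_numeral)
  moreover have "0 \<le> m * (m - 2 * \<theta>)\<^sup>2 / 8" "0 \<le> (m ^ 3 - s) / 24" using assms by auto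
  ultimately show ?thesis by linarith
next
  case False
  then have "m ^ 3 \<le> \<theta> ^ 3" using assms by (intro power_mono) auto
  moreover have "0 \<le> \<theta> ^ 3" using False assms by simp
  ultimately have "0 \<le> \<theta> ^ 3 / 6 - s / 24" using assms by linarith
  then show ?thesis using False by (simp add: rate_value_def)
qed

lemma rate_function_nonneg:
  assumes "\<mu> \<in> int_measures"
  shows "0 \<le> rate_function \<theta> \<mu>"
proof (cases "(\<integral>\<^sup>+x. ennreal x \<partial>\<mu>) < \<infinity>")
  case True
  then show ?thesis
    unfolding rate_function_eq[OF True]
    using rate_value_nonneg[OF int_measure_mean(1)[OF assms True] int_measure_mean(5)[OF assms True]] by simp
next
  case False
  then show ?thesis by (simp add: rate_function_def)
qed

text \<open>By continuity from above, every point of \<open>C\<close> that is not an atom has a ball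
  whose part in \<open>C\<close> has measure below one, hence zero. The Lindelof property reduces
  the cover by such balls to a countable one.\<close>

lemma int_measure_no_atoms:
  assumes \<mu>: "\<mu> \<in> int_measures" and C: "C \<in> sets \<mu>" and fin: "emeasure \<mu> C \<noteq> \<infinity>"
    and na: "\<And>x. x \<in> C \<Longrightarrow> emeasure \<mu> {x} = 0"
  shows "emeasure \<mu> C = 0"
proof -
  note st = int_measure_sets[OF \<mu>]
  have CU: "C \<inter> U \<in> sets \<mu>" if "U \<in> sets borel" for U
    using C that unfolding st sets_pos_borel_iff by auto
  define F where "F = {U::real set. open U \<and> emeasure \<mu> (C \<inter> U) = 0}"
  have cover: "C \<subseteq> \<Union>F"
  proof
    fix x assume x: "x \<in> C"
    let ?A = "\<lambda>j. C \<inter> ball x (1 / real (Suc j))"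
    have "(\<lambda>j. emeasure \<mu> (?A j)) \<longlonglongrightarrow> emeasure \<mu> (\<Inter>j. ?A j)"
    proof (rule Lim_emeasure_decseq)
      show "range ?A \<subseteq> sets \<mu>" using CU by auto
      show "decseq ?A"
        by (intro decseq_SucI Int_mono subset_ball) (auto simp: frac_le)
      fix j
      have "emeasure \<mu> (?A j) \<le> emeasure \<mu> C" by (rule emeasure_mono) (use C in auto)
      then show "emeasure \<mu> (?A j) \<noteq> \<infinity>" using fin by (auto simp: top_unique)
    qed
    moreover have "(\<Inter>j. ?A j) = {x}"
    proof -
      have "y = x" if "\<forall>j. y \<in> ball x (1 / real (Suc j))" for y
      proof (rule ccontr)
        assume "y \<noteq> x"
        then have "0 < dist x y" by simp
        then obtain j where "1 / real (Suc j) < dist x y" using nat_approx_posE by (metis of_nat_Suc)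
        then show False using that[rule_format, of j] by simp
      qed
      then show ?thesis using x by auto
    qed
    ultimately have "(\<lambda>j. emeasure \<mu> (?A j)) \<longlonglongrightarrow> 0" using na[OF x] by simp
    then have "\<forall>\<^sub>F j in sequentially. emeasure \<mu> (?A j) < 1" by (rule order_tendstoD(2)) simp
    then obtain j where j: "emeasure \<mu> (?A j) < 1" by (auto simp: eventually_sequentially)
    have "emeasure \<mu> (?A j) = 0"
      using int_measure_ge_1[OF \<mu> CU, of "ball x (1 / real (Suc j))"] j by (auto simp: not_le[symmetric])
    then have "ball x (1 / real (Suc j)) \<in> F" by (simp add: F_def)
    moreover have "x \<in> ball x (1 / real (Suc j))" by simp
    ultimately show "x \<in> \<Union>F" by blast
  qed
  obtain F' where F': "F' \<subseteq> F" "countable F'" "\<Union>F' = \<Union>F"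
    using Lindelof[of F] by (auto simp: F_def)
  have "(\<Union>U\<in>F'. C \<inter> U) \<in> null_sets \<mu>"
    by (rule null_sets_UN'[OF F'(2)]) (use F'(1) CU in \<open>auto simp: F_def intro!: null_setsI\<close>)
  moreover have "(\<Union>U\<in>F'. C \<inter> U) = C" using cover F'(3) by auto
  ultimately show ?thesis by (auto simp: null_sets_def)
qed

text \<open>Each atom weighs at least one, so there are finitely many above \<alpha>, and their
  complement is null by \<open>int_measure_no_atoms\<close>. The list repeats each atom according to
  its weight.\<close>

lemma int_measure_atoms:
  assumes \<mu>: "\<mu> \<in> int_measures" and \<alpha>: "0 < \<alpha>" and fin: "emeasure \<mu> {\<alpha>..} < \<infinity>"
  shows "\<exists>xs. (\<forall>x\<in>set xs. \<alpha> \<le> x) \<and>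
    (\<forall>g::real \<Rightarrow> real. integrable \<mu> (\<lambda>x. indicator {\<alpha>..} x * g x) \<longrightarrow> (LINT x|\<mu>. indicator {\<alpha>..} x * g x) = sum_list (map g xs))"
proof -
  note st = int_measure_sets[OF \<mu>]
  let ?B = "{\<alpha>..}"
  have B: "?B \<in> sets \<mu>" unfolding st sets_pos_borel_iff using \<alpha> by auto
  have sing: "{x} \<in> sets \<mu>" if "x \<in> ?B" for x unfolding st sets_pos_borel_iff using \<alpha> that by auto
  define At where "At = {x \<in> ?B. emeasure \<mu> {x} \<noteq> 0}"
  have finsub: "emeasure \<mu> A < \<infinity>" if "A \<subseteq> ?B" for A
    using emeasure_mono[OF that B] fin by (rule le_less_trans)
  obtain M where M: "emeasure \<mu> ?B = of_nat M"
  proof -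
    have "emeasure \<mu> ?B \<in> range of_nat \<union> {\<infinity>}" using \<mu> B by (auto simp: int_measures_def)
    then show ?thesis using fin that by auto
  qed
  have finAt: "finite At"
  proof -
    have "card G \<le> M" if G: "G \<subseteq> At" "finite G" for G
    proof -
      have "of_nat (card G) = (\<Sum>x\<in>G. 1 :: ennreal)" by simp
      also have "\<dots> \<le> (\<Sum>x\<in>G. emeasure \<mu> {x})"
        using G sing by (intro sum_mono int_measure_ge_1[OF \<mu>]) (auto simp: At_def)
      also have "\<dots> = emeasure \<mu> G"
        by (rule emeasure_eq_sum_singleton[symmetric]) (use G sing in \<open>auto simp: At_def\<close>)
      also have "\<dots> \<le> emeasure \<mu> ?B" by (rule emeasure_mono) (use G B in \<open>auto simp: At_def\<close>)
      finally show ?thesis unfolding M by simp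
    qed
    then show ?thesis using finite_if_finite_subsets_card_bdd[of At M] by blast
  qed
  have Ats: "At \<in> sets \<mu>" unfolding st sets_pos_borel_iff
    using finAt \<alpha> by (auto simp: At_def intro: finite_imp_closed borel_closed)
  have null: "?B - At \<in> null_sets \<mu>"
  proof (rule null_setsI)
    show "emeasure \<mu> (?B - At) = 0"
      by (rule int_measure_no_atoms[OF \<mu>]) (use B Ats finsub[of "?B - At"] in \<open>auto simp: At_def\<close>)
  qed (use B Ats in auto)
  have "\<exists>c. emeasure \<mu> {x} = of_nat c" if "x \<in> At" for x
  proof -
    have "emeasure \<mu> {x} \<in> range of_nat \<union> {\<infinity>}" using \<mu> sing that by (auto simp: int_measures_def At_def)
    then show ?thesis using finsub[of "{x}"] that by (auto simp: At_def)
  qed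
  then obtain c where c: "\<And>x. x \<in> At \<Longrightarrow> emeasure \<mu> {x} = of_nat (c x)" by metis
  define ys where "ys = sorted_list_of_set At"
  have ys: "set ys = At" "distinct ys" using finAt by (auto simp: ys_def)
  define xs where "xs = concat (map (\<lambda>x. replicate (c x) x) ys)"
  have sl: "sum_list (map g xs) = (\<Sum>x\<in>At. real (c x) * g x)" for g :: "real \<Rightarrow> real"
  proof -
    have "sum_list (map g (concat (map (\<lambda>x. replicate (c x) x) zs))) = sum_list (map (\<lambda>x. real (c x) * g x) zs)" for zs
      by (induction zs) (auto simp: sum_list_replicate)
    from this[of ys] show ?thesis
      unfolding xs_def using sum_list_distinct_conv_sum_set[OF ys(2), of "\<lambda>x. real (c x) * g x"] ys(1) by simp
  qed
  show ?thesis
  proof (intro exI[of _ xs] conjI allI impI)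
    show "\<forall>x\<in>set xs. \<alpha> \<le> x" by (auto simp: xs_def ys At_def)
    fix g :: "real \<Rightarrow> real" assume gi: "integrable \<mu> (\<lambda>x. indicator ?B x * g x)"
    have ind: "integrable \<mu> (\<lambda>x. indicator {y} x :: real)" if "y \<in> At" for y
      using sing[of y] finsub[of "{y}"] that by (auto simp: At_def intro!: integrable_real_indicator)
    have ae: "AE x in \<mu>. indicator ?B x * g x = (\<Sum>y\<in>At. g y * indicator {y} x)"
    proof (rule AE_I'[OF null])
      show "{x \<in> space \<mu>. \<not> indicator ?B x * g x = (\<Sum>y\<in>At. g y * indicator {y} x)} \<subseteq> ?B - At"
      proof
        fix x assume x: "x \<in> {x \<in> space \<mu>. \<not> indicator ?B x * g x = (\<Sum>y\<in>At. g y * indicator {y} x)}"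
        have s: "(\<Sum>y\<in>At. g y * indicator {y} x) = (if x \<in> At then g x else 0)"
          using finAt by (auto simp: indicator_def sum.delta' if_distrib cong: if_cong)
        show "x \<in> ?B - At"
          using x unfolding mem_Collect_eq s by (cases "x \<in> At"; cases "x \<in> ?B") (auto simp: At_def)
      qed
    qed
    have "(LINT x|\<mu>. indicator ?B x * g x) = (LINT x|\<mu>. (\<Sum>y\<in>At. g y * indicator {y} x))"
      by (rule integral_cong_AE[OF _ _ ae]) (use gi ind in \<open>auto intro!: borel_measurable_sum borel_measurable_times\<close>)
    also have "\<dots> = (\<Sum>y\<in>At. g y * measure \<mu> {y})"
      using ind int_measure_space[OF \<mu>] \<alpha> by (subst Bochner_Integration.integral_sum) (auto simp: At_def intro!: sum.cong arg_cong[where f = "measure \<mu>"])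
    also have "\<dots> = (\<Sum>y\<in>At. real (c y) * g y)"
      by (intro sum.cong refl) (simp add: measure_def c)
    finally show "(LINT x|\<mu>. indicator ?B x * g x) = sum_list (map g xs)" by (simp add: sl)
  qed
qed

text \<open>Limits of rescaled sizes may be zero; such entries correspond to no atom in
  \<open>(0,\<infinity>)\<close> and are left out of the index set. They do not contribute to the
  sums of first and third powers either.\<close>

lemma atomic_measure_sequence:
  fixes x :: "nat \<Rightarrow> real"
  assumes x0: "\<And>i. 0 \<le> x i" and sm: "summable x"
  defines "\<mu> \<equiv> atomic_measure {i. 0 < x i} x"
  shows "\<mu> \<in> int_measures"
    and "f \<in> test_functions \<Longrightarrow> (LINT y|\<mu>. f y) = (\<Sum>i | 0 < x i \<and> f (x i) \<noteq> 0. f (x i))"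
    and "(\<integral>\<^sup>+y. ennreal y \<partial>\<mu>) < \<infinity>" "(LINT y|\<mu>. y) = suminf x"
    and "summable (\<lambda>i. x i ^ 3)" "(LINT y|\<mu>. y ^ 3) = (\<Sum>i. x i ^ 3)"
proof -
  let ?I = "{i. 0 < x i}"
  have xI: "x \<in> ?I \<rightarrow> {0<..}" by auto
  have fin: "finite {i \<in> ?I. \<alpha> \<le> x i}" if "0 < \<alpha>" for \<alpha>
  proof -
    have "\<forall>\<^sub>F i in sequentially. x i < \<alpha>" by (rule order_tendstoD(2)[OF summable_LIMSEQ_zero[OF sm] that])
    then obtain n where n: "\<And>i. n \<le> i \<Longrightarrow> x i < \<alpha>" by (auto simp: eventually_sequentially)
    have "i < n" if "\<alpha> \<le> x i" for i
    proof (rule ccontr)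
      assume "\<not> i < n"
      then have "x i < \<alpha>" by (intro n) simp
      then show False using that by simp
    qed
    then have "{i \<in> ?I. \<alpha> \<le> x i} \<subseteq> {..<n}" by auto
    then show ?thesis using finite_subset by blast
  qed
  show "\<mu> \<in> int_measures" unfolding \<mu>_def by (rule atomic_measure_int_measures(1)[OF xI fin])
  show "(LINT y|\<mu>. f y) = (\<Sum>i | 0 < x i \<and> f (x i) \<noteq> 0. f (x i))" if "f \<in> test_functions"
    using atomic_measure_int_measures(2)[OF xI fin that] by (simp add: \<mu>_def)
  note m = atomic_measurable[OF xI]
  have restr: "count_space ?I = restrict_space (count_space UNIV) ?I" by (simp add: restrict_count_space)
  have I: "(LINT y|\<mu>. g y) = (\<Sum>i. g (x i))"
    if g: "g \<in> borel_measurable pos_borel" "g 0 = 0" and s: "summable (\<lambda>i. norm (g (x i)))" for g :: "real \<Rightarrow> real"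
  proof -
    have eq: "indicator ?I i *\<^sub>R g (x i) = g (x i)" for i
      using x0[of i] g(2) by (cases "x i = 0") (auto simp: indicator_def)
    have "(LINT y|\<mu>. g y) = (LINT i|count_space ?I. g (x i))"
      unfolding \<mu>_def atomic_measure_def by (rule integral_distr[OF m g(1)])
    also have "\<dots> = (LINT i|count_space UNIV. indicator ?I i *\<^sub>R g (x i))"
      unfolding restr by (rule integral_restrict_space) simp
    also have "\<dots> = (LINT i|count_space UNIV. g (x i))" by (simp only: eq)
    also have "\<dots> = (\<Sum>i. g (x i))"
      by (rule integral_count_space_nat) (use s in \<open>simp add: integrable_count_space_nat_iff\<close>)
    finally show ?thesis .
  qed
  have idm: "(\<lambda>y. y) \<in> borel_measurable pos_borel" "(\<lambda>y. y ^ 3) \<in> borel_measurable pos_borel"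
    by (auto intro!: measurable_restrict_space1)
  show "(LINT y|\<mu>. y) = suminf x" by (rule I) (use idm sm x0 in auto)
  have tot: "x i \<le> suminf x" for i using sum_le_suminf[OF sm, of "{i}"] x0 by simp
  show s3: "summable (\<lambda>i. x i ^ 3)"
  proof (rule summable_comparison_test')
    show "summable (\<lambda>i. (suminf x)\<^sup>2 * x i)" using sm by (rule summable_mult)
    fix i :: nat
    have "(x i)\<^sup>2 * x i \<le> (suminf x)\<^sup>2 * x i" using tot x0 by (intro mult_right_mono power_mono) auto
    then show "norm (x i ^ 3) \<le> (suminf x)\<^sup>2 * x i" using x0[of i] by (simp add: eval_nat_numeral)
  qed
  show "(LINT y|\<mu>. y ^ 3) = (\<Sum>i. x i ^ 3)" by (rule I) (use idm s3 x0 in auto)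
  have "(\<integral>\<^sup>+y. ennreal y \<partial>\<mu>) = (\<integral>\<^sup>+i. ennreal (x i) \<partial>count_space ?I)"
    unfolding \<mu>_def atomic_measure_def using idm by (subst nn_integral_distr[OF m]) auto
  also have "\<dots> \<le> (\<integral>\<^sup>+i. ennreal (x i) \<partial>count_space UNIV)"
    unfolding restr by (subst nn_integral_restrict_space) (auto intro!: nn_integral_mono simp: indicator_def)
  also have "\<dots> = (\<Sum>i. ennreal (x i))" by (rule nn_integral_count_space_nat)
  also have "\<dots> = ennreal (suminf x)" by (rule suminf_ennreal2) (use x0 sm in auto)
  also have "\<dots> < \<infinity>" by simp
  finally show "(\<integral>\<^sup>+y. ennreal y \<partial>\<mu>) < \<infinity>" .
qed

text \<open>Cantor's diagonal argument.\<close>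

lemma bounded_sequences_subsequence:
  fixes X :: "nat \<Rightarrow> nat \<Rightarrow> real"
  assumes "\<And>n i. \<bar>X n i\<bar> \<le> A i"
  shows "\<exists>r x. strict_mono r \<and> (\<forall>i. (\<lambda>n. X (r n) i) \<longlonglongrightarrow> x i)"
proof -
  interpret subseqs "\<lambda>i s. convergent (\<lambda>n. X (s n) i)"
  proof
    fix i :: nat and s :: "nat \<Rightarrow> nat" assume "strict_mono s"
    have "\<forall>n. X (s n) i \<in> {- A i .. A i}" using assms by (auto simp: abs_le_iff minus_le_iff)
    then obtain l r where "strict_mono r" "((\<lambda>n. X (s n) i) \<circ> r) \<longlonglongrightarrow> l"
      using compact_Icc[of "- A i" "A i"] unfolding compact_eq_seq_compact_metric seq_compact_def by metis
    then show "\<exists>r'. strict_mono r' \<and> convergent (\<lambda>n. X ((s \<circ> r') n) i)"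
      by (auto simp: convergent_def o_def)
  qed
  have "\<exists>l. (\<lambda>n. X (diagseq n) i) \<longlonglongrightarrow> l" for i
  proof -
    have "convergent (\<lambda>n. X ((diagseq \<circ> (+) (Suc i)) n) i)"
    proof (rule diagseq_holds)
      fix r s :: "nat \<Rightarrow> nat" and j assume "strict_mono r" "convergent (\<lambda>n. X (s n) j)"
      then show "convergent (\<lambda>n. X ((s \<circ> r) n) j)"
        using convergent_subseq_convergent[of "\<lambda>n. X (s n) j" r] by (simp add: o_def)
    qed
    then obtain l where "(\<lambda>n. X (diagseq (n + Suc i)) i) \<longlonglongrightarrow> l" by (auto simp: convergent_def add.commute o_def)
    then show ?thesis using LIMSEQ_offset[of "\<lambda>n. X (diagseq n) i"] by blast
  qed
  then show ?thesis using subseq_diagseq by metis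
qed

section \<open>The large deviation bounds\<close>

lemma rate_value_mono:
  assumes "m \<le> m'" "s' \<le> s"
  shows "rate_value \<theta> m s \<le> rate_value \<theta> m' s'"
proof -
  have "(max 0 (m - \<theta>)) ^ 3 \<le> (max 0 (m' - \<theta>)) ^ 3" using assms by (intro power_mono) auto
  then show ?thesis using assms unfolding rate_value_def by linarith
qed

lemma sum_count_list_real:
  fixes g :: "nat \<Rightarrow> real"
  assumes "set ys \<subseteq> {1..n}"
  shows "(\<Sum>k=1..n. real (count_list ys k) * g k) = sum_list (map g ys)"
  using assms
proof (induction ys)
  case (Cons y ys)
  have "(\<Sum>k=1..n. real (count_list (y # ys) k) * g k) = (\<Sum>k=1..n. real (count_list ys k) * g k + (if k = y then g y else 0))"
    by (intro sum.cong) (auto simp: algebra_simps)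
  then show ?case using Cons by (simp add: sum.distrib)
qed simp

text \<open>Compactness together with lower semicontinuity. Decreasing rows of mass at most
  \<open>A\<close> satisfy \<open>X j i \<le> A / (i + 1)\<close>, so a subsequence converges in
  every coordinate and, since a test function sees only finitely many coordinates, also vaguely.
  Cubes pass to the limit without loss, whereas mass can be lost to dust; the rate is increasing in
  the mass, so it can only drop.\<close>

lemma vague_closed_limit:
  fixes X :: "nat \<Rightarrow> nat \<Rightarrow> real" and len :: "nat \<Rightarrow> nat"
  assumes X0: "\<And>j i. 0 \<le> X j i" and dec: "\<And>j i i'. i \<le> i' \<Longrightarrow> X j i' \<le> X j i" and len: "\<And>j i. len j \<le> i \<Longrightarrow> X j i = 0"
    and mass: "\<And>j. (\<Sum>i<len j. X j i) \<le> A"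
    and rate: "\<And>\<eta>. 0 < \<eta> \<Longrightarrow> \<forall>\<^sub>F j in sequentially. rate_value \<theta> (\<Sum>i<len j. X j i) (\<Sum>i<len j. X j i ^ 3) \<le> c + \<eta>"
    and F: "closedin vague_topology F" and \<nu>: "\<And>j. \<nu> j \<in> F"
    and int: "\<And>f. f \<in> test_functions \<Longrightarrow>
      \<forall>\<^sub>F j in sequentially. (LINT y|\<nu> j. f y) = (\<Sum>i<len j. if 0 < X j i then f (X j i) else 0)"
  shows "\<exists>\<mu>\<in>F. rate_function \<theta> \<mu> \<le> ereal c"
proof -
  define M where "M j = (\<Sum>i<len j. X j i)" for j
  have part: "(\<Sum>i<I. X j i) \<le> M j" for j I
  proof -
    have "(\<Sum>i<I. X j i) \<le> (\<Sum>i<max I (len j). X j i)" by (rule sum_mono2) (use X0 in auto)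
    also have "\<dots> = M j" unfolding M_def by (rule sum.mono_neutral_right) (use len in auto)
    finally show ?thesis .
  qed
  have M0: "0 \<le> M j" for j unfolding M_def by (intro sum_nonneg X0)
  have MA: "M j \<le> A" for j using mass by (simp add: M_def)
  have A0: "0 \<le> A" using M0[of 0] MA[of 0] by linarith
  have XA: "X j i \<le> A / real (Suc i)" for j i
  proof -
    have "real (Suc i) * X j i = (\<Sum>i'<Suc i. X j i)" by simp
    also have "\<dots> \<le> (\<Sum>i'<Suc i. X j i')" by (rule sum_mono) (use dec in auto)
    also have "\<dots> \<le> A" using part[of j "Suc i"] MA[of j] by linarith
    finally show ?thesis by (simp add: pos_le_divide_eq mult.commute del: of_nat_Suc)
  qed
  have XA': "X j i \<le> A / real (Suc I)" if "I \<le> i" for j i I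
  proof -
    have "A / real (Suc i) \<le> A / real (Suc I)" using that A0 by (intro divide_left_mono) auto
    then show ?thesis using XA[of j i] by linarith
  qed
  \<comment> \<open>The total mass becomes an additional coordinate, because its limit is not
    determined by the limits of the sizes.\<close>
  define Y where "Y j i = (case i of 0 \<Rightarrow> M j | Suc i' \<Rightarrow> X j i')" for j i
  have "\<bar>Y j i\<bar> \<le> A" for j i
  proof (cases i)
    case 0
    then show ?thesis using M0 MA by (simp add: Y_def)
  next
    case (Suc i')
    have "X j i' \<le> A" using XA'[of 0 i' j] by simp
    then show ?thesis using X0 Suc by (simp add: Y_def)
  qed
  then obtain r y where r: "strict_mono r" and y: "\<And>i. (\<lambda>j. Y (r j) i) \<longlonglongrightarrow> y i"
    using bounded_sequences_subsequence[of Y "\<lambda>_. A"] by blast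
  define x where "x i = y (Suc i)" for i
  have x: "(\<lambda>j. X (r j) i) \<longlonglongrightarrow> x i" for i using y[of "Suc i"] by (simp add: Y_def x_def)
  have mlim: "(\<lambda>j. M (r j)) \<longlonglongrightarrow> y 0" using y[of 0] by (simp add: Y_def)
  have x0: "0 \<le> x i" for i by (rule tendsto_lowerbound[OF x]) (auto simp: X0)
  have xpart: "(\<Sum>i<I. x i) \<le> y 0" for I
    by (rule tendsto_le[OF _ mlim tendsto_sum[OF x]]) (auto simp: part)
  have sx: "summable x" by (rule summableI_nonneg_bounded[OF x0 xpart])
  have xm: "suminf x \<le> y 0" by (rule suminf_le_const[OF sx xpart])
  define \<mu> where "\<mu> = atomic_measure {i. 0 < x i} x"
  note mu = atomic_measure_sequence[OF x0 sx, folded \<mu>_def]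
  have conv: "(\<lambda>j. LINT y|\<nu> (r j). f y) \<longlonglongrightarrow> (LINT y|\<mu>. f y)" if f: "f \<in> test_functions" for f
  proof -
    obtain \<alpha> where \<alpha>: "0 < \<alpha>" "\<And>x. 0 < x \<Longrightarrow> x < \<alpha> \<Longrightarrow> f x = 0" using test_function_support[OF f] by blast
    let ?F = "\<lambda>x. if 0 < x then f x else 0"
    obtain I where I: "A / real (Suc I) < \<alpha>"
    proof -
      obtain I where "A / \<alpha> < real I" using reals_Archimedean2 by blast
      then have "A < real I * \<alpha>" using \<alpha> by (simp add: pos_divide_less_eq)
      also have "\<dots> \<le> real (Suc I) * \<alpha>" using \<alpha> by (intro mult_right_mono) auto
      finally have "A / real (Suc I) < \<alpha>" by (simp add: pos_divide_less_eq mult.commute del: of_nat_Suc)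
      then show ?thesis by (rule that)
    qed
    have FX: "?F (X j i) = 0" if "I \<le> i" for i j
      using XA'[OF that, of j] I \<alpha>(2)[of "X j i"] by auto
    have xI: "x i \<le> A / real (Suc I)" if "I \<le> i" for i
      by (rule tendsto_upperbound[OF x]) (use XA'[OF that] in auto)
    have "(\<Sum>i<len j. ?F (X j i)) = (\<Sum>i<I. ?F (X j i))" for j
    proof -
      have "(\<Sum>i<len j. ?F (X j i)) = (\<Sum>i<max I (len j). ?F (X j i))"
        by (rule sum.mono_neutral_left) (use len in auto)
      also have "\<dots> = (\<Sum>i<I. ?F (X j i))" by (rule sum.mono_neutral_right) (use FX in auto)
      finally show ?thesis .
    qed
    moreover have "\<forall>\<^sub>F j in sequentially. (LINT y|\<nu> (r j). f y) = (\<Sum>i<len (r j). ?F (X (r j) i))"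
      by (rule eventually_subseq[OF r int[OF f]])
    ultimately have ev: "\<forall>\<^sub>F j in sequentially. (\<Sum>i<I. ?F (X (r j) i)) = (LINT y|\<nu> (r j). f y)"
      by (auto elim: eventually_mono)
    have "(\<lambda>j. \<Sum>i<I. ?F (X (r j) i)) \<longlonglongrightarrow> (\<Sum>i<I. ?F (x i))"
      by (intro tendsto_sum isCont_tendsto_compose[OF test_function_extension[OF f]] x)
    moreover have "(\<Sum>i<I. ?F (x i)) = (LINT y|\<mu>. f y)"
    proof -
      have "{i. 0 < x i \<and> f (x i) \<noteq> 0} \<subseteq> {..<I}"
      proof
        fix i assume i: "i \<in> {i. 0 < x i \<and> f (x i) \<noteq> 0}"
        then have "\<not> x i < \<alpha>" using \<alpha>(2) by auto
        then show "i \<in> {..<I}" using xI[of i] I by (cases "I \<le> i") auto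
      qed
      then have "(\<Sum>i | 0 < x i \<and> f (x i) \<noteq> 0. f (x i)) = (\<Sum>i<I. ?F (x i))"
        by (intro sum.mono_neutral_cong_left) auto
      then show ?thesis using mu(2)[OF f] by simp
    qed
    ultimately show ?thesis using Lim_transform_eventually[OF _ ev] by simp
  qed
  have "\<mu> \<in> F"
  proof (rule ccontr)
    assume "\<mu> \<notin> F"
    then have "\<mu> \<in> topspace vague_topology - F" using mu(1) by (simp add: topspace_vague)
    moreover have "openin vague_topology (topspace vague_topology - F)" using F by blast
    ultimately obtain T d where T: "finite T" "T \<subseteq> test_functions" "0 < d"
      "\<forall>\<nu>\<in>int_measures. (\<forall>f\<in>T. \<bar>(LINT x|\<nu>. f x) - (LINT x|\<mu>. f x)\<bar> < d) \<longrightarrow> \<nu> \<in> topspace vague_topology - F"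
      using vague_neighbourhood by metis
    have "\<forall>\<^sub>F j in sequentially. \<forall>f\<in>T. \<bar>(LINT x|\<nu> (r j). f x) - (LINT x|\<mu>. f x)\<bar> < d"
    proof (rule eventually_ball_finite[OF T(1)], rule ballI)
      fix f assume "f \<in> T"
      then have "f \<in> test_functions" using T by auto
      from tendstoD[OF conv[OF this] T(3)] show "\<forall>\<^sub>F j in sequentially. \<bar>(LINT x|\<nu> (r j). f x) - (LINT x|\<mu>. f x)\<bar> < d"
        by (simp add: dist_real_def)
    qed
    then obtain j where j: "\<forall>f\<in>T. \<bar>(LINT x|\<nu> (r j). f x) - (LINT x|\<mu>. f x)\<bar> < d"
      by (auto simp: eventually_sequentially)
    have "\<nu> (r j) \<in> int_measures" using \<nu> closedin_subset[OF F] by (auto simp: topspace_vague)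
    then show False using T(4) j \<nu> by auto
  qed
  moreover have "rate_value \<theta> (suminf x) (\<Sum>i. x i ^ 3) \<le> c"
  proof -
    \<comment> \<open>Entries from index \<open>I\<close> on are at most \<open>A / (I + 1)\<close>,
      so their cubes add up to at most \<open>(A / (I + 1))\<^sup>2 * A\<close>. This bounds the
      tail uniformly in \<open>j\<close> before the limit in \<open>I\<close> is taken.\<close>
    have fix_I: "\<theta> ^ 3 / 6 + (max 0 (y 0 - \<theta>)) ^ 3 / 6 - ((\<Sum>i<I. x i ^ 3) + (A / real (Suc I))\<^sup>2 * A) / 24 \<le> c + \<eta>"
      if \<eta>: "0 < \<eta>" for I \<eta>
    proof (rule tendsto_upperbound)
      show "(\<lambda>j. \<theta> ^ 3 / 6 + (max 0 (M (r j) - \<theta>)) ^ 3 / 6 - ((\<Sum>i<I. X (r j) i ^ 3) + (A / real (Suc I))\<^sup>2 * A) / 24)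
        \<longlonglongrightarrow> \<theta> ^ 3 / 6 + (max 0 (y 0 - \<theta>)) ^ 3 / 6 - ((\<Sum>i<I. x i ^ 3) + (A / real (Suc I))\<^sup>2 * A) / 24"
        by (intro tendsto_intros mlim x) auto
      have "\<forall>\<^sub>F j in sequentially. rate_value \<theta> (\<Sum>i<len (r j). X (r j) i) (\<Sum>i<len (r j). X (r j) i ^ 3) \<le> c + \<eta>"
        by (rule eventually_subseq[OF r rate[OF \<eta>]])
      then show "\<forall>\<^sub>F j in sequentially. \<theta> ^ 3 / 6 + (max 0 (M (r j) - \<theta>)) ^ 3 / 6 - ((\<Sum>i<I. X (r j) i ^ 3) + (A / real (Suc I))\<^sup>2 * A) / 24 \<le> c + \<eta>"
      proof eventually_elim
        case (elim j)
        let ?k = "r j"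
        have "(\<Sum>i<len ?k. X ?k i ^ 3) \<le> (\<Sum>i<len ?k. (if i < I then X ?k i ^ 3 else 0) + (A / real (Suc I))\<^sup>2 * X ?k i)"
        proof (rule sum_mono)
          fix i
          show "X ?k i ^ 3 \<le> (if i < I then X ?k i ^ 3 else 0) + (A / real (Suc I))\<^sup>2 * X ?k i"
          proof (cases "i < I")
            case True
            then show ?thesis using X0 by simp
          next
            case False
            then have "(X ?k i)\<^sup>2 \<le> (A / real (Suc I))\<^sup>2" using XA'[of I i ?k] X0 by (intro power_mono) auto
            then have "(X ?k i)\<^sup>2 * X ?k i \<le> (A / real (Suc I))\<^sup>2 * X ?k i" using X0 by (intro mult_right_mono) auto
            then show ?thesis using False by (simp add: eval_nat_numeral)
          qed
        qed
        also have "\<dots> = (\<Sum>i<len ?k. if i < I then X ?k i ^ 3 else 0) + (A / real (Suc I))\<^sup>2 * M ?k"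
          by (simp add: sum.distrib sum_distrib_left M_def)
        also have "(\<Sum>i<len ?k. if i < I then X ?k i ^ 3 else 0) \<le> (\<Sum>i<max I (len ?k). if i < I then X ?k i ^ 3 else 0)"
          by (rule sum_mono2) (use X0 in auto)
        also have "\<dots> = (\<Sum>i<I. X ?k i ^ 3)" by (rule sum.mono_neutral_cong_right) auto
        also have "(A / real (Suc I))\<^sup>2 * M ?k \<le> (A / real (Suc I))\<^sup>2 * A" using MA by (intro mult_left_mono) auto
        finally have cubes: "(\<Sum>i<len ?k. X ?k i ^ 3) \<le> (\<Sum>i<I. X ?k i ^ 3) + (A / real (Suc I))\<^sup>2 * A" by simp
        have "u - w / 24 \<le> c + \<eta>" if "t \<le> w" "u - t / 24 \<le> c + \<eta>" for t u w :: real
          using that by linarith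
        from this[OF cubes] show ?case using elim unfolding rate_value_def M_def by blast
      qed
    qed simp
    have lim_I: "\<theta> ^ 3 / 6 + (max 0 (y 0 - \<theta>)) ^ 3 / 6 - (\<Sum>i. x i ^ 3) / 24 \<le> c + \<eta>" if \<eta>: "0 < \<eta>" for \<eta>
    proof (rule tendsto_upperbound)
      have z: "(\<lambda>I. A / real (Suc I)) \<longlonglongrightarrow> 0" by real_asymp
      have "(\<lambda>I. \<theta> ^ 3 / 6 + (max 0 (y 0 - \<theta>)) ^ 3 / 6 - ((\<Sum>i<I. x i ^ 3) + (A / real (Suc I))\<^sup>2 * A) / 24)
         \<longlonglongrightarrow> \<theta> ^ 3 / 6 + (max 0 (y 0 - \<theta>)) ^ 3 / 6 - ((\<Sum>i. x i ^ 3) + 0\<^sup>2 * A) / 24"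
        by (intro tendsto_intros z summable_LIMSEQ mu(5)) auto
      then show "(\<lambda>I. \<theta> ^ 3 / 6 + (max 0 (y 0 - \<theta>)) ^ 3 / 6 - ((\<Sum>i<I. x i ^ 3) + (A / real (Suc I))\<^sup>2 * A) / 24)
         \<longlonglongrightarrow> \<theta> ^ 3 / 6 + (max 0 (y 0 - \<theta>)) ^ 3 / 6 - (\<Sum>i. x i ^ 3) / 24" by simp
      show "\<forall>\<^sub>F I in sequentially. \<theta> ^ 3 / 6 + (max 0 (y 0 - \<theta>)) ^ 3 / 6 - ((\<Sum>i<I. x i ^ 3) + (A / real (Suc I))\<^sup>2 * A) / 24 \<le> c + \<eta>"
        by (rule always_eventually) (rule allI, rule fix_I[OF \<eta>])
    qed simp
    have "rate_value \<theta> (y 0) (\<Sum>i. x i ^ 3) \<le> c"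
      unfolding rate_value_def by (rule field_le_epsilon) (rule lim_I)
    \<comment> \<open>The limit measure has mass \<open>suminf x\<close>, at most the limit
      \<open>y 0\<close> of the masses.\<close>
    then show ?thesis using rate_value_mono[OF xm order.refl, of \<theta> "\<Sum>i. x i ^ 3"] by linarith
  qed
  then have "rate_function \<theta> \<mu> \<le> ereal c"
    unfolding rate_function_eq[OF mu(3)] mu(4) mu(6) by simp
  ultimately show ?thesis by blast
qed

text \<open>The atoms below a small level are replaced by dust that raises the total mass to \<open>\<theta>\<close> if it was
  smaller; then the graph outside of the prescribed components is not supercritical.\<close>

lemma vague_approximation:
  assumes \<mu>: "\<mu> \<in> int_measures" and fin: "(\<integral>\<^sup>+x. ennreal x \<partial>\<mu>) < \<infinity>" and e: "0 < e"
    and \<alpha>: "0 < \<alpha>" and T: "T \<subseteq> test_functions" "\<forall>f\<in>T. \<forall>x. 0 < x \<longrightarrow> x < \<alpha> \<longrightarrow> f x = 0"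
  shows "\<exists>zs. (\<forall>z\<in>set zs. 0 < z) \<and> \<theta> \<le> sum_list zs \<and>
    rate_value \<theta> (sum_list zs) (sum_list (map (\<lambda>z. z ^ 3) zs)) \<le> rate_value \<theta> (LINT x|\<mu>. x) (LINT x|\<mu>. x ^ 3) + e \<and>
    (\<forall>f\<in>T. sum_list (map f zs) = (LINT x|\<mu>. f x))"
proof -
  note mean = int_measure_mean[OF \<mu> fin]
  define m where "m = (LINT x|\<mu>. x)"
  have m0: "0 \<le> m" using mean(1) by (simp add: m_def)
  \<comment> \<open>Below \<alpha>, so that the functions in \<open>T\<close> ignore what is cut
    off; and so small that the discarded cubes, at most \<open>c\<^sup>2 * m \<le> 24 * e\<close>,
    change the rate by at most \<open>e\<close>.\<close>
  define c where "c = min (\<alpha> / 2) (min 1 (24 * e / (m + 1)))"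
  have c: "0 < c" "c < \<alpha>" "c \<le> 1" "c \<le> 24 * e / (m + 1)" using \<alpha> e m0 by (auto simp: c_def)
  have cm: "c\<^sup>2 * m \<le> 24 * e"
  proof -
    have "c\<^sup>2 * m \<le> c * (m + 1)" using c m0 by (intro mult_mono) (auto simp: power2_eq_square mult_left_le_one_le)
    also have "\<dots> \<le> 24 * e" using c(4) m0 by (simp add: pos_le_divide_eq)
    finally show ?thesis .
  qed
  let ?B = "{c..}"
  have st: "?B \<in> sets \<mu>" unfolding int_measure_sets[OF \<mu>] sets_pos_borel_iff using c by auto
  have "ennreal c * emeasure \<mu> ?B = (\<integral>\<^sup>+x. ennreal c * indicator ?B x \<partial>\<mu>)"
    using st by (simp add: nn_integral_cmult_indicator)
  also have "\<dots> \<le> (\<integral>\<^sup>+x. ennreal x \<partial>\<mu>)" by (intro nn_integral_mono) (auto simp: indicator_def intro!: ennreal_leI)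
  also note fin
  finally have "emeasure \<mu> ?B < \<infinity>" using c by (auto simp: ennreal_mult_less_top)
  then obtain xs where xs: "\<And>x. x \<in> set xs \<Longrightarrow> c \<le> x"
    "\<And>g::real \<Rightarrow> real. integrable \<mu> (\<lambda>x. indicator ?B x * g x) \<Longrightarrow> (LINT x|\<mu>. indicator ?B x * g x) = sum_list (map g xs)"
    using int_measure_atoms[OF \<mu> c(1)] by blast
  have int: "integrable \<mu> (\<lambda>x. indicator ?B x * g x)" if "integrable \<mu> g" for g :: "real \<Rightarrow> real"
    using integrable_real_mult_indicator[OF st that] by (simp add: mult.commute)
  have ae0: "AE x in \<mu>. 0 < x" by (rule AE_I2) (simp add: int_measure_space[OF \<mu>])
  have s1: "sum_list xs \<le> m"
  proof -
    have "sum_list xs = (LINT x|\<mu>. indicator ?B x * x)" using xs(2)[OF int[OF mean(2)]] by simp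
    also have "\<dots> \<le> m" unfolding m_def
      by (rule integral_mono_AE[OF int[OF mean(2)] mean(2)]) (use ae0 in eventually_elim, auto simp: indicator_def)
    finally show ?thesis .
  qed
  have s3: "(LINT x|\<mu>. x ^ 3) \<le> sum_list (map (\<lambda>z. z ^ 3) xs) + 24 * e"
  proof -
    have "(LINT x|\<mu>. x ^ 3) \<le> (LINT x|\<mu>. indicator ?B x * x ^ 3 + c\<^sup>2 * x)"
    proof (rule integral_mono_AE)
      show "AE x in \<mu>. x ^ 3 \<le> indicator ?B x * x ^ 3 + c\<^sup>2 * x"
        using ae0
      proof eventually_elim
        case (elim x)
        show ?case
        proof (cases "c \<le> x")
          case True
          then show ?thesis using elim by simp
        next
          case False
          then have "x\<^sup>2 * x \<le> c\<^sup>2 * x" using elim by (intro mult_right_mono power_mono) auto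
          then show ?thesis using False by (simp add: eval_nat_numeral)
        qed
      qed
    qed (use mean int[OF mean(4)] in auto)
    also have "\<dots> = sum_list (map (\<lambda>z. z ^ 3) xs) + c\<^sup>2 * m"
      using xs(2)[OF int[OF mean(4)]] int[OF mean(4)] mean(2) by (simp add: m_def)
    finally show ?thesis using cm by linarith
  qed
  have tf: "sum_list (map f xs) = (LINT x|\<mu>. f x)" if f: "f \<in> T" for f
  proof -
    have fi: "integrable \<mu> f" using \<mu> f T(1) by (auto simp: int_measures_def)
    have "(LINT x|\<mu>. indicator ?B x * f x) = (LINT x|\<mu>. f x)"
      by (rule integral_cong_AE) (use int[OF fi] fi ae0 bspec[OF T(2) f] c in \<open>auto elim!: eventually_mono simp: indicator_def\<close>)
    then show ?thesis using xs(2)[OF int[OF fi]] by simp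
  qed
  obtain zs where zs: "\<forall>z\<in>set zs. 0 < z" "sum_list zs = max \<theta> (sum_list xs)"
    "sum_list (map (\<lambda>z. z ^ 3) xs) \<le> sum_list (map (\<lambda>z. z ^ 3) zs)"
    "\<forall>f\<in>T. sum_list (map f zs) = sum_list (map f xs)"
  proof (cases "\<theta> \<le> sum_list xs")
    case True
    have "\<forall>z\<in>set xs. 0 < z" using xs(1) c(1) less_le_trans by blast
    then show ?thesis using True by (intro that[of xs]) auto
  next
    case False
    define g where "g = \<theta> - sum_list xs"
    have g: "0 < g" using False by (simp add: g_def)
    obtain k where k: "g / c < real k" using reals_Archimedean2 by blast
    have k0: "0 < real k" using k g c by (meson divide_pos_pos less_trans)
    define z where "z = g / real k"
    have z: "0 < z" "z < \<alpha>"
    proof -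
      show "0 < z" using g k0 by (simp add: z_def)
      have "z < c" using k k0 c by (simp add: z_def pos_divide_less_eq mult.commute)
      then show "z < \<alpha>" using c by simp
    qed
    show ?thesis
    proof (rule that[of "xs @ replicate k z"])
      show "\<forall>w\<in>set (xs @ replicate k z). 0 < w" using xs(1) c z by force
      show "sum_list (xs @ replicate k z) = max \<theta> (sum_list xs)"
        using False k0 by (simp add: sum_list_replicate z_def g_def)
      show "sum_list (map (\<lambda>z. z ^ 3) xs) \<le> sum_list (map (\<lambda>z. z ^ 3) (xs @ replicate k z))"
        using z by (simp add: sum_list_replicate)
      show "\<forall>f\<in>T. sum_list (map f (xs @ replicate k z)) = sum_list (map f xs)"
        using T(2) z by (simp add: sum_list_replicate)
    qed
  qed
  have "max 0 (sum_list zs - \<theta>) \<le> max 0 (m - \<theta>)" using zs(2) s1 by auto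
  then have "(max 0 (sum_list zs - \<theta>)) ^ 3 \<le> (max 0 (m - \<theta>)) ^ 3" by (intro power_mono) auto
  then have "rate_value \<theta> (sum_list zs) (sum_list (map (\<lambda>z. z ^ 3) zs)) \<le> rate_value \<theta> m (LINT x|\<mu>. x ^ 3) + e"
    using zs(3) s3 unfolding rate_value_def by linarith
  then show ?thesis using zs tf by (intro exI[of _ zs]) (auto simp: m_def)
qed

context critical_window
begin

text \<open>Suppose the bound fails infinitely often and take \<open>c'\<close> strictly between
  \<open>c\<close> and the infimum. The number of vectors is at most
  \<open>exp ((c' - c) * S n)\<close>, so infinitely often a single vector with image in
  \<open>F\<close> has probability at least \<open>exp (- (c' * S n))\<close>. By
  \<open>macro_bound\<close> these vectors have bounded mass and asymptotically rate at most
  \<open>c'\<close>; a limit point in \<open>F\<close> then has rate at most \<open>c'\<close>, a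
  contradiction.\<close>

lemma large_deviation_upper:
  assumes N: "(\<lambda>n. (real n - 1 / p n) / a n) \<longlonglongrightarrow> \<theta>"
    and ab: "\<forall>\<^sub>F n in sequentially. 0 < real n * b n \<and> a n = (real n * b n) powr (2/3)"
    and F: "closedin vague_topology F" and c: "ereal c < (INF \<mu>\<in>F. rate_function \<theta> \<mu>)"
  shows "\<forall>\<^sub>F n in sequentially. measure_pmf.prob (count_law n (p n)) {l. Me n (b n) l \<in> F} \<le> exp (- (c * S n))"
proof (rule ccontr)
  assume neg: "\<not> ?thesis"
  obtain c' where c': "ereal c < ereal c'" "ereal c' < (INF \<mu>\<in>F. rate_function \<theta> \<mu>)" using ereal_dense2[OF c] by blast
  then have cc: "c < c'" by simp
  obtain A where A: "\<And>\<eta>. 0 < \<eta> \<Longrightarrow> \<forall>\<^sub>F n in sequentially. \<forall>l\<in>partitions_of n.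
     exp (- (c' * S n)) \<le> pmf (count_law n (p n)) l \<longrightarrow>
     moment 1 (cutoff n) n (a n) l \<le> A \<and>
     \<theta> ^ 3 / 6 + (max 0 (moment 1 (cutoff n) n (a n) l - \<theta>)) ^ 3 / 6
       - moment 3 (cutoff n) n (a n) l / 24 \<le> c' + \<eta>"
    using macro_bound[OF N, of c'] by blast
  define good where "good n l \<longleftrightarrow> l \<in> partitions_of n \<and> Me n (b n) l \<in> F \<and> exp (- (c' * S n)) \<le> pmf (count_law n (p n)) l" for n l
  define ok where "ok n \<longleftrightarrow> 0 < a n \<and> 0 < real n * b n \<and> a n = (real n * b n) powr (2/3) \<and>
     (\<forall>l. good n l \<longrightarrow> moment 1 (cutoff n) n (a n) l \<le> A)" for n
  have ok: "\<forall>\<^sub>F n in sequentially. ok n"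
    using ab a_pos A[OF zero_less_one] by eventually_elim (auto simp: ok_def good_def)
  have cd: "\<forall>\<^sub>F n in sequentially. real (card (partitions_of n)) \<le> exp ((c' - c) * S n)"
    by (rule card_partitions_subexp[OF N]) (use cc in simp)
  have ex: "\<exists>l. good n l" if "\<not> measure_pmf.prob (count_law n (p n)) {l. Me n (b n) l \<in> F} \<le> exp (- (c * S n))"
    "real (card (partitions_of n)) \<le> exp ((c' - c) * S n)" for n
  proof (rule ccontr)
    assume no: "\<not> (\<exists>l. good n l)"
    let ?P = "partitions_of n \<inter> {l. Me n (b n) l \<in> F}"
    have "measure_pmf.prob (count_law n (p n)) {l. Me n (b n) l \<in> F} \<le> (\<Sum>l\<in>?P. exp (- (c' * S n)))"
      unfolding prob_count_law using no by (intro sum_mono) (auto simp: good_def not_le intro: less_imp_le)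
    also have "\<dots> = real (card ?P) * exp (- (c' * S n))" by simp
    also have "\<dots> \<le> real (card (partitions_of n)) * exp (- (c' * S n))"
      by (intro mult_right_mono of_nat_mono card_mono finite_partitions_of) auto
    also have "\<dots> \<le> exp ((c' - c) * S n) * exp (- (c' * S n))" using that by (intro mult_right_mono) auto
    also have "\<dots> = exp (- (c * S n))" by (simp add: exp_add[symmetric] algebra_simps)
    finally show False using that(1) by simp
  qed
  have "\<not> (\<forall>\<^sub>F n in sequentially. \<not> (ok n \<and> (\<exists>l. good n l)))"
  proof
    assume "\<forall>\<^sub>F n in sequentially. \<not> (ok n \<and> (\<exists>l. good n l))"
    then have "\<forall>\<^sub>F n in sequentially. measure_pmf.prob (count_law n (p n)) {l. Me n (b n) l \<in> F} \<le> exp (- (c * S n))"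
      using ok cd by eventually_elim (use ex in blast)
    then show False using neg by simp
  qed
  from not_eventually_sequentiallyD[OF this] obtain r :: "nat \<Rightarrow> nat"
    where r0: "strict_mono r \<and> (\<forall>j. \<not> \<not> (ok (r j) \<and> (\<exists>l. good (r j) l)))" by (elim exE) (rule that)
  have r: "strict_mono r" "\<And>j. ok (r j) \<and> (\<exists>l. good (r j) l)" using r0 by simp_all
  then obtain l where l: "\<And>j. good (r j) (l j)" by metis
  \<comment> \<open>Only sizes above the cutoff are kept: \<open>macro_bound\<close> controls their
    moments, and by \<open>cutoff_small\<close> a given test function eventually vanishes on the
    others.\<close>
  define xs where "xs j = large_sizes (cutoff (r j)) (r j) (l j)" for j
  define X where "X j i = (if i < length (xs j) then real (xs j ! i) / a (r j) else 0)" for j i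
  have apos: "0 < a (r j)" for j using r(2)[of j] unfolding ok_def by blast
  have sumX: "(\<Sum>i<length (xs j). h (X j i)) = (\<Sum>k\<in>{cutoff (r j)<..r j}. real (l j k) * h (real k / a (r j)))" for h :: "real \<Rightarrow> real" and j
  proof -
    have "(\<Sum>i<length (xs j). h (X j i)) = (\<Sum>i<length (xs j). (\<lambda>k. h (real k / a (r j))) (xs j ! i))"
      by (intro sum.cong) (auto simp: X_def)
    also have "\<dots> = sum_list (map (\<lambda>k. h (real k / a (r j))) (xs j))"
      by (simp add: sum_list_sum_nth atLeast0LessThan)
    finally show ?thesis unfolding xs_def sum_list_large_sizes by simp
  qed
  have "\<exists>\<mu>\<in>F. rate_function \<theta> \<mu> \<le> ereal c'"
  proof (rule vague_closed_limit[where X = X and len = "\<lambda>j. length (xs j)" and A = A and \<nu> = "\<lambda>j. Me (r j) (b (r j)) (l j)"])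
    fix j i i' :: nat
    show "0 \<le> X j i" using apos[of j] by (simp add: X_def)
    show "length (xs j) \<le> i \<Longrightarrow> X j i = 0" by (simp add: X_def)
    show "i \<le> i' \<Longrightarrow> X j i' \<le> X j i"
    proof -
      assume ii: "i \<le> i'"
      show "X j i' \<le> X j i"
      proof (cases "i' < length (xs j)")
        case True
        have "xs j ! i' \<le> xs j ! i"
        proof (cases "i = i'")
          case False
          then show ?thesis using sorted_large_sizes[of "cutoff (r j)" "r j" "l j"] ii True
            unfolding xs_def[symmetric] sorted_wrt_iff_nth_less by auto
        qed simp
        then show ?thesis using True ii apos[of j] by (simp add: X_def divide_right_mono)
      next
        case False
        then show ?thesis using apos[of j] by (simp add: X_def)
      qed
    qed
    show "(\<Sum>i<length (xs j). X j i) \<le> A"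
    proof -
      have "moment 1 (cutoff (r j)) (r j) (a (r j)) (l j) \<le> A" using r(2)[of j] l[of j] unfolding ok_def by blast
      then show ?thesis using sumX[of "\<lambda>x. x" j] by (simp add: moment_def)
    qed
    show "Me (r j) (b (r j)) (l j) \<in> F" using l by (simp add: good_def)
  next
    fix \<eta> :: real assume "0 < \<eta>"
    from eventually_subseq[OF r(1) A[OF this]]
    show "\<forall>\<^sub>F j in sequentially. rate_value \<theta> (\<Sum>i<length (xs j). X j i) (\<Sum>i<length (xs j). X j i ^ 3) \<le> c' + \<eta>"
    proof eventually_elim
      case (elim j)
      then show ?case
        using l[of j] sumX[of "\<lambda>x. x" j] sumX[of "\<lambda>x. x ^ 3" j] by (simp add: good_def rate_value_def moment_def)
    qed
  next
    fix f assume f: "f \<in> test_functions"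
    obtain \<alpha> where \<alpha>: "0 < \<alpha>" "\<And>x. 0 < x \<Longrightarrow> x < \<alpha> \<Longrightarrow> f x = 0" using test_function_support[OF f] by blast
    from eventually_subseq[OF r(1) cutoff_small[OF \<alpha>(1)]]
    show "\<forall>\<^sub>F j in sequentially. (LINT y|Me (r j) (b (r j)) (l j). f y) = (\<Sum>i<length (xs j). if 0 < X j i then f (X j i) else 0)"
    proof eventually_elim
      case (elim j)
      let ?n = "r j"
      have o: "0 < real ?n * b ?n" "a ?n = (real ?n * b ?n) powr (2/3)" using r(2)[of j] by (auto simp: ok_def)
      have "(LINT y|Me ?n (b ?n) (l j). f y) = (\<Sum>k=1..?n. real (l j k) * f (real k / a ?n))"
        using Me_facts(2)[OF o(1) f, of "l j"] by (simp add: o(2))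
      also have "\<dots> = (\<Sum>k\<in>{cutoff ?n<..?n}. real (l j k) * (if 0 < real k / a ?n then f (real k / a ?n) else 0))"
      proof (rule sum.mono_neutral_cong_right)
        show "\<forall>k\<in>{1..?n} - {cutoff ?n<..?n}. real (l j k) * f (real k / a ?n) = 0"
        proof
          fix k assume "k \<in> {1..?n} - {cutoff ?n<..?n}"
          then have k: "1 \<le> k" "k \<le> cutoff ?n" by auto
          then have "real k < \<alpha> * a ?n" using elim by linarith
          then have "real k / a ?n < \<alpha>" using apos[of j] by (simp add: pos_divide_less_eq)
          moreover have "0 < real k / a ?n" using k apos[of j] by simp
          ultimately show "real (l j k) * f (real k / a ?n) = 0" using \<alpha>(2) by simp
        qed
      qed (use apos[of j] in auto)
      also have "\<dots> = (\<Sum>i<length (xs j). if 0 < X j i then f (X j i) else 0)"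
        using sumX[of "\<lambda>x. if 0 < x then f x else 0" j] by simp
      finally show ?case .
    qed
  qed (rule F)
  then obtain \<mu> where "\<mu> \<in> F" "rate_function \<theta> \<mu> \<le> ereal c'" by blast
  then have "(INF \<mu>\<in>F. rate_function \<theta> \<mu>) \<le> ereal c'" by (rule INF_lower2)
  then show False using c'(2) by simp
qed

text \<open>Components of sizes close to \<open>z * a\<close>, for \<open>z\<close> in a list
  \<open>zs\<close> that imitates \<mu>, are planted. Their total is at least about
  \<open>\<theta> * a\<close>, so the remaining graph typically has no macroscopic component. The
  exponents add up to \<open>- \<theta> ^ 3 / 6 + (\<theta> - m) ^ 3 / 6 + s / 24\<close>, with
  \<open>m\<close> and \<open>s\<close> the sums of the \<open>z\<close> and of their cubes, which
  is minus the rate since \<open>\<theta> \<le> m\<close>.\<close>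

lemma large_deviation_lower:
  assumes N: "(\<lambda>n. (real n - 1 / p n) / a n) \<longlonglongrightarrow> \<theta>"
    and ab: "\<forall>\<^sub>F n in sequentially. 0 < real n * b n \<and> a n = (real n * b n) powr (2/3)"
    and U: "openin vague_topology U" "\<mu> \<in> U" and fin: "(\<integral>\<^sup>+x. ennreal x \<partial>\<mu>) < \<infinity>" and e: "0 < e"
  shows "\<forall>\<^sub>F n in sequentially. exp (- ((rate_value \<theta> (LINT x|\<mu>. x) (LINT x|\<mu>. x ^ 3) + e) * S n))
     \<le> measure_pmf.prob (count_law n (p n)) {l. Me n (b n) l \<in> U}"
proof -
  have \<mu>: "\<mu> \<in> int_measures" using openin_subset[OF U(1)] U(2) by (auto simp: topspace_vague)
  obtain T d where T: "finite T" "T \<subseteq> test_functions" "0 < d"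
      "\<forall>\<nu>\<in>int_measures. (\<forall>f\<in>T. \<bar>(LINT x|\<nu>. f x) - (LINT x|\<mu>. f x)\<bar> < d) \<longrightarrow> \<nu> \<in> U"
    using vague_neighbourhood[OF U] by metis
  have "\<exists>\<alpha>>0. \<forall>f\<in>T. \<forall>x. 0 < x \<longrightarrow> x < \<alpha> \<longrightarrow> f x = 0"
    using T(1,2)
  proof (induction T rule: finite_induct)
    case empty
    then show ?case by (intro exI[of _ 1]) auto
  next
    case (insert f T)
    then obtain \<alpha> where \<alpha>: "0 < \<alpha>" "\<forall>f\<in>T. \<forall>x. 0 < x \<longrightarrow> x < \<alpha> \<longrightarrow> f x = 0" by auto
    obtain \<beta> where \<beta>: "0 < \<beta>" "\<forall>x. 0 < x \<longrightarrow> x < \<beta> \<longrightarrow> f x = 0" using test_function_support[of f] insert by blast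
    show ?case using \<alpha> \<beta> by (intro exI[of _ "min \<alpha> \<beta>"]) auto
  qed
  then obtain \<alpha> where \<alpha>: "0 < \<alpha>" "\<forall>f\<in>T. \<forall>x. 0 < x \<longrightarrow> x < \<alpha> \<longrightarrow> f x = 0" by blast
  define R where "R = rate_value \<theta> (LINT x|\<mu>. x) (LINT x|\<mu>. x ^ 3)"
  obtain zs where zs: "\<forall>z\<in>set zs. 0 < z" "\<theta> \<le> sum_list zs"
    "rate_value \<theta> (sum_list zs) (sum_list (map (\<lambda>z. z ^ 3) zs)) \<le> R + e / 3"
    "\<forall>f\<in>T. sum_list (map f zs) = (LINT x|\<mu>. f x)"
  proof -
    have "0 < e / 3" using e by simp
    from vague_approximation[OF \<mu> fin this \<alpha>(1) T(2) \<alpha>(2), of \<theta>] show ?thesis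
      using that unfolding R_def by blast
  qed
  \<comment> \<open>The loss over all planted components is at most \<open>e / 3\<close>. Another
    third goes into the choice of \<open>zs\<close>, and the last one makes the final inequality
    strict; \<open>Suc\<close> covers the empty list.\<close>
  define h where "h = e / (3 * real (Suc (length zs)))"
  have h: "0 < h" using e by (simp add: h_def)
  have hl: "real (length zs) * h \<le> e / 3"
  proof -
    have "real (length zs) * h \<le> real (Suc (length zs)) * h" using h by (intro mult_right_mono) auto
    also have "\<dots> = e / 3" by (simp add: h_def field_simps del: of_nat_Suc)
    finally show ?thesis .
  qed
  define Q where "Q z k \<longleftrightarrow> (\<lambda>n. real (k n) / a n) \<longlonglongrightarrow> z \<and>
    (\<forall>\<eta>>0. \<forall>\<^sub>F n in sequentially. 1 \<le> k n \<and> 0 < comp_weight (p n) (k n) \<and>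
      real (k n) * (1 + ln (p n)) + (z ^ 3 / 24 - \<eta>) * S n \<le> ln (comp_weight (p n) (k n)))" for z k
  define K where "K z = (SOME k. Q z k)" for z
  have Q: "Q z (K z)" if "0 < z" for z
  proof -
    have "\<exists>k. Q z k" unfolding Q_def by (rule comp_weight_lower[OF that])
    then show ?thesis unfolding K_def by (rule someI_ex)
  qed
  have K: "(\<lambda>n. real (K z n) / a n) \<longlonglongrightarrow> z" if "0 < z" for z
    using Q[OF that] unfolding Q_def by (rule conjunct1)
  have Kh: "\<forall>\<^sub>F n in sequentially. 1 \<le> K z n \<and> 0 < comp_weight (p n) (K z n) \<and>
      real (K z n) * (1 + ln (p n)) + (z ^ 3 / 24 - h) * S n \<le> ln (comp_weight (p n) (K z n))" if "0 < z" for z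
    using conjunct2[OF Q[OF that, unfolded Q_def], rule_format, OF h] .
  define ks where "ks n = map (\<lambda>z. K z n) zs" for n
  have sl_tendsto: "(\<lambda>n. sum_list (map (\<lambda>z. g z n) ys)) \<longlonglongrightarrow> sum_list (map G ys)"
    if "\<And>z. z \<in> set ys \<Longrightarrow> (\<lambda>n. g z n) \<longlonglongrightarrow> G z" for g :: "real \<Rightarrow> nat \<Rightarrow> real" and G ys
    using that by (induction ys) (auto intro!: tendsto_add)
  have ksum: "(\<lambda>n. real (sum_list (ks n)) / a n) \<longlonglongrightarrow> sum_list zs"
  proof -
    have "(\<lambda>n. sum_list (map (\<lambda>z. real (K z n) / a n) zs)) \<longlonglongrightarrow> sum_list (map (\<lambda>z. z) zs)"
      by (rule sl_tendsto) (use K zs(1) in auto)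
    moreover have "sum_list (map (\<lambda>z. real (K z n) / a n) ys) = real (sum_list (map (\<lambda>z. K z n) ys)) / a n" for n ys
      by (induction ys) (auto simp: add_divide_distrib)
    ultimately show ?thesis by (simp add: ks_def)
  qed
  have ks_ge1: "\<forall>\<^sub>F n in sequentially. \<forall>k\<in>set (ks n). 1 \<le> k"
  proof -
    have "\<forall>\<^sub>F n in sequentially. \<forall>z\<in>set zs. 1 \<le> K z n"
    proof (rule eventually_ball_finite, simp, rule ballI)
      fix z assume "z \<in> set zs"
      then have "0 < z" using zs(1) by simp
      from Kh[OF this] show "\<forall>\<^sub>F n in sequentially. 1 \<le> K z n" by eventually_elim simp
    qed
    then show ?thesis by eventually_elim (auto simp: ks_def)
  qed
  have ksle: "\<forall>\<^sub>F n in sequentially. sum_list (ks n) \<le> n"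
  proof -
    have "(\<lambda>n. real (sum_list (ks n)) / a n * (a n * p n)) \<longlonglongrightarrow> sum_list zs * 0" by (intro tendsto_mult ksum ap_null)
    then have "(\<lambda>n. real (sum_list (ks n)) / a n * (a n * p n)) \<longlonglongrightarrow> 0" by simp
    then have "\<forall>\<^sub>F n in sequentially. real (sum_list (ks n)) / a n * (a n * p n) < 1/2" by (rule order_tendstoD(2)) simp
    moreover have "\<forall>\<^sub>F n in sequentially. 1/2 < real n * p n" by (rule order_tendstoD(1)[OF Np_tendsto[OF N]]) simp
    ultimately show ?thesis using eventually_basic
    proof eventually_elim
      case (elim n)
      then have "real (sum_list (ks n)) / a n * (a n * p n) = real (sum_list (ks n)) * p n" by simp
      then have "real (sum_list (ks n)) * p n < real n * p n" using elim by linarith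
      then have "real (sum_list (ks n)) < real n" using elim by simp
      then show ?case by simp
    qed
  qed
  \<comment> \<open>Relative to \<open>1 / p\<close>, the remaining number of vertices is shifted by
    about \<open>(\<theta> - sum_list zs) * a\<close>, where the coefficient is not positive, as
    \<open>no_macroscopic_components\<close> requires.\<close>
  define N' where "N' n = n - sum_list (ks n)" for n
  have N': "(\<lambda>n. (real (N' n) - 1 / p n) / a n) \<longlonglongrightarrow> \<theta> - sum_list zs"
  proof -
    have "(\<lambda>n. (real n - 1 / p n) / a n - real (sum_list (ks n)) / a n) \<longlonglongrightarrow> \<theta> - sum_list zs" by (intro tendsto_diff N ksum)
    then show ?thesis
      by (rule Lim_transform_eventually)
         (use ksle in \<open>eventually_elim, auto simp: N'_def of_nat_diff diff_divide_distrib[symmetric] algebra_simps\<close>)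
  qed
  define G where "G n = {l. \<forall>k. \<alpha> / 2 * a n \<le> real k \<longrightarrow> l k = (0::nat)}" for n
  have PG: "\<forall>\<^sub>F n in sequentially. 1/2 < measure_pmf.prob (count_law (N' n) (p n)) (G n)"
    unfolding G_def by (rule order_tendstoD(1)[OF no_macroscopic_components[OF N']]) (use zs(2) \<alpha>(1) in auto)
  have close: "\<forall>\<^sub>F n in sequentially. \<forall>f\<in>T. \<bar>sum_list (map (\<lambda>z. f (real (K z n) / a n)) zs) - (LINT x|\<mu>. f x)\<bar> < d"
  proof (rule eventually_ball_finite[OF T(1)], rule ballI)
    fix f assume f: "f \<in> T"
    have "(\<lambda>n. sum_list (map (\<lambda>z. f (real (K z n) / a n)) zs)) \<longlonglongrightarrow> sum_list (map f zs)"
    proof (rule sl_tendsto)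
      fix z assume "z \<in> set zs"
      then have z: "0 < z" using zs(1) by simp
      have "continuous_on {0<..} f" using f T(2) by (auto simp: test_functions_def)
      then have "isCont f z" using z by (simp add: continuous_on_eq_continuous_at)
      from isCont_tendsto_compose[OF this K[OF z]] show "(\<lambda>n. f (real (K z n) / a n)) \<longlonglongrightarrow> f z" .
    qed
    then have "(\<lambda>n. sum_list (map (\<lambda>z. f (real (K z n) / a n)) zs)) \<longlonglongrightarrow> (LINT x|\<mu>. f x)" using zs(4) f by simp
    from tendstoD[OF this T(3)]
    show "\<forall>\<^sub>F n in sequentially. \<bar>sum_list (map (\<lambda>z. f (real (K z n) / a n)) zs) - (LINT x|\<mu>. f x)\<bar> < d"
      by (simp add: dist_real_def)
  qed
  \<comment> \<open>On the event \<open>G n\<close>, every component of the remaining graph lies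
    below the support of all functions in \<open>T\<close>, so only the planted components enter
    their integrals.\<close>
  have inU: "\<forall>\<^sub>F n in sequentially. \<forall>l. l \<in> partitions_of (N' n) \<longrightarrow> l \<in> G n \<longrightarrow> Me n (b n) (add_sizes (ks n) l) \<in> U"
    using close ks_ge1 ksle ab a_pos
  proof eventually_elim
    case (elim n)
    show ?case
    proof (intro allI impI)
      fix l assume l: "l \<in> partitions_of (N' n)" "l \<in> G n"
      have o: "0 < real n * b n" "a n = (real n * b n) powr (2/3)" "0 < a n" using elim by auto
      have "(LINT y|Me n (b n) (add_sizes (ks n) l). f y) = sum_list (map (\<lambda>z. f (real (K z n) / a n)) zs)" if f: "f \<in> T" for f
      proof -
        have "(LINT y|Me n (b n) (add_sizes (ks n) l). f y) = (\<Sum>k=1..n. real (add_sizes (ks n) l k) * f (real k / a n))"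
          using Me_facts(2)[OF o(1), of f "add_sizes (ks n) l"] f T(2) by (auto simp: o(2))
        also have "\<dots> = (\<Sum>k=1..n. real (count_list (ks n) k) * f (real k / a n))"
        proof (rule sum.cong[OF refl])
          fix k assume k: "k \<in> {1..n}"
          have "real (l k) * f (real k / a n) = 0"
          proof (cases "l k = 0")
            case False
            have "real k < \<alpha> / 2 * a n"
            proof (rule ccontr)
              assume "\<not> real k < \<alpha> / 2 * a n"
              then have "\<alpha> / 2 * a n \<le> real k" by (simp only: not_less)
              then have "l k = 0" using l(2) unfolding G_def by blast
              then show False using False by simp
            qed
            then have "real k / a n < \<alpha> / 2" using o by (simp add: pos_divide_less_eq)
            then have "real k / a n < \<alpha>" using \<alpha>(1) by linarith
            moreover have "0 < real k / a n" using k o by auto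
            ultimately show ?thesis using bspec[OF \<alpha>(2) f] by simp
          qed simp
          then show "real (add_sizes (ks n) l k) * f (real k / a n) = real (count_list (ks n) k) * f (real k / a n)"
            by (simp add: add_sizes_def algebra_simps)
        qed
        also have "\<dots> = sum_list (map (\<lambda>k. f (real k / a n)) (ks n))"
        proof -
          have "k \<le> n" if "k \<in> set (ks n)" for k
            using member_le_sum_list[OF that] elim by linarith
          then have "set (ks n) \<subseteq> {1..n}" using elim by auto
          then show ?thesis by (rule sum_count_list_real)
        qed
        finally show ?thesis by (simp add: ks_def o_def)
      qed
      then show "Me n (b n) (add_sizes (ks n) l) \<in> U"
        using T(4) Me_facts(1)[OF o(1)] elim(1) by auto
    qed
  qed
  have lnw: "\<forall>\<^sub>F n in sequentially. 0 < prod_list (map (comp_weight (p n)) (ks n)) \<and>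
     real (sum_list (ks n)) * (1 + ln (p n)) + (sum_list (map (\<lambda>z. z ^ 3) zs) / 24 - real (length zs) * h) * S n
       \<le> ln (prod_list (map (comp_weight (p n)) (ks n)))"
    unfolding ks_def using zs(1)
  proof (induction zs)
    case Nil
    then show ?case by simp
  next
    case (Cons z zs)
    then have z: "0 < z" and IH: "\<forall>\<^sub>F n in sequentially. 0 < prod_list (map (comp_weight (p n)) (map (\<lambda>z. K z n) zs)) \<and>
     real (sum_list (map (\<lambda>z. K z n) zs)) * (1 + ln (p n)) + (sum_list (map (\<lambda>z. z ^ 3) zs) / 24 - real (length zs) * h) * S n
       \<le> ln (prod_list (map (comp_weight (p n)) (map (\<lambda>z. K z n) zs)))" by auto
    from IH Kh[OF z] show ?case
    proof eventually_elim
      case (elim n)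
      define Q' where "Q' = prod_list (map (comp_weight (p n)) (map (\<lambda>z. K z n) zs))"
      have w: "0 < comp_weight (p n) (K z n)" and Q': "0 < Q'"
        and i1: "real (K z n) * (1 + ln (p n)) + (z ^ 3 / 24 - h) * S n \<le> ln (comp_weight (p n) (K z n))"
        and i2: "real (sum_list (map (\<lambda>z. K z n) zs)) * (1 + ln (p n)) + (sum_list (map (\<lambda>z. z ^ 3) zs) / 24 - real (length zs) * h) * S n \<le> ln Q'"
        using elim unfolding Q'_def by blast+
      have L: "real (sum_list (map (\<lambda>z. K z n) (z # zs))) * (1 + ln (p n))
          + (sum_list (map (\<lambda>z. z ^ 3) (z # zs)) / 24 - real (length (z # zs)) * h) * S n
        = (real (K z n) * (1 + ln (p n)) + (z ^ 3 / 24 - h) * S n)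
          + (real (sum_list (map (\<lambda>z. K z n) zs)) * (1 + ln (p n)) + (sum_list (map (\<lambda>z. z ^ 3) zs) / 24 - real (length zs) * h) * S n)"
        by (simp add: field_simps)
      have P: "prod_list (map (comp_weight (p n)) (map (\<lambda>z. K z n) (z # zs))) = comp_weight (p n) (K z n) * Q'"
        by (simp add: Q'_def)
      show ?case
        unfolding L P ln_mult_pos[OF w Q'] by (intro conjI mult_pos_pos w Q' add_mono i1 i2)
    qed
  qed
  \<comment> \<open>The exponent of the lower bound per unit of \<open>S n\<close>. The last bracket
    is the price of planting and of the factor \<open>1/2\<close> for the typical event; it tends to
    zero.\<close>
  define q where "q n = log_weight (p n) n / S n - log_weight (p n) (N' n) / S n
     + (sum_list (map (\<lambda>z. z ^ 3) zs) / 24 - real (length zs) * h)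
     - (real (length zs) * (ln (2 * real n) / S n) + ln 2 * (1 / S n))" for n
  have qlim: "q \<longlonglongrightarrow> - (rate_value \<theta> (sum_list zs) (sum_list (map (\<lambda>z. z ^ 3) zs)) + real (length zs) * h)"
  proof -
    have "q \<longlonglongrightarrow> - (\<theta> ^ 3) / 6 - - ((\<theta> - sum_list zs) ^ 3) / 6
     + (sum_list (map (\<lambda>z. z ^ 3) zs) / 24 - real (length zs) * h)
     - (real (length zs) * 0 + ln 2 * 0)"
      unfolding q_def[abs_def]
      by (intro tendsto_intros log_weight_tendsto[OF N] log_weight_tendsto[OF N'] ln_size_null[OF N] inverse_S_null)
    moreover have "max 0 (sum_list zs - \<theta>) = sum_list zs - \<theta>" using zs(2) by simp
    moreover have "(\<theta> - sum_list zs) ^ 3 = - ((sum_list zs - \<theta>) ^ 3)"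
      by (simp add: eval_nat_numeral algebra_simps)
    ultimately show ?thesis by (simp add: rate_value_def algebra_simps)
  qed
  have "- (R + e) < - (rate_value \<theta> (sum_list zs) (sum_list (map (\<lambda>z. z ^ 3) zs)) + real (length zs) * h)"
    using zs(3) hl e by linarith
  from order_tendstoD(1)[OF qlim this] lnw inU PG ks_ge1 ksle eventually_basic eventually_N[OF N]
  show ?thesis
    unfolding R_def[symmetric]
  proof eventually_elim
    case (elim n)
    define P where "P = measure_pmf.prob (count_law n (p n)) {l. Me n (b n) l \<in> U}"
    define W where "W = prod_list (map (comp_weight (p n)) (ks n))"
    define PG where "PG = measure_pmf.prob (count_law (N' n) (p n)) (G n)"
    define len where "len = length zs"
    have pp: "0 \<le> p n" "p n < 1" and S: "0 < S n" and n: "0 < real n" using elim by auto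
    have W: "0 < W" using elim by (simp add: W_def)
    have PG: "1/2 < PG" using elim by (simp add: PG_def)
    have D: "0 < part_weight (p n) n" "0 < part_weight (p n) (N' n)" using pp by (auto intro: part_weight_pos)
    have main: "part_weight (p n) n * W * PG \<le> part_weight (p n) (N' n) * real n ^ len * P"
    proof -
      have "part_weight (p n) n * prod_list (map (comp_weight (p n)) (ks n)) * measure_pmf.prob (count_law (N' n) (p n)) (G n)
        \<le> part_weight (p n) (N' n) * real n ^ length (ks n) * measure_pmf.prob (count_law n (p n)) {l. Me n (b n) l \<in> U}"
        by (rule prob_count_law_add_sizes[OF pp]) (use elim in \<open>auto simp: N'_def\<close>)
      then show ?thesis by (simp add: W_def PG_def P_def len_def ks_def)
    qed
    have "part_weight (p n) n * W * (1/2) \<le> part_weight (p n) n * W * PG"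
      using PG D W by (intro mult_left_mono) auto
    then have m2: "part_weight (p n) n * W * (1/2) \<le> part_weight (p n) (N' n) * real n ^ len * P" using main by linarith
    have "0 < part_weight (p n) n * W * (1/2)" using D W by simp
    then have "0 < part_weight (p n) (N' n) * real n ^ len * P" using m2 by linarith
    then have P: "0 < P" by (rule zero_less_mult_pos) (use D n in simp)
    have "ln (part_weight (p n) n * W * (1/2)) \<le> ln (part_weight (p n) (N' n) * real n ^ len * P)"
      using m2 D W by (intro ln_mono) auto
    moreover have "ln (part_weight (p n) n * W * (1/2)) = ln (part_weight (p n) n) + ln W - ln 2"
      using D W by (simp add: ln_mult_pos ln_div)
    moreover have "ln (part_weight (p n) (N' n) * real n ^ len * P) = ln (part_weight (p n) (N' n)) + real len * ln (real n) + ln P"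
      using D P n by (simp add: ln_mult_pos ln_realpow)
    moreover have "real len * ln (real n) \<le> real len * ln (2 * real n)" using n by (intro mult_left_mono) auto
    ultimately have l1: "ln (part_weight (p n) n) - ln (part_weight (p n) (N' n)) + ln W - real len * ln (2 * real n) - ln 2 \<le> ln P"
      by linarith
    have nn: "real n = real (N' n) + real (sum_list (ks n))" using elim by (simp add: N'_def of_nat_diff)
    have l2: "ln (part_weight (p n) n) - ln (part_weight (p n) (N' n))
       = log_weight (p n) n - log_weight (p n) (N' n) - real (sum_list (ks n)) * (1 + ln (p n))"
      unfolding log_weight_def nn by (simp add: algebra_simps)
    have l3: "real (sum_list (ks n)) * (1 + ln (p n)) + (sum_list (map (\<lambda>z. z ^ 3) zs) / 24 - real len * h) * S n \<le> ln W"
      using elim by (simp add: W_def len_def)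
    have "q n * S n = log_weight (p n) n - log_weight (p n) (N' n)
     + (sum_list (map (\<lambda>z. z ^ 3) zs) / 24 - real len * h) * S n
     - (real len * ln (2 * real n) + ln 2)"
      unfolding q_def len_def using S by (simp add: field_simps)
    then have l4: "q n * S n \<le> ln P" using l1 l2 l3 by linarith
    have "- (R + e) * S n \<le> q n * S n" using elim S by (intro mult_right_mono) auto
    from order.trans[OF this l4] have "- ((R + e) * S n) \<le> ln P" by (simp only: minus_mult_left)
    then have "exp (- ((R + e) * S n)) \<le> exp (ln P)" by (simp only: exp_le_cancel_iff)
    also have "exp (ln P) = P" using P by (rule exp_ln)
    finally show ?case unfolding P_def .
  qed
qed

end

section \<open>The large deviation principle in the extended reals\<close>

lemma ereal_ln_le:
  assumes "x \<le> exp y"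
  shows "ereal_ln x \<le> ereal y"
proof (cases "0 < x")
  case True
  then have "ln x \<le> ln (exp y)" using assms by (subst ln_le_cancel_iff) auto
  then show ?thesis using True by (simp add: ereal_ln_def)
qed (simp add: ereal_ln_def)

lemma ereal_ln_ge:
  assumes "exp y \<le> x"
  shows "ereal y \<le> ereal_ln x"
proof -
  have x: "0 < x" using assms exp_gt_zero less_le_trans by blast
  have "ln (exp y) \<le> ln x" using assms x by (subst ln_le_cancel_iff) auto
  then show ?thesis using x by (simp add: ereal_ln_def)
qed

theorem theorem2p1:
  fixes \<theta> :: real and b p r :: "nat \<Rightarrow> real"
  assumes "incseq b"
    and "(\<lambda>n. real n powr (3/10)) \<in> o(b)"
    and "b \<in> o(\<lambda>n. real n powr (1/2))"
    and "r \<in> O(\<lambda>n. ((b n)\<^sup>2 / real n) powr (2/3))"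
    and "\<And>n. p n = (1 + \<theta> * ((b n)\<^sup>2 / real n) powr (1/3) + r n) / real n"
  shows "(\<forall>\<mu>\<in>int_measures. 0 \<le> rate_function \<theta> \<mu>) \<and>
         LDP vague_topology
           (\<lambda>n. map_pmf (\<lambda>E. Me n (b n) (component_count n E)) (erdos_renyi n (p n)))
           (\<lambda>n. (b n)\<^sup>2) (rate_function \<theta>)"
proof
  show "\<forall>\<mu>\<in>int_measures. 0 \<le> rate_function \<theta> \<mu>" using rate_function_nonneg by blast
  define a where "a n = (real n * b n) powr (2/3)" for n
  define S where "S n = (b n)\<^sup>2" for n
  \<comment> \<open>Up to finitely many \<open>n\<close>,
    \<open>a n = real n * \<epsilon> n\<close>; thus the deviation of \<open>n * p n\<close> from
    one, in units of \<open>\<epsilon> n\<close>, is the deviation of the number of vertices in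
    units of \<open>a n\<close>.\<close>
  define \<epsilon> where "\<epsilon> n = ((b n)\<^sup>2 / real n) powr (1/3)" for n
  define \<Delta> where "\<Delta> n = \<theta> * \<epsilon> n + r n" for n
  have pn: "p n = (1 + \<Delta> n) / real n" for n using assms(5)[of n] by (simp add: \<Delta>_def \<epsilon>_def)
  have big: "\<forall>\<^sub>F n in sequentially. real n powr (3/10) \<le> \<bar>b n\<bar>"
    using landau_o.smallD[OF assms(2) zero_less_one] by simp
  \<comment> \<open>If \<open>b\<close> never became positive, monotonicity would bound
    \<open>\<bar>b n\<bar>\<close> by \<open>\<bar>b 0\<bar>\<close>, against the growth of
    \<open>b\<close>.\<close>
  have b_pos: "\<forall>\<^sub>F n in sequentially. 0 < b n"
  proof (rule ccontr)
    assume neg: "\<not> ?thesis"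
    have np: "b m \<le> 0" for m
    proof (rule ccontr)
      assume "\<not> b m \<le> 0"
      then have "\<forall>n\<ge>m. 0 < b n" using incseqD[OF assms(1)] by (meson less_le_trans not_le)
      then show False using neg by (auto simp: eventually_sequentially)
    qed
    have "filterlim (\<lambda>n. real n powr (3/10)) at_top sequentially" by real_asymp
    then have "\<forall>\<^sub>F n in sequentially. \<bar>b 0\<bar> + 1 \<le> real n powr (3/10)" by (simp add: filterlim_at_top)
    then have "\<forall>\<^sub>F n in sequentially. False"
      using big
    proof eventually_elim
      case (elim n)
      have "b 0 \<le> b n" using incseqD[OF assms(1), of 0 n] by simp
      then have "\<bar>b n\<bar> \<le> \<bar>b 0\<bar>" using np[of n] np[of 0] by simp
      then show False using elim by linarith
    qed
    then show False by simp
  qed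
  have basic: "\<forall>\<^sub>F n in sequentially. 0 < b n \<and> 0 < real n \<and> 0 < real n * b n \<and> 0 < \<epsilon> n \<and>
     a n ^ 3 = (real n * b n)\<^sup>2 \<and> \<epsilon> n ^ 3 = (b n)\<^sup>2 / real n \<and> a n = real n * \<epsilon> n"
    using b_pos eventually_gt_at_top[of "0::nat"]
  proof eventually_elim
    case (elim n)
    have nb: "0 < real n * b n" using elim by simp
    have e0: "0 < \<epsilon> n" using elim by (simp add: \<epsilon>_def)
    have a3: "a n ^ 3 = (real n * b n)\<^sup>2"
    proof -
      have "0 < a n" using nb unfolding a_def powr_gt_zero by linarith
      then have "a n ^ 3 = a n powr (real 3)" by (rule powr_realpow[symmetric])
      also have "\<dots> = (real n * b n) powr 2" by (simp add: a_def powr_powr)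
      also have "\<dots> = (real n * b n)\<^sup>2" using nb by simp
      finally show ?thesis .
    qed
    have e3: "\<epsilon> n ^ 3 = (b n)\<^sup>2 / real n"
    proof -
      have "\<epsilon> n ^ 3 = \<epsilon> n powr (real 3)" using e0 by (subst powr_realpow) auto
      also have "\<dots> = ((b n)\<^sup>2 / real n) powr 1" by (simp add: \<epsilon>_def powr_powr)
      also have "\<dots> = (b n)\<^sup>2 / real n" using elim by simp
      finally show ?thesis .
    qed
    have "a n ^ 3 = (real n * \<epsilon> n) ^ 3"
      unfolding a3 power_mult_distrib e3 using elim by (simp add: eval_nat_numeral)
    then have "a n = real n * \<epsilon> n"
      by (rule power_eq_imp_eq_base) (use e0 in \<open>auto simp: a_def\<close>)
    then show ?case using elim nb e0 a3 e3 by simp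
  qed
  have eps0: "\<epsilon> \<longlonglongrightarrow> 0"
  proof -
    have "(\<lambda>n. b n / real n powr (1/2)) \<longlonglongrightarrow> 0" by (rule smalloD_tendsto[OF assms(3)])
    then have "(\<lambda>n. (b n / real n powr (1/2))\<^sup>2) \<longlonglongrightarrow> 0\<^sup>2" by (rule tendsto_power)
    then have "(\<lambda>n. (b n / real n powr (1/2))\<^sup>2) \<longlonglongrightarrow> 0" by simp
    then have sq: "(\<lambda>n. (b n)\<^sup>2 / real n) \<longlonglongrightarrow> 0"
    proof (rule Lim_transform_eventually)
      show "\<forall>\<^sub>F n in sequentially. (b n / real n powr (1/2))\<^sup>2 = (b n)\<^sup>2 / real n"
        using eventually_gt_at_top[of "0::nat"] by eventually_elim (simp add: power_divide powr_half_sqrt)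
    qed
    have "(\<lambda>n. root 3 ((b n)\<^sup>2 / real n)) \<longlonglongrightarrow> root 3 0" by (rule tendsto_real_root[OF sq])
    then have "(\<lambda>n. root 3 ((b n)\<^sup>2 / real n)) \<longlonglongrightarrow> 0" by simp
    then show ?thesis
    proof (rule Lim_transform_eventually)
      show "\<forall>\<^sub>F n in sequentially. root 3 ((b n)\<^sup>2 / real n) = \<epsilon> n"
        using basic
      proof eventually_elim
        case (elim n)
        have "root 3 (\<epsilon> n ^ 3) = \<epsilon> n" using elim by (intro real_root_power_cancel) auto
        then show ?case using elim by simp
      qed
    qed
  qed
  have r_eps: "(\<lambda>n. r n / \<epsilon> n) \<longlonglongrightarrow> 0"
  proof -
    obtain C where C: "\<forall>\<^sub>F n in sequentially. norm (r n) \<le> C * norm (((b n)\<^sup>2 / real n) powr (2/3))"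
      using landau_o.bigE[OF assms(4)] by blast
    show ?thesis
    proof (rule Lim_null_comparison)
      show "\<forall>\<^sub>F n in sequentially. norm (r n / \<epsilon> n) \<le> C * \<epsilon> n"
        using C basic
      proof eventually_elim
        case (elim n)
        have "((b n)\<^sup>2 / real n) powr (2/3) = \<epsilon> n * \<epsilon> n" by (simp add: \<epsilon>_def powr_add[symmetric])
        then have "\<bar>r n\<bar> \<le> C * (\<epsilon> n * \<epsilon> n)" using elim by simp
        then show ?case using elim by (simp add: pos_divide_le_eq mult.assoc)
      qed
      show "(\<lambda>n. C * \<epsilon> n) \<longlonglongrightarrow> 0" using tendsto_mult_right_zero[OF eps0] by simp
    qed
  qed
  have D_eps: "(\<lambda>n. \<Delta> n / \<epsilon> n) \<longlonglongrightarrow> \<theta>"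
  proof -
    have "(\<lambda>n. \<theta> + r n / \<epsilon> n) \<longlonglongrightarrow> \<theta> + 0" by (intro tendsto_intros r_eps)
    then have "(\<lambda>n. \<theta> + r n / \<epsilon> n) \<longlonglongrightarrow> \<theta>" by simp
    then show ?thesis
      by (rule Lim_transform_eventually) (use basic in \<open>eventually_elim, auto simp: \<Delta>_def add_divide_distrib\<close>)
  qed
  have D0: "\<Delta> \<longlonglongrightarrow> 0"
  proof -
    have "(\<lambda>n. \<Delta> n / \<epsilon> n * \<epsilon> n) \<longlonglongrightarrow> \<theta> * 0" by (intro tendsto_mult D_eps eps0)
    then have "(\<lambda>n. \<Delta> n / \<epsilon> n * \<epsilon> n) \<longlonglongrightarrow> 0" by simp
    then show ?thesis by (rule Lim_transform_eventually) (use basic in \<open>eventually_elim, auto\<close>)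
  qed
  have D_half: "\<forall>\<^sub>F n in sequentially. \<bar>\<Delta> n\<bar> < 1/2"
    using tendstoD[OF D0, of "1/2"] by (simp add: dist_real_def)
  have inv_n: "(\<lambda>n. 1 / real n) \<longlonglongrightarrow> 0" by (rule lim_1_over_n)
  interpret critical_window p a S
  proof
    show "\<forall>\<^sub>F n in sequentially. 0 < p n"
      using D_half basic by eventually_elim (auto simp: pn intro!: divide_pos_pos)
    have "(\<lambda>n. (1 + \<Delta> n) * (1 / real n)) \<longlonglongrightarrow> (1 + 0) * 0" by (intro tendsto_intros D0 inv_n)
    then show "p \<longlonglongrightarrow> 0" by (simp add: pn[abs_def])
    show "\<forall>\<^sub>F n in sequentially. 0 < a n" using basic by eventually_elim simp
    show "\<forall>\<^sub>F n in sequentially. 0 < S n" using basic by eventually_elim (simp add: S_def)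
    have "(\<lambda>n. \<epsilon> n * (1 + \<Delta> n)) \<longlonglongrightarrow> 0 * (1 + 0)" by (intro tendsto_intros D0 eps0)
    then have "(\<lambda>n. \<epsilon> n * (1 + \<Delta> n)) \<longlonglongrightarrow> 0" by simp
    then show "(\<lambda>n. a n * p n) \<longlonglongrightarrow> 0"
      by (rule Lim_transform_eventually) (use basic in \<open>eventually_elim, auto simp: pn\<close>)
    have "(\<lambda>n. (1 + \<Delta> n)\<^sup>2) \<longlonglongrightarrow> (1 + 0)\<^sup>2" by (intro tendsto_intros D0)
    then have "(\<lambda>n. (1 + \<Delta> n)\<^sup>2) \<longlonglongrightarrow> 1" by simp
    then show "(\<lambda>n. a n ^ 3 * (p n)\<^sup>2 / S n) \<longlonglongrightarrow> 1"
    proof (rule Lim_transform_eventually)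
      show "\<forall>\<^sub>F n in sequentially. (1 + \<Delta> n)\<^sup>2 = a n ^ 3 * (p n)\<^sup>2 / S n"
        using basic
      proof eventually_elim
        case (elim n)
        then have a3: "a n ^ 3 = (real n * b n)\<^sup>2" by blast
        have "a n ^ 3 * (p n)\<^sup>2 / S n = (real n * b n)\<^sup>2 * ((1 + \<Delta> n) / real n)\<^sup>2 / (b n)\<^sup>2"
          unfolding a3 pn S_def ..
        also have "\<dots> = (1 + \<Delta> n)\<^sup>2" using elim by (simp add: power_mult_distrib power_divide)
        finally show ?case ..
      qed
    qed
    show "(\<lambda>n. sqrt (1 / p n) * ln (1 / p n) / S n) \<longlonglongrightarrow> 0"
    proof (rule Lim_null_comparison)
      \<comment> \<open>The lower growth condition on \<open>b\<close> enters here: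
        \<open>(b n)\<^sup>2\<close> is at least \<open>n powr (6/10)\<close>, which outgrows
        \<open>sqrt n * ln n\<close>, while \<open>1 / p n\<close> lies between \<open>1\<close> and
        \<open>2 * n\<close>.\<close>
      show "(\<lambda>n. sqrt (2 * real n) * ln (2 * real n) / real n powr (6/10)) \<longlonglongrightarrow> 0" by real_asymp
      show "\<forall>\<^sub>F n in sequentially. norm (sqrt (1 / p n) * ln (1 / p n) / S n) \<le> sqrt (2 * real n) * ln (2 * real n) / real n powr (6/10)"
        using D_half basic big eventually_ge_at_top[of "2::nat"]
      proof eventually_elim
        case (elim n)
        have n: "2 \<le> real n" using elim by simp
        define w where "w = 1 / p n"
        have v: "w = real n / (1 + \<Delta> n)" by (simp add: pn w_def)
        have d: "1/2 < 1 + \<Delta> n" "1 + \<Delta> n < 3/2" using elim by auto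
        have "1 \<le> real n / (1 + \<Delta> n)" using n d by (simp add: pos_le_divide_eq)
        moreover have "real n / (1 + \<Delta> n) \<le> 2 * real n"
        proof -
          have "real n * 1 \<le> real n * (2 * (1 + \<Delta> n))" using d by (intro mult_left_mono) auto
          then show ?thesis using d by (simp add: pos_divide_le_eq mult_ac)
        qed
        ultimately have v1: "1 \<le> w" "w \<le> 2 * real n" unfolding v by auto
        have S: "real n powr (6/10) \<le> S n" "0 < real n powr (6/10)"
        proof -
          have "(real n powr (3/10))\<^sup>2 \<le> \<bar>b n\<bar>\<^sup>2" using elim by (intro power_mono) auto
          moreover have "(real n powr (3/10))\<^sup>2 = real n powr (6/10)" by (simp add: power2_eq_square powr_add[symmetric])
          ultimately show "real n powr (6/10) \<le> S n" by (simp add: S_def)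
          show "0 < real n powr (6/10)" using n by simp
        qed
        have l: "0 \<le> ln w" "ln w \<le> ln (2 * real n)" using v1 by simp_all
        have "sqrt w * ln w / S n \<le> sqrt (2 * real n) * ln (2 * real n) / real n powr (6/10)"
          using v1 l S by (intro frac_le mult_mono real_sqrt_le_mono mult_nonneg_nonneg) auto
        moreover have "0 \<le> sqrt w * ln w / S n" using v1 l by (auto simp: S_def intro!: divide_nonneg_nonneg mult_nonneg_nonneg)
        ultimately show ?case unfolding w_def by simp
      qed
    qed
  qed
  \<comment> \<open>With \<open>n * p n = 1 + \<Delta> n\<close> the quotient is
    \<open>(\<Delta> n / \<epsilon> n) / (1 + \<Delta> n)\<close>.\<close>
  have N: "(\<lambda>n. (real n - 1 / p n) / a n) \<longlonglongrightarrow> \<theta>"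
  proof -
    have "(\<lambda>n. (\<Delta> n / \<epsilon> n) / (1 + \<Delta> n)) \<longlonglongrightarrow> \<theta> / (1 + 0)" by (intro tendsto_intros D_eps D0) simp
    then have "(\<lambda>n. (\<Delta> n / \<epsilon> n) / (1 + \<Delta> n)) \<longlonglongrightarrow> \<theta>" by simp
    then show ?thesis
    proof (rule Lim_transform_eventually)
      show "\<forall>\<^sub>F n in sequentially. (\<Delta> n / \<epsilon> n) / (1 + \<Delta> n) = (real n - 1 / p n) / a n"
        using D_half basic
      proof eventually_elim
        case (elim n)
        have d: "0 < 1 + \<Delta> n" using elim by auto
        have "real n - 1 / p n = real n * (\<Delta> n / (1 + \<Delta> n))" unfolding pn using d by (simp add: field_simps)
        then show ?case using elim by simp
      qed
    qed
  qed
  have ab: "\<forall>\<^sub>F n in sequentially. 0 < real n * b n \<and> a n = (real n * b n) powr (2/3)"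
    using basic by eventually_elim (simp add: a_def)
  define P where "P n U = measure_pmf.prob (count_law n (p n)) {l. Me n (b n) l \<in> U}" for n U
  have law: "measure_pmf.prob (map_pmf (\<lambda>E. Me n (b n) (component_count n E)) (erdos_renyi n (p n))) U = P n U" for n U
    by (simp add: P_def count_law_def vimage_def)
  show "LDP vague_topology
           (\<lambda>n. map_pmf (\<lambda>E. Me n (b n) (component_count n E)) (erdos_renyi n (p n)))
           (\<lambda>n. (b n)\<^sup>2) (rate_function \<theta>)"
    unfolding LDP_def law S_def[symmetric]
  proof (intro conjI allI impI)
    fix U assume U: "openin vague_topology U"
    let ?L = "liminf (\<lambda>n. ereal (1 / S n) * ereal_ln (P n U))"
    have "- ?L \<le> (INF x\<in>U. rate_function \<theta> x)"
    proof (rule INF_greatest)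
      fix \<mu> assume \<mu>: "\<mu> \<in> U"
      show "- ?L \<le> rate_function \<theta> \<mu>"
      proof (cases "(\<integral>\<^sup>+x. ennreal x \<partial>\<mu>) < \<infinity>")
        case True
        define R where "R = rate_value \<theta> (LINT x|\<mu>. x) (LINT x|\<mu>. x ^ 3)"
        have "- ?L \<le> ereal R + ereal e" if e: "0 < e" for e
        proof -
          have "ereal (- (R + e)) \<le> ?L"
          proof (rule Liminf_bounded)
            show "\<forall>\<^sub>F n in sequentially. ereal (- (R + e)) \<le> ereal (1 / S n) * ereal_ln (P n U)"
              using large_deviation_lower[OF N ab U \<mu> True e] S_pos
            proof eventually_elim
              case (elim n)
              have "ereal (- ((R + e) * S n)) \<le> ereal_ln (P n U)"
                by (rule ereal_ln_ge) (use elim in \<open>simp add: R_def P_def\<close>)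
              then have "ereal (1 / S n) * ereal (- ((R + e) * S n)) \<le> ereal (1 / S n) * ereal_ln (P n U)"
                using elim by (intro ereal_mult_left_mono) auto
              moreover have "ereal (1 / S n) * ereal (- ((R + e) * S n)) = ereal (- (R + e))"
                using elim by simp
              ultimately show ?case by simp
            qed
          qed
          then show ?thesis by (simp add: ereal_uminus_le_reorder)
        qed
        then have "- ?L \<le> ereal R" by (rule ereal_le_epsilon2)
        then show ?thesis unfolding rate_function_eq[OF True] R_def .
      next
        case False
        then show ?thesis by (simp add: rate_function_def)
      qed
    qed
    then show "- (INF x\<in>U. rate_function \<theta> x) \<le> ?L" by (simp add: ereal_uminus_le_reorder)
  next
    fix F assume F: "closedin vague_topology F"
    let ?L = "limsup (\<lambda>n. ereal (1 / S n) * ereal_ln (P n F))"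
    \<comment> \<open>Testing all real \<open>c\<close> below the infimum also covers the case that
      the infimum is infinite, such as for the empty set.\<close>
    have *: "?L \<le> - ereal c" if c: "ereal c < (INF x\<in>F. rate_function \<theta> x)" for c
    proof (rule Limsup_bounded)
      show "\<forall>\<^sub>F n in sequentially. ereal (1 / S n) * ereal_ln (P n F) \<le> - ereal c"
        using large_deviation_upper[OF N ab F c] S_pos
      proof eventually_elim
        case (elim n)
        have "ereal_ln (P n F) \<le> ereal (- (c * S n))"
          by (rule ereal_ln_le) (use elim in \<open>simp add: P_def\<close>)
        then have "ereal (1 / S n) * ereal_ln (P n F) \<le> ereal (1 / S n) * ereal (- (c * S n))"
          using elim by (intro ereal_mult_left_mono) auto
        also have "\<dots> = - ereal c" using elim by simp
        finally show ?case .
      qed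
    qed
    show "?L \<le> - (INF x\<in>F. rate_function \<theta> x)"
    proof (rule ccontr)
      assume "\<not> ?thesis"
      then have "- ?L < (INF x\<in>F. rate_function \<theta> x)" by (simp add: not_le ereal_uminus_less_reorder)
      then obtain c where c: "- ?L < ereal c" "ereal c < (INF x\<in>F. rate_function \<theta> x)" using ereal_dense2 by blast
      from *[OF c(2)] have "ereal c \<le> - ?L" by (metis ereal_minus_le_minus ereal_uminus_uminus)
      then show False using c(1) by simp
    qed
  qed
qed

end
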